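(* Let $n\ge2$ and $0<s<1$. There is a constant $\kappa=\kappa(n)>0$ such that the following holds. Let $\lambda\in\mathbb{R}$, let $\Omega$ be an unbounded domain in $\Sigma_\lambda$, and let $c:\Omega\to\mathbb{R}$ satisfy $$\liminf_{d(x,o)\to\infty}\ d(x,o)^{\,n+2s}\,e^{\kappa(n-1)d(x,o)}\,c(x)\ \ge\ 0 .$$ Then there exists a constant $R_0>0$, depending on $c(x)$ (and on $n,s,\lambda$), with the following property: if $u\in\mathcal{L}_s(\mathbb{H}^n)\cap C^{1,1}_{loc}(\Omega)$ is lower semi-continuous on $\bar\Omega$ and satisfies $$(-\Delta_{\mathbb{H}^n})^su+c(x)u\ge0\ \text{ in }\Omega,\qquad u\ge0\ \text{ in }\Sigma_\lambda\setminus\Omega,\qquad u(x^\lambda)=-u(x)\ \text{ in }\Sigma_\lambda,$$ and if $u$ attains its negative minimum at $x^0\in\Omega$ (i.e. $u(x^0)=\min_\Omega u<0$), then $d(x^0,o)\le R_0$.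
   Context: $\mathbb{H}^n$ is the $n$-dimensional hyperbolic space of constant sectional curvature $-1$, with geodesic distance $d$, volume element $d\xi$. Use the hyperboloid model $\mathbb{H}^n=\{x\in\mathbb{R}^{n+1}: x_0^2-x_1^2-\dots-x_n^2=1,\ x_0>0\}$ with origin $o=(1,0,\dots,0)$. For $t\in\mathbb{R}$ let $A_t$ be the boost $(x_0,x_1,x')\mapsto(x_0\cosh t+x_1\sinh t,\ x_0\sinh t+x_1\cosh t,\ x')$. Set $U=\mathbb{H}^n\cap\{x_1=0\}$, $U_t=A_t(U)$ (these hypersurfaces foliate $\mathbb{H}^n$), and $\Sigma_\lambda=\bigcup_{t<\lambda}U_t$. With $I(x_0,x_1,x')=(x_0,-x_1,x')$, the reflection in $U_\lambda$ is $I_\lambda=A_\lambda\circ I\circ A_{-\lambda}$, and $x^\lambda=I_\lambda(x)$. The fractional Laplacian is defined pointwise by $$(-\Delta_{\mathbb{H}^n})^su(x)=C_{n,s}\,\mathrm{P.V.}\int_{\mathbb{H}^n}(u(x)-u(\xi))\,\mathcal{K}_{n,s}(d(x,\xi))\,d\xi ,$$ where $C_{n,s}>0$ is a normalization constant and the positive kernel $\mathcal{K}_{n,s}$ is, up to a positive multiplicative constant, $$\mathcal{K}_{n,s}(\rho)=\left(-\frac{\partial_\rho}{\sinh\rho}\right)^{\frac{n-1}{2}}\left(\rho^{-\frac{1+2s}{2}}K_{\frac{1+2s}{2}}\left(\tfrac{n-1}{2}\rho\right)\right)\quad(n\ge3\text{ odd}),$$ $$\mathcal{K}_{n,s}(\rho)=\int_\rho^\infty\frac{\sinh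 r}{\sqrt{\cosh r-\cosh\rho}}\left(-\frac{\partial_r}{\sinh r}\right)^{\frac n2}\left(r^{-\frac{1+2s}{2}}K_{\frac{1+2s}{2}}\left(\tfrac{n-1}{2}r\right)\right)dr\quad(n\ge2\text{ even}),$$ with $K_\nu$ the modified Bessel function of the second kind. $\mathcal{L}_s(\mathbb{H}^n)$ denotes the set of measurable $u:\mathbb{H}^n\to\mathbb{R}$ with $\int_{\mathbb{H}^n}|u(\xi)|\,\mathcal{K}_{n,s}(1+d(\xi,o))\,d\xi<\infty$. *)

theory Defs
  imports "HOL-Analysis.Analysis"
begin

text \<open>
  Points of $\mathbb{R}^{n+1}$ are triples $(x_0,x_1,x')$ with $x' \in \mathbb{R}^{n-1}$, so the
  index type of $x'$ has $n-1$ elements. Hyperbolic space is a subset of this type; functions on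
  it are total HOL functions of which only the values on the hyperboloid are ever used.
\<close>

type_synonym 'k mink = "real \<times> real \<times> (real ^ 'k)"

definition hyperboloid :: "'k::finite mink set" where
  "hyperboloid = {(x0, x1, x'). x0\<^sup>2 - x1\<^sup>2 - (norm x')\<^sup>2 = 1 \<and> x0 > 0}"

definition origin :: "'k::finite mink" where
  "origin = (1, 0, 0)"

text \<open>The geodesic distance is given by $\cosh d(x,y) = x_0 y_0 - x_1 y_1 - x' \cdot y'$.\<close>

definition hdist :: "'k::finite mink \<Rightarrow> 'k mink \<Rightarrow> real" where
  "hdist = (\<lambda>(x0, x1, x') (y0, y1, y'). arcosh (x0 * y0 - x1 * y1 - x' \<bullet> y'))"

text \<open>The hyperboloid is the graph of $y \mapsto \sqrt{1+|y|^2}$ over $\mathbb{R}^n$.\<close>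

definition chart :: "real \<times> (real ^ 'k::finite) \<Rightarrow> 'k mink" where
  "chart y = (sqrt (1 + (norm y)\<^sup>2), y)"

lemma range_chart: "range chart = (hyperboloid :: 'k::finite mink set)"
proof (intro equalityI subsetI)
  fix x :: "'k mink" assume "x \<in> range chart"
  then obtain y where x: "x = chart y" by blast
  have "1 + (norm y)\<^sup>2 > 0" by (simp add: add_pos_nonneg)
  then show "x \<in> hyperboloid"
    by (cases y) (simp add: x chart_def hyperboloid_def norm_Pair)
next
  fix x :: "'k mink" assume "x \<in> hyperboloid"
  then obtain x0 x1 x' where x: "x = (x0, x1, x')" "x0\<^sup>2 - x1\<^sup>2 - (norm x')\<^sup>2 = 1" "x0 > 0"
    by (auto simp: hyperboloid_def)
  have "1 + (norm (x1, x'))\<^sup>2 = x0\<^sup>2" using x by (simp add: norm_Pair)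
  then have "x = chart (x1, x')" using x by (simp add: chart_def)
  then show "x \<in> range chart" by blast
qed

text \<open>
  In the coordinates of \<open>chart\<close> the metric induced by the Minkowski form is
  $g = \mathrm{Id} - y y^T/(1+|y|^2)$, whence $d\xi = \sqrt{\det g}\,dy = dy/\sqrt{1+|y|^2}$.
  The measure is completed so that measurability means Lebesgue measurability.
\<close>

definition hvol :: "'k::finite mink measure" where
  "hvol = completion (distr (density lborel (\<lambda>y. ennreal (1 / sqrt (1 + (norm y)\<^sup>2))))
     (restrict_space borel hyperboloid) chart)"

definition boost :: "real \<Rightarrow> 'k::finite mink \<Rightarrow> 'k mink" where
  "boost t = (\<lambda>(x0, x1, x'). (x0 * cosh t + x1 * sinh t, x0 * sinh t + x1 * cosh t, x'))"

definition U :: "real \<Rightarrow> 'k::finite mink set" where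
  "U t = boost t ` {x \<in> hyperboloid. fst (snd x) = 0}"

definition Sigma_half :: "real \<Rightarrow> 'k::finite mink set" where
  "Sigma_half lam = (\<Union>t\<in>{..<lam}. U t)"

definition refl0 :: "'k::finite mink \<Rightarrow> 'k mink" where
  "refl0 = (\<lambda>(x0, x1, x'). (x0, - x1, x'))"

definition hrefl :: "real \<Rightarrow> 'k::finite mink \<Rightarrow> 'k mink" where
  "hrefl lam = boost lam \<circ> refl0 \<circ> boost (- lam)"

text \<open>
  Modified Bessel function of the second kind for positive argument, by its classical integral
  representation, valid for every real order.
\<close>

definition Bessel_K :: "real \<Rightarrow> real \<Rightarrow> real" where
  "Bessel_K \<nu> z = (LBINT t:{0..}. exp (- z * cosh t) * cosh (\<nu> * t))"

definition sinh_deriv :: "(real \<Rightarrow> real) \<Rightarrow> real \<Rightarrow> real" where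
  "sinh_deriv f = (\<lambda>r. - deriv f r / sinh r)"

definition Bessel_profile :: "nat \<Rightarrow> real \<Rightarrow> real \<Rightarrow> real" where
  "Bessel_profile n s r =
     r powr (- (1 + 2 * s) / 2) * Bessel_K ((1 + 2 * s) / 2) ((real n - 1) / 2 * r)"

definition kernel :: "nat \<Rightarrow> real \<Rightarrow> real \<Rightarrow> real" where
  "kernel n s \<rho> =
     (if odd n then (sinh_deriv ^^ ((n - 1) div 2)) (Bessel_profile n s) \<rho>
      else (LBINT r:{\<rho><..}. sinh r / sqrt (cosh r - cosh \<rho>) *
              (sinh_deriv ^^ (n div 2)) (Bessel_profile n s) r))"

text \<open>
  \<open>n\<close> is the dimension $CARD('k) + 1$ of the hyperboloid. The constant \<open>C\<close> is $C_{n,s}$ times the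
  unspecified positive multiplicative constant of the kernel. The limit is the principal value.
\<close>

definition frac_laplacian ::
    "real \<Rightarrow> nat \<Rightarrow> real \<Rightarrow> ('k::finite mink \<Rightarrow> real) \<Rightarrow> 'k mink \<Rightarrow> real" where
  "frac_laplacian C n s u x = C * Lim (at_right 0) (\<lambda>\<epsilon>.
     LINT \<xi>:{\<xi> \<in> hyperboloid. \<epsilon> \<le> hdist x \<xi>}|hvol. (u x - u \<xi>) * kernel n s (hdist x \<xi>))"

definition L_space :: "nat \<Rightarrow> real \<Rightarrow> ('k::finite mink \<Rightarrow> real) set" where
  "L_space n s = {u \<in> borel_measurable hvol.
     (\<integral>\<^sup>+ \<xi>. ennreal (\<bar>u \<xi>\<bar> * kernel n s (1 + hdist \<xi> origin)) \<partial>hvol) < \<infinity>}"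

text \<open>
  $C^{1,1}_{loc}$ is read off in the global chart: \<open>g\<close> is the gradient of \<open>u \<circ> chart\<close>.
  It does not depend on the choice of smooth coordinates.
\<close>

definition C11_loc :: "'k::finite mink set \<Rightarrow> ('k mink \<Rightarrow> real) set" where
  "C11_loc \<Omega> = {u. \<exists>g :: real \<times> (real ^ 'k) \<Rightarrow> real \<times> (real ^ 'k).
     \<forall>y \<in> chart -` \<Omega>.
       ((\<lambda>z. u (chart z)) has_derivative (\<lambda>h. g y \<bullet> h)) (at y) \<and>
       (\<exists>r>0. \<exists>L. L-lipschitz_on (ball y r \<inter> chart -` \<Omega>) g)}"

definition lower_semicont_on :: "'a::topological_space set \<Rightarrow> ('a \<Rightarrow> real) \<Rightarrow> bool" where
  "lower_semicont_on S u \<longleftrightarrow>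
     (\<forall>x\<in>S. ereal (u x) \<le> Liminf (at x within S) (\<lambda>y. ereal (u y)))"

definition unbounded_domain :: "'k::finite mink set \<Rightarrow> bool" where
  "unbounded_domain \<Omega> \<longleftrightarrow>
     openin (top_of_set hyperboloid) \<Omega> \<and> connected \<Omega> \<and> (\<forall>R. \<exists>x\<in>\<Omega>. hdist x origin > R)"

text \<open>The filter on \<open>\<Omega>\<close> of $d(x,o) \to \infty$.\<close>

definition at_far :: "'k::finite mink set \<Rightarrow> 'k mink filter" where
  "at_far \<Omega> = inf (filtercomap (\<lambda>x. hdist x origin) at_top) (principal \<Omega>)"

end

theory Submission
  imports Defs
begin

text \<open>
  At a negative minimum $x^0$ the gradient of $u$ vanishes, so by $C^{1,1}$ regularity the singular
  integral converges absolutely. Folding it along the reflection and using that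
  $\mathcal{K}$ is decreasing and $d(x^0,\xi) \le d(x^0,\xi^\lambda)$, one gets
  $(-\Delta)^s u(x^0) \le 2 C u(x^0) \int_{\Sigma_\lambda} \mathcal{K}(d(x^0,\xi^\lambda)) d\xi$, hence
  $c(x^0) \le -2C \int_{\Sigma_\lambda} \mathcal{K}(d(x^0,\xi^\lambda)) d\xi$. The integral is at least
  a multiple of $\mathcal{K}(d(x^0,o)+R)$, which for $\kappa = 2$ contradicts the assumption on $c$ when
  $d(x^0,o)$ is large.

  For the kernel, $r^{-\nu}K_\nu(mr)$ is a product of Laplace transforms of positive measures, and
  $1/\sinh r = e^{-r}(\coth r+1)$ is completely monotone as well. Hence all terms arising in the iterated
  derivatives have the same sign, and bounding them one by one shows that
  $\mathcal{K}$ is positive, decreasing, of order $e^{-(n-1)r} r^{-1-s}$ at infinity and less singular than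
  $r^{-n-2}$ at $0$.
\<close>

section \<open>Moments of the modified Bessel function\<close>

text \<open>The kernel is needed in two regimes for different reasons. The principal value is a
  \<open>Lim\<close>, which carries information only once convergence is proved; at the minimum u(x)
  - u is quadratically small, so K must be less singular than r^(-n-2). Far away only membership in
  \<open>L_space\<close> is known, so K(d(x,\<xi>)) has to be compared with the weight K(1 +
  d(\<xi>,o)), which asks for upper and lower bounds of the same order. There e^(-(n-1)r) only just
  cancels the growth of volume, and r^(-1-s) alone makes constants integrable, so a cruder decay
  rate would not do.

  Two coordinate systems are used: the graph chart, comparable with the Euclidean metric near a
  point, for regularity and singularity; and Fermi coordinates, in which volume is Lebesgue measure
  and the reflection is affine. The value \<kappa> = 2 has slack: the factor d^(n+2s) already beats
  d^(1+s), and the spare e^((n-1)d) keeps the last computation short.\<close>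

lemma real_le_sinh:
  fixes x :: real assumes "0 \<le> x" shows "x \<le> sinh x"
proof -
  have "sinh 0 - 0 \<le> sinh x - x"
  proof (rule DERIV_nonneg_imp_nondecreasing[OF assms])
    fix y :: real assume "0 \<le> y"
    have "((\<lambda>x. sinh x - x) has_real_derivative cosh y - 1) (at y)"
      by (auto intro!: derivative_eq_intros)
    then show "\<exists>d. ((\<lambda>x. sinh x - x) has_real_derivative d) (at y) \<and> 0 \<le> d"
      using cosh_real_ge_1[of y] by force
  qed
  then show ?thesis by simp
qed

lemma cosh_ge_quadratic:
  fixes t :: real shows "1 + t\<^sup>2 / 2 \<le> cosh t"
proof -
  have "(\<bar>t\<bar>/2)\<^sup>2 \<le> (sinh (\<bar>t\<bar>/2))\<^sup>2"
    by (rule power_mono[OF real_le_sinh]) auto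
  moreover have "cosh \<bar>t\<bar> = 1 + 2 * (sinh (\<bar>t\<bar>/2))\<^sup>2"
    using cosh_double[of "\<bar>t\<bar>/2"] cosh_square_eq[of "\<bar>t\<bar>/2"] by simp
  ultimately show ?thesis by (simp add: power_divide)
qed

lemma exp_half_le_cosh: "exp t / 2 \<le> cosh (t::real)"
  by (simp add: cosh_field_def)

lemma cosh_le_exp_real: "0 \<le> t \<Longrightarrow> cosh t \<le> exp (t::real)"
  using cosh_plus_sinh[of t] by (metis add.commute le_add_same_cancel2 sinh_real_nonneg_iff)

text \<open>From 1 + y <= (Q+1)(1 + y/(Q+1)) and 1 + x <= e^x. The exponent is raised to Q + 1 first
  so that the division is harmless at Q = 0.\<close>

lemma powr_le_exp:
  fixes Q y :: real assumes "0 \<le> Q" "0 \<le> y"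
  shows "(1 + y) powr Q \<le> (Q + 1) powr (Q + 1) * exp y"
proof -
  have "(1 + y) powr Q \<le> (1 + y) powr (Q + 1)" using assms by (intro powr_mono) auto
  also have "\<dots> \<le> ((Q + 1) * (1 + y / (Q + 1))) powr (Q + 1)"
    using assms by (intro powr_mono2) (auto simp: field_simps)
  also have "\<dots> = (Q + 1) powr (Q + 1) * (1 + y / (Q + 1)) powr (Q + 1)"
    using assms by (simp only: powr_mult)
  also have "(1 + y / (Q + 1)) powr (Q + 1) \<le> exp (y / (Q + 1)) powr (Q + 1)"
    using assms by (intro powr_mono2) (simp_all add: add_nonneg_nonneg)
  also have "\<dots> = exp y" using assms by (simp add: exp_powr_real)
  finally show ?thesis using assms by (simp add: mult_left_mono)
qed

text \<open>The factor $m^i$ makes \<open>- bessel_moment m \<nu> (Suc i)\<close> the derivative of \<open>bessel_moment m \<nu> i\<close>.\<close>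

definition moment_integrand :: "real \<Rightarrow> real \<Rightarrow> nat \<Rightarrow> real \<Rightarrow> real \<Rightarrow> real" where
  "moment_integrand m \<nu> i r t = (m * cosh t) ^ i * exp (- (m * r) * cosh t) * cosh (\<nu> * t)"

definition bessel_moment :: "real \<Rightarrow> real \<Rightarrow> nat \<Rightarrow> real \<Rightarrow> real" where
  "bessel_moment m \<nu> i r = (LBINT t:{0..}. moment_integrand m \<nu> i r t)"

text \<open>With X = cosh t, e^(-m r X) is e^(-m r) times two equal factors e^(-a(X-1)), a = m r/2.
  One absorbs the power X^(i+\<nu>+\<delta>) at the price of (1 + 1/r)^(i+\<nu>+\<delta>); the other
  gives decay in t at rate sqrt(m r), whose integral later produces the factor (1+r)^(-1/2). The
  compensating X^(-\<delta>) keeps a decay e^(-\<delta> t) that does not degenerate as r tends to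
  0.\<close>

lemma moment_integrand_bound:
  assumes m: "m > 0" and nu: "\<nu> \<ge> 0" and d: "\<delta> > 0"
  obtains C where "C > 0"
    "\<And>r t. r > 0 \<Longrightarrow> t \<ge> 0 \<Longrightarrow> moment_integrand m \<nu> i r t
       \<le> C * exp (- m * r) * (1 + 1 / r) powr (i + \<nu> + \<delta>) * exp (- (\<delta> + sqrt (m * r)) * t)"
proof
  let ?Q = "i + \<nu> + \<delta>"
  let ?C = "m ^ i * 2 powr \<nu> * 2 powr \<delta> * (1 + 2 / m) powr ?Q * ((?Q + 1) powr (?Q + 1)) * exp 1"
  have Q: "?Q > 0" using nu d by simp
  have "1 + 2 / m > 0" using m by (simp add: add_pos_pos)
  then show "?C > 0" using m Q by (intro mult_pos_pos) auto
  fix r t :: real assume r: "r > 0" and t: "t \<ge> 0"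
  define X where "X = cosh t"
  define a where "a = m * r / 2"
  have a: "a > 0" using m r by (simp add: a_def)
  have X1: "X \<ge> 1" by (simp add: X_def cosh_real_ge_1)
  have Xt: "X \<ge> 1 + t\<^sup>2 / 2" by (simp add: X_def cosh_ge_quadratic)
  have Xe: "exp t / 2 \<le> X" unfolding X_def by (rule exp_half_le_cosh)
  have 1: "cosh (\<nu> * t) \<le> 2 powr \<nu> * X powr \<nu>"
  proof -
    have "cosh (\<nu> * t) \<le> exp (\<nu> * t)" using nu t by (intro cosh_le_exp_real) auto
    also have "\<dots> = exp t powr \<nu>" by (simp add: exp_powr_real mult.commute)
    also have "\<dots> \<le> (2 * X) powr \<nu>" using nu Xe by (intro powr_mono2) auto
    finally show ?thesis using X1 by (simp add: powr_mult)
  qed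
  have 2: "X powr (- \<delta>) \<le> 2 powr \<delta> * exp (- \<delta> * t)"
  proof -
    have "X powr (- \<delta>) \<le> (exp t / 2) powr (- \<delta>)"
      using d Xe by (intro powr_mono2') auto
    also have "\<dots> = 2 powr \<delta> * exp (- \<delta> * t)"
      by (simp add: powr_divide exp_powr_real powr_minus field_simps exp_minus)
    finally show ?thesis .
  qed
  have 3: "X powr ?Q * exp (- a * (X - 1)) \<le> (1 + 2/m) powr ?Q * (1 + 1/r) powr ?Q * (?Q+1) powr (?Q+1)"
  proof -
    have "(1 + 1 / a) * (1 + a * (X - 1)) = X + (a * (X - 1) + 1 / a)" using a by (simp add: field_simps)
    moreover have "0 \<le> a * (X - 1) + 1 / a" using a X1 by simp
    ultimately have "X \<le> (1 + 1 / a) * (1 + a * (X - 1))" by simp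
    then have "X powr ?Q \<le> ((1 + 1 / a) * (1 + a * (X - 1))) powr ?Q"
      using X1 Q by (intro powr_mono2) auto
    also have "\<dots> = (1 + 1 / a) powr ?Q * (1 + a * (X - 1)) powr ?Q"
      using a X1 by (simp only: powr_mult)
    also have "\<dots> \<le> (1 + 1 / a) powr ?Q * ((?Q+1) powr (?Q+1) * exp (a * (X - 1)))"
      using powr_le_exp[of ?Q "a * (X - 1)"] a X1 Q by (intro mult_left_mono) auto
    finally have "X powr ?Q * exp (- a * (X - 1)) \<le>
      ((1 + 1 / a) powr ?Q * ((?Q+1) powr (?Q+1) * exp (a * (X - 1)))) * exp (- a * (X - 1))"
      by (intro mult_right_mono) auto
    moreover have "exp (a * (X - 1)) * exp (- a * (X - 1)) = 1" by (simp flip: exp_add)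
    ultimately have A: "X powr ?Q * exp (- a * (X - 1)) \<le> (1 + 1 / a) powr ?Q * (?Q+1) powr (?Q+1)"
      by (simp only: mult.assoc mult_1_right)
    have "1 + 1 / a \<le> (1 + 2/m) * (1 + 1/r)"
      using m r by (simp add: a_def field_simps)
    then have "(1 + 1 / a) powr ?Q \<le> ((1 + 2/m) * (1 + 1/r)) powr ?Q"
      using a Q by (intro powr_mono2) auto
    also have "\<dots> = (1 + 2/m) powr ?Q * (1 + 1/r) powr ?Q" using m r by (simp only: powr_mult)
    finally have "(1 + 1 / a) powr ?Q * (?Q+1) powr (?Q+1) \<le> (1 + 2/m) powr ?Q * (1 + 1/r) powr ?Q * (?Q+1) powr (?Q+1)"
      by (intro mult_right_mono) auto
    with A show ?thesis by linarith
  qed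
  have 4: "exp (- a * (X - 1)) \<le> exp 1 * exp (- sqrt (m * r) * t)"
  proof -
    \<comment> \<open>Completing the square trades the Gaussian decay coming from cosh t >= 1 +
      t^2/2 for an exponential one, at the cost of a factor e.\<close>
    have "0 \<le> (sqrt (m * r) * t / 2 - 1)\<^sup>2" by simp
    then have "sqrt (m * r) * t \<le> 1 + m * r * t\<^sup>2 / 4"
      using m r by (simp add: power2_eq_square algebra_simps)
    also have "m * r * t\<^sup>2 / 4 \<le> a * (X - 1)"
      using mult_left_mono[OF Xt, of a] a by (simp add: a_def algebra_simps)
    finally have "- a * (X - 1) \<le> 1 + (- sqrt (m * r) * t)" by simp
    then show ?thesis by (metis exp_add exp_le_cancel_iff)
  qed
  have "moment_integrand m \<nu> i r t = m ^ i * X powr i * exp (- m * r * X) * cosh (\<nu> * t)"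
    using X1 by (simp add: moment_integrand_def X_def powr_realpow power_mult_distrib)
  also have "\<dots> \<le> m ^ i * X powr i * exp (- m * r * X) * (2 powr \<nu> * X powr \<nu>)"
    using 1 m X1 by (intro mult_left_mono) auto
  also have "\<dots> = m ^ i * 2 powr \<nu> * exp (- m * r) * (X powr (-\<delta>) * ((X powr ?Q * exp (- a * (X - 1))) * exp (- a * (X - 1))))"
  proof -
    have "X powr i * X powr \<nu> = X powr (-\<delta>) * X powr ?Q" using X1 by (simp flip: powr_add)
    moreover have "exp (- m * r * X) = exp (- m * r) * (exp (- a * (X - 1)) * exp (- a * (X - 1)))"
      by (simp add: a_def field_simps flip: exp_add)
    ultimately show ?thesis by (simp add: algebra_simps)
  qed
  also have "\<dots> \<le> m ^ i * 2 powr \<nu> * exp (- m * r) * ((2 powr \<delta> * exp (- \<delta> * t)) *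
     (((1 + 2/m) powr ?Q * (1 + 1/r) powr ?Q * (?Q+1) powr (?Q+1)) * (exp 1 * exp (- sqrt (m * r) * t))))"
    using m by (intro mult_left_mono[OF mult_mono[OF 2 mult_mono[OF 3 4]]]) auto
  also have "\<dots> = ?C * exp (- m * r) * (1 + 1 / r) powr ?Q * exp (- (\<delta> + sqrt (m * r)) * t)"
  proof -
    have e: "exp (- (\<delta> + sqrt (m * r)) * t) = exp (- \<delta> * t) * exp (- sqrt (m * r) * t)"
      by (simp add: algebra_simps flip: exp_add)
    show ?thesis unfolding e by (simp only: mult_ac)
  qed
  finally show "moment_integrand m \<nu> i r t \<le> \<dots>" .
qed

section \<open>Integrability and differentiation of the moments\<close>

lemma nn_integral_exp_atLeast:
  assumes c: "(c::real) > 0"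
  shows "(\<integral>\<^sup>+t. ennreal (exp (- c * t)) * indicator {0..} t \<partial>lborel) = ennreal (1 / c)"
proof -
  have "(\<integral>\<^sup>+t. ennreal (exp (- c * t)) * indicator {0..} t \<partial>lborel) = 0 - (- exp (- c * 0) / c)"
  proof (rule nn_integral_FTC_atLeast)
    show "((\<lambda>t. - exp (- c * t) / c) has_real_derivative exp (- c * x)) (at x)" for x
      using c by (auto intro!: derivative_eq_intros)
    have "((\<lambda>t. - exp (- c * t) / c) \<longlongrightarrow> - 0 / c) at_top"
      using c
      by (intro tendsto_intros filterlim_compose[OF exp_at_bot] filterlim_tendsto_neg_mult_at_bot[OF tendsto_const]) (auto intro: filterlim_ident)
    then show "((\<lambda>t. - exp (- c * t) / c) \<longlongrightarrow> 0) at_top" by simp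
  qed auto
  then show ?thesis by simp
qed

lemma set_integrable_exp_atLeast:
  assumes c: "(c::real) > 0"
  shows "set_integrable lborel {0..} (\<lambda>t. exp (- c * t))"
    and "(LBINT t:{0..}. exp (- c * t)) = 1 / c"
proof -
  have *: "(\<integral>\<^sup>+t. ennreal (indicator {0..} t *\<^sub>R exp (- c * t)) \<partial>lborel) = ennreal (1 / c)"
    unfolding nn_integral_exp_atLeast[OF c, symmetric]
    by (rule nn_integral_cong) (auto simp: indicator_def)
  show "set_integrable lborel {0..} (\<lambda>t. exp (- c * t))"
    unfolding set_integrable_def by (rule integrableI_nonneg) (simp_all only: *, auto)
  show "(LBINT t:{0..}. exp (- c * t)) = 1 / c"
    unfolding set_lebesgue_integral_def
    by (subst integral_eq_nn_integral, simp, simp, subst *) (use c in simp)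
qed

lemma cosh_le_quadratic:
  fixes t :: real assumes "0 \<le> t" "t \<le> 1"
  shows "cosh t \<le> 1 + (cosh 1)\<^sup>2 * t\<^sup>2"
proof -
  have "sinh (t/2) \<le> cosh 1 * (t/2)"
  proof -
    have "sinh (t/2) - cosh 1 * (t/2) \<le> sinh 0 - cosh 1 * 0"
    proof (rule DERIV_nonpos_imp_nonincreasing[where f = "\<lambda>x. sinh x - cosh 1 * x"])
      fix y :: real assume y: "0 \<le> y" "y \<le> t / 2"
      have "((\<lambda>x. sinh x - cosh 1 * x) has_real_derivative cosh y - cosh 1) (at y)"
        by (auto intro!: derivative_eq_intros)
      moreover have "cosh y \<le> cosh 1" using y assms by (subst cosh_real_nonneg_le_iff) auto
      ultimately show "\<exists>d. ((\<lambda>x. sinh x - cosh 1 * x) has_real_derivative d) (at y) \<and> d \<le> 0"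
        by force
    qed (use assms in auto)
    then show ?thesis by simp
  qed
  then have "(sinh (t/2))\<^sup>2 \<le> (cosh 1 * (t/2))\<^sup>2" using assms by (intro power_mono) auto
  moreover have "cosh t = 1 + 2 * (sinh (t/2))\<^sup>2"
    using cosh_double[of "t/2"] cosh_square_eq[of "t/2"] by simp
  ultimately have "cosh t \<le> 1 + (cosh 1)\<^sup>2 * t\<^sup>2 / 2" by (simp add: power_mult_distrib power_divide)
  also have "\<dots> \<le> 1 + (cosh 1)\<^sup>2 * t\<^sup>2" by (simp add: zero_le_mult_iff)
  finally show ?thesis .
qed

lemma borel_moment_integrand [measurable]: "moment_integrand m \<nu> i r \<in> borel_measurable borel"
  unfolding moment_integrand_def
  by (intro borel_measurable_continuous_onI continuous_intros)

lemma moment_integrand_nonneg: "m > 0 \<Longrightarrow> 0 \<le> moment_integrand m \<nu> i r t"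
  by (simp add: moment_integrand_def)

lemma moment_integrable:
  assumes "m > 0" "\<nu> \<ge> 0" "r > 0"
  shows "set_integrable lborel {0..} (moment_integrand m \<nu> i r)"
proof -
  obtain C where C: "C > 0" "\<And>r t. r > 0 \<Longrightarrow> t \<ge> 0 \<Longrightarrow> moment_integrand m \<nu> i r t
       \<le> C * exp (- m * r) * (1 + 1 / r) powr (i + \<nu> + 1) * exp (- (1 + sqrt (m * r)) * t)"
    by (rule moment_integrand_bound[OF assms(1,2), of 1]) auto
  show ?thesis
  proof (rule set_integrable_bound)
    show "set_integrable lborel {0..} (\<lambda>t. C * exp (- m * r) * (1 + 1 / r) powr (i + \<nu> + 1) * exp (- (1 + sqrt (m * r)) * t))"
      using assms by (intro set_integrable_mult_right set_integrable_exp_atLeast) (auto simp: add_pos_nonneg)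
    show "AE t in lborel. t \<in> {0..} \<longrightarrow> norm (moment_integrand m \<nu> i r t)
       \<le> norm (C * exp (- m * r) * (1 + 1 / r) powr (i + \<nu> + 1) * exp (- (1 + sqrt (m * r)) * t))"
      using C assms moment_integrand_nonneg[OF assms(1), of \<nu> i r] by (auto simp: abs_mult)
  qed (simp add: set_borel_measurable_def)
qed

lemma bessel_moment_nonneg: "m > 0 \<Longrightarrow> 0 \<le> bessel_moment m \<nu> i r"
  unfolding bessel_moment_def set_lebesgue_integral_def
  by (intro integral_nonneg_AE) (simp add: moment_integrand_nonneg)

text \<open>The function x -> e^(-b x) is convex, so its secant slope lies between the slopes at
  both ends (e^z >= 1 + z at z = b(y-x) and at z = -b(y-x)); integration over t with b = m cosh t
  preserves this. These secant bounds take the place of differentiation under the integral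
  sign.\<close>

lemma bessel_moment_diff_bounds:
  assumes m: "m > 0" and nu: "\<nu> \<ge> 0" and xy: "0 < x" "x \<le> y"
  shows "bessel_moment m \<nu> (Suc i) y * (y - x) \<le> bessel_moment m \<nu> i x - bessel_moment m \<nu> i y"
    and "bessel_moment m \<nu> i x - bessel_moment m \<nu> i y \<le> bessel_moment m \<nu> (Suc i) x * (y - x)"
proof -
  have y: "0 < y" using xy by simp
  note I = moment_integrable[OF m nu xy(1)] moment_integrable[OF m nu y]
  have pw: "moment_integrand m \<nu> (Suc i) y t * (y - x) \<le> moment_integrand m \<nu> i x t - moment_integrand m \<nu> i y t"
           "moment_integrand m \<nu> i x t - moment_integrand m \<nu> i y t \<le> moment_integrand m \<nu> (Suc i) x t * (y - x)" for t
  proof -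
    define b where "b = m * cosh t"
    have b: "b > 0" using m by (simp add: b_def)
    have "exp (- b * x) = exp (- b * y) * exp (b * (y - x))" by (simp add: field_simps flip: exp_add)
    moreover have "1 + b * (y - x) \<le> exp (b * (y - x))" by simp
    ultimately have 1: "b * exp (- b * y) * (y - x) \<le> exp (- b * x) - exp (- b * y)"
      using mult_left_mono[of "1 + b * (y - x)" "exp (b * (y - x))" "exp (- b * y)"] by (simp add: algebra_simps)
    have "exp (- b * y) = exp (- b * x) * exp (- b * (y - x))" by (simp add: field_simps flip: exp_add)
    moreover have "1 + - b * (y - x) \<le> exp (- b * (y - x))" by (rule exp_ge_add_one_self)
    ultimately have 2: "exp (- b * x) - exp (- b * y) \<le> b * exp (- b * x) * (y - x)"
      using mult_left_mono[of "1 + - b * (y - x)" "exp (- b * (y - x))" "exp (- b * x)"] by (simp add: algebra_simps)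
    have w: "0 \<le> b ^ i * cosh (\<nu> * t)" using b by simp
    show "moment_integrand m \<nu> (Suc i) y t * (y - x) \<le> moment_integrand m \<nu> i x t - moment_integrand m \<nu> i y t"
      using mult_left_mono[OF 1 w] by (simp add: moment_integrand_def b_def algebra_simps)
    show "moment_integrand m \<nu> i x t - moment_integrand m \<nu> i y t \<le> moment_integrand m \<nu> (Suc i) x t * (y - x)"
      using mult_left_mono[OF 2 w] by (simp add: moment_integrand_def b_def algebra_simps)
  qed
  have "(LBINT t:{0..}. moment_integrand m \<nu> (Suc i) y t * (y - x)) \<le> (LBINT t:{0..}. moment_integrand m \<nu> i x t - moment_integrand m \<nu> i y t)"
    by (intro set_integral_mono set_integral_diff set_integrable_mult_left impI I pw)
  then show "bessel_moment m \<nu> (Suc i) y * (y - x) \<le> bessel_moment m \<nu> i x - bessel_moment m \<nu> i y"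
    unfolding bessel_moment_def by (simp add: set_integral_diff I)
  have "(LBINT t:{0..}. moment_integrand m \<nu> i x t - moment_integrand m \<nu> i y t) \<le> (LBINT t:{0..}. moment_integrand m \<nu> (Suc i) x t * (y - x))"
    by (intro set_integral_mono set_integral_diff set_integrable_mult_left impI I pw)
  then show "bessel_moment m \<nu> i x - bessel_moment m \<nu> i y \<le> bessel_moment m \<nu> (Suc i) x * (y - x)"
    unfolding bessel_moment_def by (simp add: set_integral_diff I)
qed

text \<open>Suits a monotone candidate derivative: if secant slopes lie between its values at x and
  at r, their error is at most the difference of these values, and continuity of the candidate
  finishes.\<close>

lemma DERIV_squeeze:
  fixes f g :: "real \<Rightarrow> real"
  assumes ev: "\<forall>\<^sub>F x in at r. \<bar>(f x - f r) - D * (x - r)\<bar> \<le> \<bar>g x - g r\<bar> * \<bar>x - r\<bar>"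
    and g: "isCont g r"
  shows "(f has_real_derivative D) (at r)"
  unfolding has_field_derivative_iff
proof (rule Lim_transform)
  have "((\<lambda>x. \<bar>g x - g r\<bar>) \<longlongrightarrow> \<bar>g r - g r\<bar>) (at r)"
    using g by (intro tendsto_intros) (simp add: isCont_def)
  then have "((\<lambda>x. \<bar>g x - g r\<bar>) \<longlongrightarrow> 0) (at r)" by simp
  then show "((\<lambda>x. (f x - f r) / (x - r) - D) \<longlongrightarrow> 0) (at r)"
  proof (rule Lim_null_comparison[rotated])
    have "\<forall>\<^sub>F x in at r. x \<noteq> r" by (simp add: eventually_at_filter)
    with ev show "\<forall>\<^sub>F x in at r. norm ((f x - f r) / (x - r) - D) \<le> \<bar>g x - g r\<bar>"
    proof eventually_elim
      case (elim x)
      have "(f x - f r) / (x - r) - D = ((f x - f r) - D * (x - r)) / (x - r)"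
        using elim by (simp add: field_simps)
      then show ?case using elim by (simp add: abs_divide pos_divide_le_eq)
    qed
  qed
qed auto

text \<open>The secant bounds are used twice: they make every moment locally Lipschitz, hence
  continuous, and then continuity of moment \<open>Suc i\<close> squeezes the difference quotient of
  moment \<open>i\<close>.\<close>

lemma bessel_moment_DERIV:
  assumes m: "m > 0" and nu: "\<nu> \<ge> 0" and r: "r > 0"
  shows "(bessel_moment m \<nu> i has_real_derivative - bessel_moment m \<nu> (Suc i) r) (at r)"
proof -
  let ?k = "bessel_moment m \<nu>"
  note B = bessel_moment_diff_bounds[OF m nu]
  have anti: "?k i y \<le> ?k i x" if "0 < x" "x \<le> y" for x y i
    using B(1)[OF that, of i] bessel_moment_nonneg[OF m, of \<nu> "Suc i" y] that
    by (smt (verit) mult_nonneg_nonneg)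
  \<comment> \<open>Staying above r/2 makes the next moment at r/2 a uniform Lipschitz constant near
    r.\<close>
  have evr: "\<forall>\<^sub>F x in at r. x > r / 2"
    using r by (intro order_tendstoD(1)[OF tendsto_ident_at]) auto
  have cont: "isCont (?k i) r" for i
  proof -
    have "((\<lambda>x. ?k i x - ?k i r) \<longlongrightarrow> 0) (at r)"
    proof (rule Lim_null_comparison)
      have "((\<lambda>x. ?k (Suc i) (r/2) * \<bar>x - r\<bar>) \<longlongrightarrow> ?k (Suc i) (r/2) * \<bar>r - r\<bar>) (at r)"
        by (intro tendsto_intros)
      then show "((\<lambda>x. ?k (Suc i) (r/2) * \<bar>x - r\<bar>) \<longlongrightarrow> 0) (at r)" by simp
      show "\<forall>\<^sub>F x in at r. norm (?k i x - ?k i r) \<le> ?k (Suc i) (r/2) * \<bar>x - r\<bar>"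
        using evr
      proof eventually_elim
        case (elim x)
        show ?case
        proof (cases "x \<le> r")
          case True
          have "0 \<le> ?k i x - ?k i r" using anti[of x r i] True elim r by simp
          moreover have "?k i x - ?k i r \<le> ?k (Suc i) x * (r - x)" using B(2)[of x r i] True elim r by simp
          moreover have "\<dots> \<le> ?k (Suc i) (r/2) * (r - x)"
            using anti[of "r/2" x "Suc i"] True elim r by (intro mult_right_mono) auto
          moreover have "\<bar>x - r\<bar> = r - x" using True by simp
          ultimately show ?thesis unfolding real_norm_def by (simp only:)
        next
          case False
          have "0 \<le> ?k i r - ?k i x" using anti[of r x i] False elim r by simp
          moreover have "?k i r - ?k i x \<le> ?k (Suc i) r * (x - r)" using B(2)[of r x i] False elim r by simp
          moreover have "\<dots> \<le> ?k (Suc i) (r/2) * (x - r)"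
            using anti[of "r/2" r "Suc i"] False elim r by (intro mult_right_mono) auto
          moreover have "\<bar>x - r\<bar> = x - r" using False by simp
          ultimately show ?thesis unfolding real_norm_def by (simp only:)
        qed
      qed
    qed
    then show ?thesis by (simp add: isCont_def LIM_zero_iff)
  qed
  show ?thesis
  proof (rule DERIV_squeeze[OF _ cont[of "Suc i"]])
    show "\<forall>\<^sub>F x in at r. \<bar>?k i x - ?k i r - (- ?k (Suc i) r) * (x - r)\<bar>
            \<le> \<bar>?k (Suc i) x - ?k (Suc i) r\<bar> * \<bar>x - r\<bar>"
      using evr
    proof eventually_elim
      case (elim x)
      show ?case
      proof (cases "x \<le> r")
        case True
        have "?k (Suc i) r * (r - x) \<le> ?k i x - ?k i r" "?k i x - ?k i r \<le> ?k (Suc i) x * (r - x)"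
          using B[of x r i] True elim r by simp_all
        moreover have "\<bar>?k (Suc i) x - ?k (Suc i) r\<bar> = ?k (Suc i) x - ?k (Suc i) r"
          using anti[of x r "Suc i"] True elim r by simp
        moreover have "\<bar>x - r\<bar> = r - x" using True by simp
        ultimately show ?thesis by (simp only: abs_le_iff) (simp add: algebra_simps)
      next
        case False
        have "?k (Suc i) x * (x - r) \<le> ?k i r - ?k i x" "?k i r - ?k i x \<le> ?k (Suc i) r * (x - r)"
          using B[of r x i] False elim r by simp_all
        moreover have "\<bar>?k (Suc i) x - ?k (Suc i) r\<bar> = ?k (Suc i) r - ?k (Suc i) x"
          using anti[of r x "Suc i"] False elim r by simp
        moreover have "\<bar>x - r\<bar> = x - r" using False by simp
        ultimately show ?thesis by (simp only: abs_le_iff) (simp add: algebra_simps)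
      qed
    qed
  qed
qed

text \<open>Because cosh t >= 1. As the next moment is minus the derivative, this turns a lower
  bound for a moment into one for its derivative.\<close>

lemma bessel_moment_Suc_ge:
  assumes m: "m > 0" and nu: "\<nu> \<ge> 0" and r: "r > 0"
  shows "m * bessel_moment m \<nu> i r \<le> bessel_moment m \<nu> (Suc i) r"
proof -
  have "(LBINT t:{0..}. m * moment_integrand m \<nu> i r t) \<le> (LBINT t:{0..}. moment_integrand m \<nu> (Suc i) r t)"
  proof (intro set_integral_mono set_integrable_mult_right impI moment_integrable[OF m nu r])
    fix t :: real
    have "m * moment_integrand m \<nu> i r t \<le> (m * cosh t) * moment_integrand m \<nu> i r t"
      using m cosh_real_ge_1[of t] by (intro mult_right_mono moment_integrand_nonneg) auto
    then show "m * moment_integrand m \<nu> i r t \<le> moment_integrand m \<nu> (Suc i) r t"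
      by (simp add: moment_integrand_def)
  qed
  then show ?thesis by (simp add: bessel_moment_def)
qed

section \<open>Two-sided estimates of the moments\<close>

lemma set_integral_mono_subset:
  fixes f :: "'a \<Rightarrow> real"
  assumes "set_integrable M B f" "A \<subseteq> B" "\<And>x. x \<in> B \<Longrightarrow> 0 \<le> f x"
  shows "(LINT x:A|M. f x) \<le> (LINT x:B|M. f x)"
  unfolding set_lebesgue_integral_def
  by (rule integral_mono') (use assms in \<open>auto simp: set_integrable_def indicator_def\<close>)

lemma bessel_moment_upper:
  assumes m: "m > 0" and nu: "\<nu> \<ge> 0" and d: "\<delta> > 0"
  obtains C where "C > 0"
    "\<And>r. r > 0 \<Longrightarrow> bessel_moment m \<nu> i r
       \<le> C * exp (- m * r) * (1 + r) powr (- 1 / 2) * (1 + 1 / r) powr (i + \<nu> + \<delta>)"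
proof -
  obtain C where C: "C > 0" "\<And>r t. r > 0 \<Longrightarrow> t \<ge> 0 \<Longrightarrow> moment_integrand m \<nu> i r t
       \<le> C * exp (- m * r) * (1 + 1 / r) powr (i + \<nu> + \<delta>) * exp (- (\<delta> + sqrt (m * r)) * t)"
    by (rule moment_integrand_bound[OF m nu d]) auto
  \<comment> \<open>Chosen so that a sqrt(1 + r) <= \<delta> + sqrt(m r) at small and at large r
    alike: \<delta> serves the constant part, sqrt m the growing one.\<close>
  define a where "a = min \<delta> (sqrt m)"
  have a: "a > 0" using m d by (simp add: a_def)
  show ?thesis
  proof (rule that)
    show "C / a > 0" using C a by simp
    fix r :: real assume r: "r > 0"
    let ?c = "\<delta> + sqrt (m * r)" and ?E = "C * exp (- m * r) * (1 + 1 / r) powr (i + \<nu> + \<delta>)"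
    have c: "?c > 0" using m r d by (simp add: add_pos_nonneg)
    have E: "?E \<ge> 0" using C by simp
    have "a * sqrt (1 + r) \<le> a * (1 + sqrt r)"
    proof (rule mult_left_mono)
      have "sqrt (1 + r) \<le> sqrt 1 + sqrt r" using r by (intro sqrt_add_le_add_sqrt) auto
      then show "sqrt (1 + r) \<le> 1 + sqrt r" by simp
    qed (use a in simp)
    also have "\<dots> \<le> ?c"
    proof -
      have "a * sqrt r \<le> sqrt m * sqrt r" using r by (intro mult_right_mono) (auto simp: a_def)
      moreover have "a \<le> \<delta>" by (simp add: a_def)
      ultimately show ?thesis by (simp add: algebra_simps real_sqrt_mult)
    qed
    finally have ac: "a * sqrt (1 + r) \<le> ?c" .
    have "bessel_moment m \<nu> i r \<le> (LBINT t:{0..}. ?E * exp (- ?c * t))"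
      unfolding bessel_moment_def
      using C(2)[OF r] set_integrable_exp_atLeast(1)[OF c]
      by (intro set_integral_mono moment_integrable[OF m nu r] set_integrable_mult_right) auto
    also have "\<dots> = ?E * (LBINT t:{0..}. exp (- ?c * t))" by (rule set_integral_mult_right)
    also have "\<dots> = ?E * (1 / ?c)" by (simp only: set_integrable_exp_atLeast(2)[OF c])
    also have "\<dots> \<le> ?E * (1 / (a * sqrt (1 + r)))"
      using ac a r E by (intro mult_left_mono divide_left_mono) (auto intro!: mult_pos_pos c add_pos_pos)
    also have "\<dots> = C / a * exp (- m * r) * (1 + r) powr (- 1 / 2) * (1 + 1 / r) powr (i + \<nu> + \<delta>)"
      using r by (simp add: powr_minus_divide powr_half_sqrt)
    finally show "bessel_moment m \<nu> i r \<le> \<dots>" .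
  qed
qed

text \<open>Laplace's method in crude form: for 0 <= t <= (1+r)^(-1/2) the quantity r (cosh t - 1)
  stays below (cosh 1)^2, so only this interval is kept, and its length is the factor
  (1+r)^(-1/2).\<close>

lemma bessel_moment_lower:
  assumes m: "m > 0" and nu: "\<nu> \<ge> 0"
  obtains c where "c > 0"
    "\<And>r. r > 0 \<Longrightarrow> c * exp (- m * r) * (1 + r) powr (- 1 / 2) \<le> bessel_moment m \<nu> 0 r"
proof
  let ?c = "exp (- m * (cosh 1)\<^sup>2)"
  show "?c > 0" by simp
  fix r :: real assume r: "r > 0"
  define h where "h = (1 + r) powr (- 1 / 2)"
  have h: "0 \<le> h" "h \<le> 1" "r * h\<^sup>2 \<le> 1"
  proof -
    show "0 \<le> h" by (simp add: h_def)
    show "h \<le> 1" using r powr_mono[of "-1/2" 0 "1 + r"] by (simp add: h_def)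
    have "h\<^sup>2 = 1 / (1 + r)" using r by (simp add: h_def powr_minus_divide powr_half_sqrt power_divide)
    then show "r * h\<^sup>2 \<le> 1" using r by simp
  qed
  have "?c * exp (- m * r) * h = (LBINT t:{0..h}. ?c * exp (- m * r))"
    using h by (simp add: set_lebesgue_integral_def)
  also have "\<dots> \<le> (LBINT t:{0..h}. moment_integrand m \<nu> 0 r t)"
  proof (rule set_integral_mono)
    show "set_integrable lborel {0..h} (moment_integrand m \<nu> 0 r)"
      by (rule set_integrable_subset[OF moment_integrable[OF m nu r]]) auto
    fix t assume t: "t \<in> {0..h}"
    have "r * cosh t \<le> r * (1 + (cosh 1)\<^sup>2 * t\<^sup>2)"
      using cosh_le_quadratic[of t] t h r by (intro mult_left_mono) auto
    also have "\<dots> \<le> r + (cosh 1)\<^sup>2"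
    proof -
      have "r * t\<^sup>2 \<le> r * h\<^sup>2" using r t by (intro mult_left_mono power_mono) auto
      then have "(cosh 1)\<^sup>2 * (r * t\<^sup>2) \<le> (cosh 1)\<^sup>2 * (1::real)" using h by (intro mult_left_mono) auto
      then show ?thesis by (simp add: algebra_simps)
    qed
    finally have "m * (r * cosh t) \<le> m * (r + (cosh 1)\<^sup>2)" using m by (intro mult_left_mono) auto
    then have "exp (- m * (cosh 1)\<^sup>2) * exp (- m * r) \<le> exp (- (m * r) * cosh t)"
      by (simp add: algebra_simps flip: exp_add)
    also have "\<dots> \<le> exp (- (m * r) * cosh t) * cosh (\<nu> * t)"
      using cosh_real_ge_1[of "\<nu> * t"] by simp
    finally show "?c * exp (- m * r) \<le> moment_integrand m \<nu> 0 r t" by (simp add: moment_integrand_def)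
  qed (use h in \<open>simp add: set_integrable_def\<close>)
  also have "\<dots> \<le> bessel_moment m \<nu> 0 r"
    unfolding bessel_moment_def
    by (rule set_integral_mono_subset[OF moment_integrable[OF m nu r]])
       (auto simp: moment_integrand_nonneg[OF m])
  finally show "?c * exp (- m * r) * (1 + r) powr (- 1 / 2) \<le> bessel_moment m \<nu> 0 r" by (simp add: h_def)
qed

section \<open>Iterated derivatives of the Bessel profile\<close>

text \<open>Expands as 2(e^(-2r) + e^(-4r) + ...) for r > 0, which is the complete monotonicity
  behind the signs below.\<close>

definition coth_minus_one :: "real \<Rightarrow> real" where
  "coth_minus_one r = 2 / (exp (2 * r) - 1)"

lemma coth_minus_one_pos: "r > 0 \<Longrightarrow> coth_minus_one r > 0"
  by (simp add: coth_minus_one_def)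

lemma coth_minus_one_le:
  assumes "r > 0" shows "coth_minus_one r \<le> 1 / r"
proof -
  have "2 * r \<le> exp (2 * r) - 1" using exp_ge_add_one_self[of "2 * r"] by linarith
  then have "2 / (exp (2 * r) - 1) \<le> 2 / (2 * r)" using assms by (intro divide_left_mono) auto
  then show ?thesis by (simp add: coth_minus_one_def)
qed

lemma inverse_sinh_eq:
  assumes "r > 0" shows "1 / sinh r = exp (- r) * (coth_minus_one r + 2)"
proof -
  define x where "x = exp r"
  have x: "x > 1" using assms by (simp add: x_def)
  then have "x * x > 1 * 1" by (intro mult_strict_mono) auto
  then have "x * x - 1 \<noteq> 0" by simp
  moreover have "exp (2 * r) = x * x" "exp (- r) = 1 / x"
    by (simp_all add: x_def exp_minus inverse_eq_divide flip: exp_add)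
  moreover have "x - 1 / x = (x * x - 1) / x" using x by (simp add: field_simps)
  moreover have "2 / (x * x - 1) + 2 = 2 * (x * x) / (x * x - 1)"
    using \<open>x * x - 1 \<noteq> 0\<close> by (simp add: diff_divide_eq_iff add_divide_eq_iff divide_add_eq_iff)
  ultimately show ?thesis using x
    by (simp only: coth_minus_one_def sinh_field_def x_def[symmetric]) simp
qed

lemma coth_minus_one_DERIV:
  assumes "r > 0"
  shows "(coth_minus_one has_real_derivative
           - (coth_minus_one r ^ 2 + 2 * coth_minus_one r)) (at r)"
proof -
  have "exp (2 * r) > 1" using assms by simp
  then have 1: "exp (2 * r) - 1 \<noteq> 0" by linarith
  have "((\<lambda>r. 2 / (exp (2 * r) - 1)) has_real_derivative
          - 2 * (2 * exp (2 * r)) / (exp (2 * r) - 1)\<^sup>2) (at r)"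
    using 1 by (auto intro!: derivative_eq_intros simp: power2_eq_square)
  moreover have "- 2 * (2 * exp (2 * r)) / (exp (2 * r) - 1)\<^sup>2 = - (coth_minus_one r ^ 2 + 2 * coth_minus_one r)"
  proof -
    define E where "E = exp (2 * r) - 1"
    have "E \<noteq> 0" "exp (2 * r) = E + 1" using 1 by (auto simp: E_def)
    then show ?thesis
      by (simp add: coth_minus_one_def) (simp add: divide_simps power2_eq_square algebra_simps)
  qed
  ultimately show ?thesis by (simp add: coth_minus_one_def[abs_def])
qed

text \<open>\<open>j\<close> counts divisions by sinh; each unit of \<open>a\<close>,
  \<open>l\<close> or \<open>i\<close> costs at most one more power of 1/r at 0, so only their sum
  has to be tracked. With these four indices 0, m = (n-1)/2 and \<nu> = s + 1/2 this is the Bessel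
  profile.\<close>

definition bessel_atom :: "real \<Rightarrow> real \<Rightarrow> nat \<Rightarrow> nat \<Rightarrow> nat \<Rightarrow> nat \<Rightarrow> real \<Rightarrow> real" where
  "bessel_atom m \<nu> j a l i r =
     exp (- (real j * r)) * coth_minus_one r ^ a * r powr (- \<nu> - real l) * bessel_moment m \<nu> i r"

text \<open>
  Since $p = \coth r-1$ satisfies $-p' = p^2+2p$ and $1/\sinh r = e^{-r}(p+2)$, the union of these cones
  over \<open>j\<close> and \<open>N\<close> is stable under $-\partial_r/\sinh r$; the index \<open>N\<close> bounds the order of the
  additional singularity at $0$.
\<close>

inductive bessel_cone :: "real \<Rightarrow> real \<Rightarrow> nat \<Rightarrow> nat \<Rightarrow> (real \<Rightarrow> real) \<Rightarrow> bool" for m \<nu> j N where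
  atom: "a + l + i \<le> N \<Longrightarrow> bessel_cone m \<nu> j N (bessel_atom m \<nu> j a l i)"
| add: "bessel_cone m \<nu> j N F \<Longrightarrow> bessel_cone m \<nu> j N G \<Longrightarrow> bessel_cone m \<nu> j N (\<lambda>r. F r + G r)"
| scale: "0 \<le> c \<Longrightarrow> bessel_cone m \<nu> j N F \<Longrightarrow> bessel_cone m \<nu> j N (\<lambda>r. c * F r)"

lemma bessel_atom_nonneg: "m > 0 \<Longrightarrow> r > 0 \<Longrightarrow> 0 \<le> bessel_atom m \<nu> j a l i r"
  using coth_minus_one_pos[of r] by (simp add: bessel_atom_def bessel_moment_nonneg)

lemma bessel_cone_nonneg:
  assumes "bessel_cone m \<nu> j N F" "m > 0" "r > 0" shows "0 \<le> F r"
  using assms(1) by induction (use assms in \<open>auto simp: bessel_atom_nonneg\<close>)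

text \<open>No factor increases, so minus the derivative is a combination of atoms with nonnegative
  coefficients; p^a contributes a p^(a+1) + 2a p^a because -p' = p^2 + 2p for p = coth r -
  1.\<close>

lemma bessel_atom_DERIV:
  assumes m: "m > 0" and nu: "\<nu> \<ge> 0" and r: "r > 0"
  shows "(bessel_atom m \<nu> j a l i has_real_derivative
     - ((real j + 2 * real a) * bessel_atom m \<nu> j a l i r + (real a * bessel_atom m \<nu> j (Suc a) l i r
        + ((\<nu> + real l) * bessel_atom m \<nu> j a (Suc l) i r + bessel_atom m \<nu> j a l (Suc i) r)))) (at r)"
proof -
  let ?p = "coth_minus_one r" and ?w = "r powr (- \<nu> - real l)" and ?e = "exp (- (real j * r))"
  let ?k = "bessel_moment m \<nu>"
  note d = coth_minus_one_DERIV[OF r] bessel_moment_DERIV[OF m nu r, of i]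
  have "((\<lambda>r. exp (- (real j * r)) * coth_minus_one r ^ a * r powr (- \<nu> - real l) * bessel_moment m \<nu> i r)
     has_real_derivative
     ((- real j * ?e * ?p ^ a + ?e * (real a * ?p ^ (a - 1) * - (?p ^ 2 + 2 * ?p))) * ?w
        + ?e * ?p ^ a * ((- \<nu> - real l) * r powr (- \<nu> - real l - 1))) * ?k i r
     + ?e * ?p ^ a * ?w * - ?k (Suc i) r) (at r)"
    using r by (auto intro!: derivative_eq_intros d) (simp add: algebra_simps)?
  \<comment> \<open>For a = 0 the exponent \<open>a - 1\<close> is truncated to 0, but the factor
    \<open>real a\<close> vanishes on both sides.\<close>
  moreover have "real a * ?p ^ (a - 1) * - (?p ^ 2 + 2 * ?p) = - (real a * ?p ^ Suc a + 2 * real a * ?p ^ a)"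
    by (cases a) (auto simp: algebra_simps power2_eq_square)
  moreover have "r powr (- \<nu> - real l - 1) = r powr (- \<nu> - real (Suc l))"
    by (rule arg_cong[of _ _ "\<lambda>x. r powr x"]) simp
  ultimately show ?thesis
    unfolding bessel_atom_def[abs_def] by (simp only:) (simp add: algebra_simps)
qed

lemma bessel_cone_atom_le:
  "a + l + i \<le> N \<Longrightarrow> 0 \<le> c \<Longrightarrow> bessel_cone m \<nu> j N (\<lambda>r. c * bessel_atom m \<nu> j a l i r)"
  by (intro bessel_cone.scale bessel_cone.atom)

text \<open>The inequality m F <= F' comes from the term that raises \<open>i\<close>; it is carried
  along because the lower bound for the iterated derivatives rests on it.\<close>

lemma bessel_cone_DERIV:
  assumes F: "bessel_cone m \<nu> j N F" and m: "m > 0" and nu: "\<nu> \<ge> 0"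
  shows "\<exists>F'. bessel_cone m \<nu> j (Suc N) F' \<and>
    (\<forall>r>0. (F has_real_derivative - F' r) (at r) \<and> m * F r \<le> F' r)"
  using F
proof induction
  case (atom a l i)
  let ?A = "bessel_atom m \<nu> j"
  let ?F' = "\<lambda>r. (real j + 2 * real a) * ?A a l i r + (real a * ?A (Suc a) l i r
        + ((\<nu> + real l) * ?A a (Suc l) i r + ?A a l (Suc i) r))"
  have "bessel_cone m \<nu> j (Suc N) ?F'"
    using atom nu by (intro bessel_cone.add bessel_cone_atom_le bessel_cone.atom) auto
  moreover have "m * ?A a l i r \<le> ?F' r" if r: "r > 0" for r
  proof -
    have "m * ?A a l i r = exp (- (real j * r)) * coth_minus_one r ^ a * r powr (- \<nu> - real l) * (m * bessel_moment m \<nu> i r)"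
      by (simp add: bessel_atom_def)
    also have "\<dots> \<le> ?A a l (Suc i) r"
      unfolding bessel_atom_def using coth_minus_one_pos[OF r] 
      by (intro mult_left_mono bessel_moment_Suc_ge m nu r) auto
    also have "\<dots> \<le> ?F' r" using bessel_atom_nonneg[OF m r] nu by simp
    finally show ?thesis .
  qed
  ultimately show ?case using bessel_atom_DERIV[OF m nu] by (intro exI[of _ ?F']) blast
next
  case (add F G)
  then obtain F' G' where "bessel_cone m \<nu> j (Suc N) F'" "bessel_cone m \<nu> j (Suc N) G'"
    and "\<forall>r>0. (F has_real_derivative - F' r) (at r) \<and> m * F r \<le> F' r"
        "\<forall>r>0. (G has_real_derivative - G' r) (at r) \<and> m * G r \<le> G' r" by blast
  then show ?case
    by (intro exI[of _ "\<lambda>r. F' r + G' r"] conjI bessel_cone.add)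
       (auto intro!: derivative_eq_intros simp: distrib_left add_mono)
next
  case (scale c F)
  then obtain F' where "bessel_cone m \<nu> j (Suc N) F'"
    and "\<forall>r>0. (F has_real_derivative - F' r) (at r) \<and> m * F r \<le> F' r" by blast
  then show ?case using scale(1)
    by (intro exI[of _ "\<lambda>r. c * F' r"] conjI bessel_cone.scale)
       (auto intro!: derivative_eq_intros mult_left_mono simp: mult.left_commute[of m])
qed

text \<open>The two summands of p + 2 turn an atom into two atoms with \<open>Suc j\<close>, only
  one of them with \<open>Suc a\<close>, so division by sinh costs a single order.\<close>

lemma bessel_cone_over_sinh:
  assumes "bessel_cone m \<nu> j N F"
  shows "bessel_cone m \<nu> (Suc j) (Suc N) (\<lambda>r. exp (- r) * (coth_minus_one r + 2) * F r)"
  using assms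
proof induction
  case (atom a l i)
  have "(\<lambda>r. exp (- r) * (coth_minus_one r + 2) * bessel_atom m \<nu> j a l i r)
      = (\<lambda>r. bessel_atom m \<nu> (Suc j) (Suc a) l i r + 2 * bessel_atom m \<nu> (Suc j) a l i r)"
    by (rule ext) (simp add: bessel_atom_def algebra_simps exp_add exp_diff exp_minus divide_simps)
  moreover have "bessel_cone m \<nu> (Suc j) (Suc N) \<dots>"
    using atom by (intro bessel_cone.add bessel_cone_atom_le bessel_cone.atom) auto
  ultimately show ?case by simp
next
  case (add F G)
  then show ?case using bessel_cone.add[OF add.IH] by (simp add: distrib_left)
next
  case (scale c F)
  then show ?case using bessel_cone.scale[OF scale.hyps(1) scale.IH] by (simp add: mult.left_commute)
qed

text \<open>Each step costs two orders at 0, one for the derivative and one for 1/sinh, hence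
  \<open>2 * j\<close>. The lower bound multiplies F' >= m F by p + 2 >= 2 and e^(-r), a factor 2m
  e^(-r) per step.\<close>

lemma bessel_cone_sinh_deriv:
  assumes m: "m > 0" and nu: "\<nu> \<ge> 0"
    and f: "\<And>r. r > 0 \<Longrightarrow> f r = bessel_atom m \<nu> 0 0 0 0 r"
  shows "\<exists>F. bessel_cone m \<nu> j (2 * j) F \<and>
    (\<forall>r>0. (sinh_deriv ^^ j) f r = F r \<and> (2 * m) ^ j * exp (- (real j * r)) * f r \<le> F r)"
proof (induction j)
  case 0
  show ?case using f by (intro exI[of _ "bessel_atom m \<nu> 0 0 0 0"]) (auto intro: bessel_cone.atom)
next
  case (Suc j)
  then obtain F where F: "bessel_cone m \<nu> j (2 * j) F"
    "\<And>r. r > 0 \<Longrightarrow> (sinh_deriv ^^ j) f r = F r"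
    "\<And>r. r > 0 \<Longrightarrow> (2 * m) ^ j * exp (- (real j * r)) * f r \<le> F r" by blast
  obtain F' where F': "bessel_cone m \<nu> j (Suc (2 * j)) F'"
    "\<And>r. r > 0 \<Longrightarrow> (F has_real_derivative - F' r) (at r)"
    "\<And>r. r > 0 \<Longrightarrow> m * F r \<le> F' r" using bessel_cone_DERIV[OF F(1) m nu] by blast
  let ?G = "\<lambda>r. exp (- r) * (coth_minus_one r + 2) * F' r"
  have "bessel_cone m \<nu> (Suc j) (2 * Suc j) ?G" using bessel_cone_over_sinh[OF F'(1)] by simp
  moreover have "(sinh_deriv ^^ Suc j) f r = ?G r" if r: "r > 0" for r
  proof -
    \<comment> \<open>\<open>deriv\<close> depends on a neighbourhood, so the identity with F is
      needed on the whole open half-line and not only at r.\<close>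
    have "((sinh_deriv ^^ j) f has_real_derivative - F' r) (at r)"
      by (rule has_field_derivative_transform_within_open[OF F'(2)[OF r], of "{0<..}"])
         (use r F(2) in auto)
    then have "(sinh_deriv ^^ Suc j) f r = F' r * (1 / sinh r)"
      by (simp add: sinh_deriv_def DERIV_imp_deriv)
    then show ?thesis by (simp only: inverse_sinh_eq[OF r]) (simp add: mult_ac)
  qed
  moreover have "(2 * m) ^ Suc j * exp (- (real (Suc j) * r)) * f r \<le> ?G r" if r: "r > 0" for r
  proof -
    have "(2 * m) ^ Suc j * exp (- (real (Suc j) * r)) * f r
        = exp (- r) * 2 * (m * ((2 * m) ^ j * exp (- (real j * r)) * f r))"
      by (simp add: algebra_simps exp_diff exp_minus divide_simps exp_add)
    also have "\<dots> \<le> exp (- r) * 2 * F' r"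
      using F(3)[OF r] F'(3)[OF r] m by (intro mult_left_mono order_trans[OF mult_left_mono F'(3)]) (auto simp: r)
    also have "\<dots> \<le> ?G r"
      using coth_minus_one_pos[OF r] bessel_cone_nonneg[OF F'(1) m r] by (intro mult_right_mono mult_left_mono) auto
    finally show ?thesis .
  qed
  ultimately show ?case by (intro exI[of _ ?G]) blast
qed

lemma bessel_cone_upper:
  assumes F: "bessel_cone m \<nu> j N F" and m: "m > 0" and nu: "\<nu> \<ge> 0" and d: "\<delta> > 0"
  shows "\<exists>C>0. \<forall>r>0. F r \<le> C * exp (- ((m + real j) * r)) * (1 + r) powr (- \<nu> - 1 / 2)
     * (1 + 1 / r) powr (2 * \<nu> + \<delta> + real N)"
  using F
proof induction
  case (atom a l i)
  obtain C where C: "C > 0" "\<And>r. r > 0 \<Longrightarrow> bessel_moment m \<nu> i r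
       \<le> C * exp (- m * r) * (1 + r) powr (- 1 / 2) * (1 + 1 / r) powr (i + \<nu> + \<delta>)"
    by (rule bessel_moment_upper[OF m nu d]) auto
  show ?case
  proof (intro exI[of _ C] conjI allI impI)
    fix r :: real assume r: "r > 0"
    let ?q = "1 + 1 / r"
    have q: "?q \<ge> 1" using r by simp
    have 1: "coth_minus_one r ^ a \<le> ?q powr real a"
    proof -
      have "coth_minus_one r \<le> ?q" using coth_minus_one_le[OF r] by linarith
      then have "coth_minus_one r ^ a \<le> ?q ^ a" using coth_minus_one_pos[OF r] by (intro power_mono) auto
      then show ?thesis using r by (simp add: powr_realpow add_pos_pos)
    qed
    have 2: "r powr (- \<nu> - real l) \<le> ?q powr (\<nu> + real l) * (1 + r) powr (- \<nu>)"
    proof -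
      \<comment> \<open>Separates the decay of r^(-\<nu>-l) at infinity from its singularity at
        0.\<close>
      have "r = (1 + r) / ?q" using r by (simp add: field_simps)
      then have "r powr (- \<nu> - real l) = ((1 + r) / ?q) powr (- \<nu> - real l)" by simp
      also have "\<dots> = (1 + r) powr (- \<nu> - real l) * ?q powr (- (- \<nu> - real l))"
        by (simp only: powr_divide powr_minus_divide[of ?q "- \<nu> - real l"]) simp
      also have "\<dots> \<le> (1 + r) powr (- \<nu>) * ?q powr (- (- \<nu> - real l))"
        using r by (intro mult_right_mono powr_mono) auto
      finally show ?thesis by (simp add: mult.commute add.commute)
    qed
    have "bessel_atom m \<nu> j a l i r \<le> exp (- (real j * r)) * ?q powr real a * (?q powr (\<nu> + real l) * (1 + r) powr (- \<nu>))
       * (C * exp (- m * r) * (1 + r) powr (- 1 / 2) * ?q powr (i + \<nu> + \<delta>))"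
      unfolding bessel_atom_def using coth_minus_one_pos[OF r]
      by (intro mult_mono mult_left_mono 1 2 C(2) r bessel_moment_nonneg m mult_nonneg_nonneg) auto
    also have "\<dots> = C * exp (- ((m + real j) * r)) * (1 + r) powr (- \<nu> - 1 / 2) * ?q powr (2 * \<nu> + \<delta> + real (a + l + i))"
    proof -
      have "exp (- ((m + real j) * r)) = exp (- (real j * r)) * exp (- m * r)"
        by (simp add: algebra_simps flip: exp_add)
      moreover have "(1 + r) powr (- \<nu> - 1 / 2) = (1 + r) powr (- \<nu>) * (1 + r) powr (- 1 / 2)"
        by (simp flip: powr_add)
      moreover have "?q powr (2 * \<nu> + \<delta> + real (a + l + i)) = ?q powr real a * ?q powr (\<nu> + real l) * ?q powr (i + \<nu> + \<delta>)"
        by (simp add: algebra_simps flip: powr_add)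
      ultimately show ?thesis by (simp only: mult_ac)
    qed
    also have "\<dots> \<le> C * exp (- ((m + real j) * r)) * (1 + r) powr (- \<nu> - 1 / 2) * ?q powr (2 * \<nu> + \<delta> + real N)"
      using C q atom by (intro mult_left_mono powr_mono) auto
    finally show "bessel_atom m \<nu> j a l i r \<le> \<dots>" .
  qed (use C in auto)
next
  case (add F G)
  then obtain C D where "C > 0" "D > 0" and
    b: "\<forall>r>0. F r \<le> C * exp (- ((m + real j) * r)) * (1 + r) powr (- \<nu> - 1 / 2) * (1 + 1 / r) powr (2 * \<nu> + \<delta> + real N)"
    "\<forall>r>0. G r \<le> D * exp (- ((m + real j) * r)) * (1 + r) powr (- \<nu> - 1 / 2) * (1 + 1 / r) powr (2 * \<nu> + \<delta> + real N)"
    by blast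
  then show ?case
    by (intro exI[of _ "C + D"]) (auto simp: distrib_right intro!: add_mono)
next
  case (scale c F)
  then obtain C where C: "C > 0" and
    b: "\<forall>r>0. F r \<le> C * exp (- ((m + real j) * r)) * (1 + r) powr (- \<nu> - 1 / 2) * (1 + 1 / r) powr (2 * \<nu> + \<delta> + real N)"
    by blast
  show ?case
  \<comment> \<open>The added 1 keeps the constant positive when c = 0.\<close>
  proof (intro exI[of _ "c * C + 1"] conjI allI impI)
    show "c * C + 1 > 0" using C scale by (simp add: add_nonneg_pos)
    fix r :: real assume r: "r > 0"
    let ?B = "exp (- ((m + real j) * r)) * ((1 + r) powr (- \<nu> - 1 / 2) * (1 + 1 / r) powr (2 * \<nu> + \<delta> + real N))"
    have "c * F r \<le> c * (C * ?B)" using b r scale by (intro mult_left_mono) (auto simp: mult.assoc)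
    also have "\<dots> \<le> (c * C + 1) * ?B" by (simp add: distrib_right)
    finally show "c * F r \<le> (c * C + 1) * exp (- ((m + real j) * r)) * (1 + r) powr (- \<nu> - 1 / 2) * (1 + 1 / r) powr (2 * \<nu> + \<delta> + real N)"
      by (simp add: mult.assoc)
  qed
qed

text \<open>The order -1-s at infinity is -\<nu> from the power of r plus -1/2 from the moment. At 0
  the exponent is 2\<nu> + \<delta>, with \<nu> from each of these two factors, plus two for every
  application of \<open>sinh_deriv\<close>. Monotonicity and continuity are stated for use in the
  Abel integral.\<close>

lemma profile_sinh_deriv:
  fixes n j :: nat and s \<delta> :: real
  assumes n: "n \<ge> 2" and s: "0 < s" and d: "\<delta> > 0"
  defines "G \<equiv> (sinh_deriv ^^ j) (Bessel_profile n s)"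
    and "\<beta> \<equiv> (real n - 1) / 2 + real j"
  shows "\<exists>c>0. \<forall>r>0. c * exp (- (\<beta> * r)) * (1 + r) powr (- 1 - s) \<le> G r"
    and "\<exists>C>0. \<forall>r>0. G r \<le> C * exp (- (\<beta> * r)) * (1 + r) powr (- 1 - s) * (1 + 1 / r) powr (1 + 2 * s + \<delta> + 2 * real j)"
    and "\<And>r r'. 0 < r \<Longrightarrow> r \<le> r' \<Longrightarrow> G r' \<le> G r"
    and "\<And>r. 0 < r \<Longrightarrow> isCont G r"
proof -
  define m where "m = (real n - 1) / 2"
  define \<nu> where "\<nu> = s + 1 / 2"
  have m: "m > 0" and nu: "\<nu> \<ge> 0" using n s by (auto simp: m_def \<nu>_def)
  have nu': "- (1 + 2 * s) / 2 = - \<nu>" "(1 + 2 * s) / 2 = \<nu>" "- \<nu> - 1 / 2 = - 1 - s"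
    by (auto simp: \<nu>_def field_simps)
  have f: "Bessel_profile n s r = bessel_atom m \<nu> 0 0 0 0 r" for r
    unfolding Bessel_profile_def Bessel_K_def bessel_atom_def bessel_moment_def moment_integrand_def nu'
    by (simp add: m_def)
  obtain F where F: "bessel_cone m \<nu> j (2 * j) F" "\<And>r. r > 0 \<Longrightarrow> G r = F r"
    "\<And>r. r > 0 \<Longrightarrow> (2 * m) ^ j * exp (- (real j * r)) * Bessel_profile n s r \<le> F r"
    using bessel_cone_sinh_deriv[OF m nu f, of j] unfolding G_def by blast
  obtain F' where F': "bessel_cone m \<nu> j (Suc (2 * j)) F'"
    "\<And>r. r > 0 \<Longrightarrow> (F has_real_derivative - F' r) (at r)"
    using bessel_cone_DERIV[OF F(1) m nu] by blast
  have beta: "\<beta> = m + real j" by (simp add: \<beta>_def m_def)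
  show "\<exists>C>0. \<forall>r>0. G r \<le> C * exp (- (\<beta> * r)) * (1 + r) powr (- 1 - s) * (1 + 1 / r) powr (1 + 2 * s + \<delta> + 2 * real j)"
  proof -
    have "2 * \<nu> + \<delta> + real (2 * j) = 1 + 2 * s + \<delta> + 2 * real j" by (simp add: \<nu>_def)
    then show ?thesis
      using bessel_cone_upper[OF F(1) m nu d] F(2) unfolding beta nu' by (simp only:) simp
  qed
  show "\<exists>c>0. \<forall>r>0. c * exp (- (\<beta> * r)) * (1 + r) powr (- 1 - s) \<le> G r"
  proof -
    obtain c where c: "c > 0" "\<And>r. r > 0 \<Longrightarrow> c * exp (- m * r) * (1 + r) powr (- 1 / 2) \<le> bessel_moment m \<nu> 0 r"
      by (rule bessel_moment_lower[OF m nu]) auto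
    show ?thesis
    proof (intro exI[of _ "(2 * m) ^ j * c"] conjI allI impI)
      show "(2 * m) ^ j * c > 0" using m c by simp
      fix r :: real assume r: "r > 0"
      have "(2 * m) ^ j * c * exp (- (\<beta> * r)) * (1 + r) powr (- 1 - s)
          = (2 * m) ^ j * exp (- (real j * r)) * ((1 + r) powr (- \<nu>) * (c * exp (- m * r) * (1 + r) powr (- 1 / 2)))"
      proof -
        have "exp (- (\<beta> * r)) = exp (- (real j * r)) * exp (- m * r)"
          by (simp add: beta algebra_simps flip: exp_add)
        moreover have "(1 + r) powr (- 1 - s) = (1 + r) powr (- \<nu>) * (1 + r) powr (- 1 / 2)"
          by (simp add: \<nu>_def flip: powr_add)
        ultimately show ?thesis by (simp only: mult_ac)
      qed
      also have "\<dots> \<le> (2 * m) ^ j * exp (- (real j * r)) * (r powr (- \<nu>) * bessel_moment m \<nu> 0 r)"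
        using m r nu c by (intro mult_left_mono mult_mono powr_mono2') auto
      also have "\<dots> = (2 * m) ^ j * exp (- (real j * r)) * Bessel_profile n s r"
        by (simp add: f bessel_atom_def)
      also have "\<dots> \<le> G r" using F r by simp
      finally show "(2 * m) ^ j * c * exp (- (\<beta> * r)) * (1 + r) powr (- 1 - s) \<le> G r" .
    qed
  qed
  show "G r' \<le> G r" if rr: "0 < r" "r \<le> r'" for r r'
  proof -
    have "F r' \<le> F r"
      by (rule DERIV_nonpos_imp_nonincreasing[OF rr(2)])
         (use F'(2) bessel_cone_nonneg[OF F'(1) m] rr in \<open>metis neg_le_0_iff_le order_less_le_trans\<close>)
    then show ?thesis using F(2) rr by simp
  qed
  show "isCont G r" if r: "0 < r" for r
  proof -
    have "(G has_real_derivative - F' r) (at r)"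
      by (rule has_field_derivative_transform_within_open[OF F'(2)[OF r], of "{0<..}"]) (use r F(2) in auto)
    then show ?thesis by (rule DERIV_isCont)
  qed
qed

section \<open>Bounds for the kernel\<close>

text \<open>One formula for both regimes: linear in y near 0, exponential for large y.\<close>

lemma sinh_le_exp_ratio:
  fixes y :: real assumes "y > 0" shows "sinh y \<le> 2 * exp y / (1 + 1 / y)"
proof -
  have e: "2 * exp y / (1 + 1 / y) = exp y * (2 * y / (1 + y))" using assms by (simp add: field_simps)
  have s: "sinh y = exp y * ((1 - exp (- 2 * y)) / 2)"
    by (simp add: sinh_field_def algebra_simps flip: exp_add)
  have "(1 - exp (- 2 * y)) / 2 \<le> 2 * y / (1 + y)"
  proof (cases "y \<le> 1")
    case True
    have "1 + - 2 * y \<le> exp (- 2 * y)" by (rule exp_ge_add_one_self)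
    then have "(1 - exp (- 2 * y)) / 2 \<le> y" by simp
    also have "y \<le> 2 * y / (1 + y)" using assms True by (simp add: field_simps)
    finally show ?thesis .
  next
    case False
    have "(1 - exp (- 2 * y)) / 2 \<le> 1" by (rule order_trans[of _ "1 / 2"]) auto
    also have "1 \<le> 2 * y / (1 + y)" using False by (simp add: field_simps)
    finally show ?thesis .
  qed
  then show ?thesis unfolding e s by (intro mult_left_mono) auto
qed

lemma inverse_sinh_le:
  fixes y :: real assumes "y > 0" shows "1 / sinh y \<le> exp (- y) * (2 + 1 / y)"
proof -
  have "coth_minus_one y + 2 \<le> 2 + 1 / y" using coth_minus_one_le[OF assms] by simp
  then show ?thesis unfolding inverse_sinh_eq[OF assms] by (intro mult_left_mono) auto
qed

text \<open>With A = sinh((r+\<rho>)/2), B = sinh((r-\<rho>)/2) and c = cosh((r-\<rho>)/2) one has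
  cosh r - cosh \<rho> = 2AB and sinh r <= 2Ac, so the squared quotient is at most 2 A c^2 / B. The
  A that survives in the numerator gives the factor (1+1/r)^(-1/2), which lowers the singularity of
  the kernel by half a power.\<close>

lemma Abel_kernel_bound:
  fixes \<rho> r :: real
  assumes rho: "\<rho> > 0" and r: "\<rho> < r"
  shows "sinh r / sqrt (cosh r - cosh \<rho>)
    \<le> 3 * exp (r / 2) * (1 + 1 / (r - \<rho>)) powr (1 / 2) * (1 + 1 / r) powr (- 1 / 2)"
proof -
  define \<sigma> where "\<sigma> = r - \<rho>"
  define A where "A = sinh (\<rho> + \<sigma> / 2)"
  define B where "B = sinh (\<sigma> / 2)"
  define c where "c = cosh (\<sigma> / 2)"
  have sg: "\<sigma> > 0" using r by (simp add: \<sigma>_def)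
  have A: "A > 0" and B: "B > 0" and c: "c > 0" using rho sg by (auto simp: A_def B_def c_def)
  have rr: "r = (\<rho> + \<sigma> / 2) + \<sigma> / 2" "\<rho> = (\<rho> + \<sigma> / 2) - \<sigma> / 2" by (auto simp: \<sigma>_def field_simps)
  have AB: "cosh r - cosh \<rho> = 2 * A * B"
  proof -
    have "cosh r = cosh (\<rho> + \<sigma> / 2) * c + A * B" by (subst rr(1)) (simp only: cosh_add A_def B_def c_def)
    moreover have "cosh \<rho> = cosh (\<rho> + \<sigma> / 2) * c - A * B" by (subst rr(2)) (simp only: cosh_diff A_def B_def c_def)
    ultimately show ?thesis by simp
  qed
  have sr: "sinh r \<le> 2 * A * c"
  proof -
    have "sinh r = A * c + cosh (\<rho> + \<sigma> / 2) * B" by (subst rr(1)) (simp only: sinh_add A_def B_def c_def)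
    moreover have "A * c - cosh (\<rho> + \<sigma> / 2) * B = sinh \<rho>"
      by (subst (2) rr(2)) (simp only: sinh_diff A_def B_def c_def)
    moreover have "sinh \<rho> \<ge> 0" using rho by simp
    ultimately show ?thesis by linarith
  qed
  have A': "A \<le> 2 * exp (\<rho> + \<sigma> / 2) / (1 + 1 / r)"
  proof -
    have "A \<le> 2 * exp (\<rho> + \<sigma> / 2) / (1 + 1 / (\<rho> + \<sigma> / 2))"
      unfolding A_def using rho sg by (intro sinh_le_exp_ratio) auto
    also have "\<dots> \<le> 2 * exp (\<rho> + \<sigma> / 2) / (1 + 1 / r)"
    proof -
      have p: "0 < \<rho> + \<sigma> / 2" "\<rho> + \<sigma> / 2 \<le> r" using rho sg by (auto simp: \<sigma>_def field_simps)
      then have "1 / r \<le> 1 / (\<rho> + \<sigma> / 2)" by (intro frac_le) auto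
      then have "1 + 1 / r \<le> 1 + 1 / (\<rho> + \<sigma> / 2)" by simp
      moreover have "1 + 1 / r > 0" using rho r by (intro add_pos_pos) auto
      ultimately show ?thesis by (intro frac_le) auto
    qed
    finally show ?thesis .
  qed
  have B': "1 / B \<le> 2 * exp (- (\<sigma> / 2)) * (1 + 1 / \<sigma>)"
    unfolding B_def using inverse_sinh_le[of "\<sigma> / 2"] sg by (simp add: algebra_simps)
  have c': "c\<^sup>2 \<le> exp \<sigma>"
  proof -
    have "c\<^sup>2 \<le> (exp (\<sigma> / 2))\<^sup>2" unfolding c_def using sg by (intro power_mono cosh_le_exp_real) auto
    then show ?thesis by (simp flip: exp_double)
  qed
  have "(sinh r / sqrt (cosh r - cosh \<rho>))\<^sup>2 = (sinh r)\<^sup>2 / (2 * A * B)"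
    using A B by (simp add: AB power_divide)
  also have "\<dots> \<le> (2 * A * c)\<^sup>2 / (2 * A * B)"
    using A B sr rho r by (intro divide_right_mono power_mono) auto
  also have "\<dots> = 2 * (A * (c\<^sup>2 * (1 / B)))" using A B by (simp add: power2_eq_square)
  also have "\<dots> \<le> 2 * ((2 * exp (\<rho> + \<sigma> / 2) / (1 + 1 / r)) * (exp \<sigma> * (2 * exp (- (\<sigma> / 2)) * (1 + 1 / \<sigma>))))"
    using A B rho r by (intro mult_left_mono[OF mult_mono[OF A' mult_mono[OF c' B']]]) auto
  also have "\<dots> = 8 * (exp (\<rho> + \<sigma> / 2) * exp \<sigma> * exp (- (\<sigma> / 2))) * ((1 + 1 / \<sigma>) / (1 + 1 / r))"
    by simp
  also have "exp (\<rho> + \<sigma> / 2) * exp \<sigma> * exp (- (\<sigma> / 2)) = exp r"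
    by (simp add: \<sigma>_def flip: exp_add)
  \<comment> \<open>Rounding 8 up to 9 gives the clean root 3.\<close>
  also have "8 * exp r * ((1 + 1 / \<sigma>) / (1 + 1 / r)) \<le> 9 * exp r * ((1 + 1 / \<sigma>) / (1 + 1 / r))"
    using sg rho r by (intro mult_right_mono) auto
  also have "\<dots> = (3 * exp (r / 2) * (1 + 1 / \<sigma>) powr (1 / 2) * (1 + 1 / r) powr (- 1 / 2))\<^sup>2"
  proof -
    have "(exp (r / 2))\<^sup>2 = exp r" by (simp flip: exp_double)
    moreover have "((1 + 1 / \<sigma>) powr (1 / 2))\<^sup>2 = 1 + 1 / \<sigma>"
      using sg by (simp add: powr_half_sqrt)
    moreover have "((1 + 1 / r) powr (- 1 / 2))\<^sup>2 = 1 / (1 + 1 / r)"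
      using rho r by (simp add: powr_minus_divide powr_half_sqrt power_divide)
    ultimately show ?thesis by (simp only: power_mult_distrib) simp
  qed
  finally show ?thesis unfolding \<sigma>_def by (rule power2_le_imp_le) auto
qed

text \<open>Near 0 the weight behaves like t^(-\<alpha>), integrable by the Gamma integral at 1 -
  \<alpha> > 0; for t >= 1 the bracket is bounded.\<close>

lemma set_integrable_Abel_weight:
  fixes \<alpha> :: real assumes "0 \<le> \<alpha>" "\<alpha> < 1"
  shows "set_integrable lborel {0<..} (\<lambda>t. exp (- t) * (1 + 1 / t) powr \<alpha>)"
proof -
  have "((\<lambda>t. t powr ((1 - \<alpha>) - 1) / exp t) has_integral Gamma (1 - \<alpha>)) {0..}"
    by (rule Gamma_integral_real) (use assms in auto)
  then have "(\<lambda>t. t powr ((1 - \<alpha>) - 1) / exp t) absolutely_integrable_on {0..}"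
    by (intro nonnegative_absolutely_integrable_1) (auto simp: integrable_on_def)
  then have "set_integrable lebesgue {0..} (\<lambda>t. t powr (- \<alpha>) / exp t)" by simp
  then have "set_integrable lborel {0..} (\<lambda>t. t powr (- \<alpha>) / exp t)"
    unfolding set_integrable_def by (subst (asm) integrable_completion) auto
  then have 1: "set_integrable lborel {0<..} (\<lambda>t. t powr (- \<alpha>) / exp t)"
    by (rule set_integrable_subset) auto
  have "set_integrable lborel {0..} (\<lambda>t::real. exp (- 1 * t))"
    by (rule set_integrable_exp_atLeast(1)) simp
  then have 2: "set_integrable lborel {0<..} (\<lambda>t::real. exp (- 1 * t))"
    by (rule set_integrable_subset) auto
  have "set_integrable lborel {0<..} (\<lambda>t. 2 powr \<alpha> * (exp (- 1 * t) + t powr (- \<alpha>) / exp t))"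
    by (intro set_integrable_mult_right set_integral_add 1 2)
  then show ?thesis
  proof (rule set_integrable_bound)
    have "exp (- t) * (1 + 1 / t) powr \<alpha> \<le> 2 powr \<alpha> * (exp (- 1 * t) + t powr (- \<alpha>) / exp t)" if t: "t > 0" for t :: real
    proof -
      have "(1 + 1 / t) powr \<alpha> \<le> 2 powr \<alpha> * (1 + t powr (- \<alpha>))"
      proof (cases "t \<ge> 1")
        case True
        then have "(1 + 1 / t) powr \<alpha> \<le> 2 powr \<alpha>" using assms by (intro powr_mono2) auto
        also have "\<dots> \<le> 2 powr \<alpha> * (1 + t powr (- \<alpha>))" by simp
        finally show ?thesis .
      next
        case False
        then have "(1 + 1 / t) powr \<alpha> \<le> (2 / t) powr \<alpha>" using assms t by (intro powr_mono2) (auto simp: field_simps)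
        also have "\<dots> = 2 powr \<alpha> * t powr (- \<alpha>)" by (simp add: powr_divide powr_minus_divide)
        also have "\<dots> \<le> 2 powr \<alpha> * (1 + t powr (- \<alpha>))" by simp
        finally show ?thesis .
      qed
      then have "exp (- t) * (1 + 1 / t) powr \<alpha> \<le> exp (- t) * (2 powr \<alpha> * (1 + t powr (- \<alpha>)))"
        by (intro mult_left_mono) auto
      also have "\<dots> = 2 powr \<alpha> * (exp (- 1 * t) + t powr (- \<alpha>) / exp t)"
        by (simp add: exp_minus field_simps)
      finally show ?thesis .
    qed
    then show "AE t in lborel. t \<in> {0<..} \<longrightarrow> norm (exp (- t) * (1 + 1 / t) powr \<alpha>)
        \<le> norm (2 powr \<alpha> * (exp (- 1 * t) + t powr (- \<alpha>) / exp t))"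
      by (intro AE_I2 impI) (auto simp: abs_mult)
  qed (simp add: set_borel_measurable_def)
qed

section \<open>The Abel integral of even dimensions\<close>

locale Abel_transform =
  fixes G :: "real \<Rightarrow> real" and \<beta> s N c C :: real
  assumes beta: "\<beta> \<ge> 3 / 2" and s: "0 < s" "s < 1" and N: "N \<ge> (1 + s) / 2" and c: "c > 0" and C: "C > 0"
    and lower: "\<And>r. r > 0 \<Longrightarrow> c * exp (- (\<beta> * r)) * (1 + r) powr (- 1 - s) \<le> G r"
    and upper: "\<And>r. r > 0 \<Longrightarrow> G r \<le> C * exp (- (\<beta> * r)) * (1 + r) powr (- 1 - s) * (1 + 1 / r) powr N"
    and anti: "\<And>r r'. 0 < r \<Longrightarrow> r \<le> r' \<Longrightarrow> G r' \<le> G r"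
    and cont: "\<And>r. 0 < r \<Longrightarrow> isCont G r"
begin

definition integrand :: "real \<Rightarrow> real \<Rightarrow> real" where
  "integrand \<rho> r = sinh r / sqrt (cosh r - cosh \<rho>) * G r"

definition transform :: "real \<Rightarrow> real" where
  "transform \<rho> = (LBINT r:{\<rho><..}. integrand \<rho> r)"

lemma G_nonneg: "r > 0 \<Longrightarrow> 0 \<le> G r"
  using lower[of r] c by (meson mult_nonneg_nonneg exp_ge_zero powr_ge_zero less_imp_le order_trans)

lemma integrand_nonneg: "\<rho> > 0 \<Longrightarrow> r > \<rho> \<Longrightarrow> 0 \<le> integrand \<rho> r"
  unfolding integrand_def by (intro mult_nonneg_nonneg divide_nonneg_nonneg G_nonneg) (auto simp: cosh_real_nonneg_le_iff)

text \<open>The exponent is 1/2 from the Abel singularity plus s/2 taken over from the singularity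
  of G at 0. The sum is below 1, so the weight is integrable, and the s/2 moved off G is what brings
  the final exponent below n + 2 for every s < 1.\<close>

definition weight :: "real \<Rightarrow> real" where
  "weight t = exp (- t) * (1 + 1 / t) powr ((1 + s) / 2)"

text \<open>The dependence on \<rho> and on r - \<rho> is separated. As \<beta> - 1/2 >= 1, the
  exponential has e^(-(r-\<rho>)) to spare; all powers of r are moved to \<rho>, except
  (1+1/r)^(s/2), which goes to r - \<rho>.\<close>

lemma integrand_upper:
  assumes rho: "\<rho> > 0" and r: "r > \<rho>"
  shows "integrand \<rho> r \<le> 3 * C * exp (- ((\<beta> - 1 / 2) * \<rho>)) * (1 + \<rho>) powr (- 1 - s)
     * (1 + 1 / \<rho>) powr (N - 1 / 2 - s / 2) * weight (r - \<rho>)"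
proof -
  define q where "q = 1 + 1 / (r - \<rho>)"
  have r0: "r > 0" using rho r by simp
  have q1: "q \<ge> 1" using r by (simp add: q_def)
  have "integrand \<rho> r \<le> (3 * exp (r / 2) * q powr (1 / 2) * (1 + 1 / r) powr (- 1 / 2))
     * (C * exp (- (\<beta> * r)) * (1 + r) powr (- 1 - s) * (1 + 1 / r) powr N)"
    unfolding integrand_def q_def by (intro mult_mono Abel_kernel_bound rho r upper r0 G_nonneg) auto
  also have "\<dots> = 3 * C * (exp (r / 2) * exp (- (\<beta> * r))) * (1 + r) powr (- 1 - s)
     * ((1 + 1 / r) powr (- 1 / 2) * (1 + 1 / r) powr N) * q powr (1 / 2)"
    by (simp only: mult_ac)
  also have "exp (r / 2) * exp (- (\<beta> * r)) = exp (- ((\<beta> - 1 / 2) * r))"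
    by (simp add: algebra_simps flip: exp_add)
  also have "(1 + 1 / r) powr (- 1 / 2) * (1 + 1 / r) powr N = (1 + 1 / r) powr (N - 1 / 2 - s / 2) * (1 + 1 / r) powr (s / 2)"
    by (simp flip: powr_add)
  also have "3 * C * exp (- ((\<beta> - 1 / 2) * r)) * (1 + r) powr (- 1 - s)
     * ((1 + 1 / r) powr (N - 1 / 2 - s / 2) * (1 + 1 / r) powr (s / 2)) * q powr (1 / 2)
    \<le> 3 * C * (exp (- ((\<beta> - 1 / 2) * \<rho>)) * exp (- (r - \<rho>))) * (1 + \<rho>) powr (- 1 - s)
     * ((1 + 1 / \<rho>) powr (N - 1 / 2 - s / 2) * q powr (s / 2)) * q powr (1 / 2)"
  proof (intro mult_right_mono mult_mono)
    have "1 * (r - \<rho>) \<le> (\<beta> - 1 / 2) * (r - \<rho>)" using beta r by (intro mult_right_mono) auto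
    then have "- ((\<beta> - 1 / 2) * r) \<le> - ((\<beta> - 1 / 2) * \<rho>) + - (r - \<rho>)" by (simp add: field_simps)
    then show "exp (- ((\<beta> - 1 / 2) * r)) \<le> exp (- ((\<beta> - 1 / 2) * \<rho>)) * exp (- (r - \<rho>))"
      by (metis exp_add exp_le_cancel_iff)
    show "(1 + r) powr (- 1 - s) \<le> (1 + \<rho>) powr (- 1 - s)" using rho r s by (intro powr_mono2') auto
    show "(1 + 1 / r) powr (N - 1 / 2 - s / 2) \<le> (1 + 1 / \<rho>) powr (N - 1 / 2 - s / 2)"
      using rho r N by (intro powr_mono2) (auto simp: frac_le field_simps)
    have "1 / r \<le> 1 / (r - \<rho>)" using rho r by (intro divide_left_mono) auto
    then show "(1 + 1 / r) powr (s / 2) \<le> q powr (s / 2)"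
      unfolding q_def using s r0 by (intro powr_mono2) auto
  qed (use C in auto)
  also have "\<dots> = 3 * C * exp (- ((\<beta> - 1 / 2) * \<rho>)) * (1 + \<rho>) powr (- 1 - s)
     * (1 + 1 / \<rho>) powr (N - 1 / 2 - s / 2) * weight (r - \<rho>)"
  proof -
    have "weight (r - \<rho>) = exp (- (r - \<rho>)) * (q powr (s / 2) * q powr (1 / 2))"
      by (simp add: weight_def q_def add_divide_distrib add.commute flip: powr_add)
    then show ?thesis by (simp only: mult_ac)
  qed
  finally show ?thesis .
qed

lemma weight_integrable: "set_integrable lborel {0<..} weight"
  unfolding weight_def[abs_def] using s by (intro set_integrable_Abel_weight) auto

lemma weight_shift:
  shows "set_integrable lborel {\<rho><..} (\<lambda>r. weight (r - \<rho>))"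
    and "(LBINT r:{\<rho><..}. weight (r - \<rho>)) = (LBINT t:{0<..}. weight t)"
proof -
  have i: "indicator {0<..} (- \<rho> + 1 * r) *\<^sub>R weight (- \<rho> + 1 * r) = indicator {\<rho><..} r *\<^sub>R weight (r - \<rho>)" for r :: real
    by (auto simp: indicator_def)
  show "set_integrable lborel {\<rho><..} (\<lambda>r. weight (r - \<rho>))"
    using lborel_integrable_real_affine[OF weight_integrable[unfolded set_integrable_def], of 1 "- \<rho>"]
    unfolding i set_integrable_def by simp
  show "(LBINT r:{\<rho><..}. weight (r - \<rho>)) = (LBINT t:{0<..}. weight t)"
    unfolding set_lebesgue_integral_def
    using lborel_integral_real_affine[of 1 "\<lambda>t. indicator {0<..} t *\<^sub>R weight t" "- \<rho>"] unfolding i by simp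
qed

lemma integrand_integrable:
  assumes rho: "\<rho> > 0" shows "set_integrable lborel {\<rho><..} (integrand \<rho>)"
proof (rule set_integrable_bound)
  show "set_integrable lborel {\<rho><..} (\<lambda>r. 3 * C * exp (- ((\<beta> - 1 / 2) * \<rho>)) * (1 + \<rho>) powr (- 1 - s)
     * (1 + 1 / \<rho>) powr (N - 1 / 2 - s / 2) * weight (r - \<rho>))"
    by (intro set_integrable_mult_right weight_shift)
  show "AE r in lborel. r \<in> {\<rho><..} \<longrightarrow> norm (integrand \<rho> r) \<le> norm (3 * C * exp (- ((\<beta> - 1 / 2) * \<rho>)) * (1 + \<rho>) powr (- 1 - s)
     * (1 + 1 / \<rho>) powr (N - 1 / 2 - s / 2) * weight (r - \<rho>))"
  proof (intro AE_I2 impI)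
    fix r assume "r \<in> {\<rho><..}"
    then have "integrand \<rho> r \<le> 3 * C * exp (- ((\<beta> - 1 / 2) * \<rho>)) * (1 + \<rho>) powr (- 1 - s)
     * (1 + 1 / \<rho>) powr (N - 1 / 2 - s / 2) * weight (r - \<rho>)" "0 \<le> integrand \<rho> r"
      using integrand_upper[OF rho] integrand_nonneg[OF rho] by auto
    then show "norm (integrand \<rho> r) \<le> norm (3 * C * exp (- ((\<beta> - 1 / 2) * \<rho>)) * (1 + \<rho>) powr (- 1 - s)
     * (1 + 1 / \<rho>) powr (N - 1 / 2 - s / 2) * weight (r - \<rho>))" by simp
  qed
  have "continuous_on {\<rho><..} (integrand \<rho>)"
  proof (rule continuous_at_imp_continuous_on, intro ballI)
    fix r assume r: "r \<in> {\<rho><..}"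
    then have "cosh r - cosh \<rho> > 0" using rho by (simp add: cosh_real_nonneg_less_iff)
    then show "isCont (integrand \<rho>) r"
      unfolding integrand_def[abs_def] using r rho by (intro continuous_intros cont) auto
  qed
  then show "set_borel_measurable lborel {\<rho><..} (integrand \<rho>)"
    unfolding set_borel_measurable_def using borel_measurable_continuous_on_indicator[of "{\<rho><..}" "integrand \<rho>"] by simp
qed

lemma transform_upper:
  obtains C' where "C' > 0" "\<And>\<rho>. \<rho> > 0 \<Longrightarrow> transform \<rho> \<le> C' * exp (- ((\<beta> - 1 / 2) * \<rho>)) * (1 + \<rho>) powr (- 1 - s)
     * (1 + 1 / \<rho>) powr (N - 1 / 2 - s / 2)"
proof
  define W where "W = (LBINT t:{0<..}. weight t)"
  have W: "W \<ge> 0" unfolding W_def set_lebesgue_integral_def by (intro integral_nonneg_AE) (simp add: weight_def)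
  show "3 * C * (W + 1) > 0" using C W by simp
  fix \<rho> :: real assume rho: "\<rho> > 0"
  let ?E = "exp (- ((\<beta> - 1 / 2) * \<rho>)) * (1 + \<rho>) powr (- 1 - s) * (1 + 1 / \<rho>) powr (N - 1 / 2 - s / 2)"
  have "transform \<rho> \<le> (LBINT r:{\<rho><..}. 3 * C * ?E * weight (r - \<rho>))"
    unfolding transform_def using integrand_upper[OF rho]
    by (intro set_integral_mono integrand_integrable rho set_integrable_mult_right weight_shift) (auto simp: mult.assoc)
  also have "\<dots> = 3 * C * ?E * W" unfolding W_def weight_shift(2)[of \<rho>, symmetric] by (rule set_integral_mult_right)
  also have "\<dots> \<le> 3 * C * ?E * (W + 1)" using C by (intro mult_left_mono) auto
  finally show "transform \<rho> \<le> 3 * C * (W + 1) * exp (- ((\<beta> - 1 / 2) * \<rho>)) * (1 + \<rho>) powr (- 1 - s)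
     * (1 + 1 / \<rho>) powr (N - 1 / 2 - s / 2)" by (simp only: mult_ac)
qed

text \<open>Only the window [\<rho>+1, \<rho>+2] is kept: it avoids the singularity at \<rho>, has
  length 1, and on it sinh r >= e^r/4 while cosh r - cosh \<rho> <= e^r.\<close>

lemma transform_lower:
  obtains c' where "c' > 0" "\<And>\<rho>. \<rho> > 0 \<Longrightarrow> c' * exp (- ((\<beta> - 1 / 2) * \<rho>)) * (1 + \<rho>) powr (- 1 - s) \<le> transform \<rho>"
proof
  let ?c = "c / 4 * exp (- ((\<beta> - 1 / 2) * 2)) * 3 powr (- 1 - s)"
  show "?c > 0" using c by simp
  fix \<rho> :: real assume rho: "\<rho> > 0"
  let ?L = "?c * exp (- ((\<beta> - 1 / 2) * \<rho>)) * (1 + \<rho>) powr (- 1 - s)"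
  have "?L = (LBINT r:{\<rho>+1..\<rho>+2}. ?L)" by (simp add: set_lebesgue_integral_def)
  also have "\<dots> \<le> (LBINT r:{\<rho>+1..\<rho>+2}. integrand \<rho> r)"
  proof (rule set_integral_mono)
    show "set_integrable lborel {\<rho>+1..\<rho>+2} (integrand \<rho>)"
      by (rule set_integrable_subset[OF integrand_integrable[OF rho]]) auto
    show "set_integrable lborel {\<rho>+1..\<rho>+2} (\<lambda>r. ?L)" by (simp add: set_integrable_def)
    fix r assume r: "r \<in> {\<rho>+1..\<rho>+2}"
    have r0: "r > 0" using r rho by simp
    have ch: "0 < cosh r - cosh \<rho>" "cosh r - cosh \<rho> \<le> exp r"
      using r rho cosh_le_exp_real[of r] cosh_real_ge_1[of \<rho>] by (auto simp: cosh_real_nonneg_less_iff)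
    have sh: "exp r / 4 \<le> sinh r"
    proof -
      have "1 + (1::real) \<le> exp 1" by (rule exp_ge_add_one_self)
      then have "2 * 1 \<le> exp r * exp r" using r rho by (intro mult_mono) (auto intro: order_trans[of _ "exp 1"])
      then have "exp (- r) \<le> exp r / 2" by (simp add: exp_minus field_simps)
      then show ?thesis by (simp add: sinh_field_def)
    qed
    have 1: "exp (r / 2) / 4 \<le> sinh r / sqrt (cosh r - cosh \<rho>)"
    proof -
      have "sqrt (cosh r - cosh \<rho>) \<le> sqrt (exp r)" using ch by simp
      also have "\<dots> = exp (r / 2)" by (rule real_sqrt_unique) (auto simp flip: exp_double)
      finally have "(exp r / 4) / exp (r / 2) \<le> sinh r / sqrt (cosh r - cosh \<rho>)"
        using ch sh r0 by (intro frac_le) auto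
      moreover have "exp r = exp (r / 2) * exp (r / 2)" by (simp flip: exp_add)
      ultimately show ?thesis by simp
    qed
    have "?L = (1 / 4) * c * (exp (- ((\<beta> - 1 / 2) * 2)) * exp (- ((\<beta> - 1 / 2) * \<rho>))) * (3 powr (- 1 - s) * (1 + \<rho>) powr (- 1 - s))"
      by (simp only: mult_ac divide_inverse mult_1_left)
    also have "\<dots> \<le> (1 / 4) * c * exp (- ((\<beta> - 1 / 2) * r)) * (1 + r) powr (- 1 - s)"
    proof (intro mult_mono)
      have "(\<beta> - 1 / 2) * r \<le> (\<beta> - 1 / 2) * (2 + \<rho>)" using beta r by (intro mult_left_mono) auto
      then show "exp (- ((\<beta> - 1 / 2) * 2)) * exp (- ((\<beta> - 1 / 2) * \<rho>)) \<le> exp (- ((\<beta> - 1 / 2) * r))"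
        by (simp add: field_simps flip: exp_add)
      have "3 powr (- 1 - s) * (1 + \<rho>) powr (- 1 - s) = (3 * (1 + \<rho>)) powr (- 1 - s)" by (simp only: powr_mult)
      also have "\<dots> \<le> (1 + r) powr (- 1 - s)" using r rho s by (intro powr_mono2') auto
      finally show "3 powr (- 1 - s) * (1 + \<rho>) powr (- 1 - s) \<le> (1 + r) powr (- 1 - s)" .
    qed (use c in auto)
    also have "\<dots> = exp (r / 2) / 4 * (c * exp (- (\<beta> * r)) * (1 + r) powr (- 1 - s))"
    proof -
      have "exp (- ((\<beta> - 1 / 2) * r)) = exp (r / 2) * exp (- (\<beta> * r))" by (simp add: algebra_simps flip: exp_add)
      then show ?thesis by (simp only: mult_ac divide_inverse mult_1_left)
    qed
    also have "\<dots> \<le> integrand \<rho> r"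
      unfolding integrand_def using c ch r0 by (intro mult_mono 1 lower) auto
    finally show "?L \<le> integrand \<rho> r" .
  qed
  also have "\<dots> \<le> transform \<rho>"
    unfolding transform_def using rho
    by (intro set_integral_mono_subset integrand_integrable integrand_nonneg) auto
  finally show "?L \<le> transform \<rho>" .
qed

text \<open>In the variable t = cosh r - cosh \<rho> the domain and the weight t^(-1/2) no longer
  depend on \<rho>. Only G(arcosh(cosh \<rho> + t)) does, and it decreases in \<rho>; in the
  original variable the singularity moves along with \<rho> and monotonicity is hidden.\<close>

lemma transform_substitution:
  assumes rho: "\<rho> > 0"
  shows "set_integrable lborel {0<..} (\<lambda>t. t powr (- 1 / 2) * G (arcosh (cosh \<rho> + t)))"
    and "transform \<rho> = (LBINT t:{0<..}. t powr (- 1 / 2) * G (arcosh (cosh \<rho> + t)))"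
proof -
  let ?f = "\<lambda>t. t powr (- 1 / 2) * G (arcosh (cosh \<rho> + t))"
  let ?g = "\<lambda>r. cosh r - cosh \<rho>"
  have pos: "?g r > 0" if "r > \<rho>" for r using that rho by (simp add: cosh_real_nonneg_less_iff)
  have fg: "?f (?g r) * sinh r = integrand \<rho> r" if "r > \<rho>" for r
    using pos[OF that] that rho
    by (simp add: integrand_def arcosh_cosh_real powr_minus_divide powr_half_sqrt)
  have int: "set_integrable lborel (einterval (ereal \<rho>) \<infinity>) (\<lambda>r. ?f (?g r) * sinh r)"
  proof -
    have "set_integrable lborel {\<rho><..} (\<lambda>r. ?f (?g r) * sinh r)"
      using integrand_integrable[OF rho] fg
      by (subst set_integrable_cong[OF refl refl, of _ _ "integrand \<rho>"]) (simp_all only: greaterThan_iff)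
    then show ?thesis by simp
  qed
  have dg: "(?g has_real_derivative sinh r) (at r)" for r by (auto intro!: derivative_eq_intros)
  have cf: "isCont ?f (?g r)" if "r > \<rho>" for r
  proof -
    have g: "cosh \<rho> + ?g r > 1" using that rho cosh_real_nonneg_less_iff[of 0 r] by simp
    have "isCont arcosh (cosh \<rho> + ?g r)"
      by (rule DERIV_isCont[OF arcosh_real_has_field_derivative[OF g]])
    then have "isCont (\<lambda>t. arcosh (cosh \<rho> + t)) (?g r)"
      by (rule isCont_o2[rotated]) (intro continuous_intros)
    moreover have "isCont G (arcosh (cosh \<rho> + ?g r))"
      using g that rho by (intro cont) (simp add: arcosh_real_gt_1_iff)
    ultimately have "isCont (\<lambda>t. G (arcosh (cosh \<rho> + t))) (?g r)" by (rule isCont_o2)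
    then show ?thesis using that rho by (intro continuous_intros) auto
  qed
  have lim0: "((ereal \<circ> ?g \<circ> real_of_ereal) \<longlongrightarrow> ereal 0) (at_right (ereal \<rho>))"
    unfolding ereal_tendsto_simps
  proof -
    have "(?g \<longlongrightarrow> ?g \<rho>) (at_right \<rho>)" by (intro tendsto_intros)
    then show "(?g \<longlongrightarrow> 0) (at_right \<rho>)" by simp
  qed
  have "filterlim ?g at_top at_top"
  proof (rule filterlim_at_top_mono)
    show "filterlim (\<lambda>r::real. - cosh \<rho> + r) at_top at_top"
      by (intro filterlim_tendsto_add_at_top[OF tendsto_const] filterlim_ident)
    show "\<forall>\<^sub>F r in at_top. - cosh \<rho> + r \<le> ?g r"
      using eventually_ge_at_top[of 0]
    proof eventually_elim
      case (elim r)
      then have "r \<le> cosh r" using real_le_sinh[of r] sinh_le_cosh_real[of r] by simp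
      then show ?case by simp
    qed
  qed
  then have liminf: "((ereal \<circ> ?g \<circ> real_of_ereal) \<longlongrightarrow> \<infinity>) (at_left \<infinity>)"
    unfolding ereal_tendsto_simps by (simp add: o_def)
  note * = interval_integral_substitution_nonneg[of "ereal \<rho>" \<infinity> ?g sinh ?f, OF _ dg cf _ _ _ lim0 liminf int]
  have pre: "ereal \<rho> < \<infinity>" "isCont sinh x"
    "ereal \<rho> < ereal x \<Longrightarrow> 0 \<le> ?f (?g x)" "ereal \<rho> \<le> ereal x \<Longrightarrow> 0 \<le> sinh x" for x
    using rho by (auto intro!: mult_nonneg_nonneg G_nonneg continuous_intros simp: arcosh_cosh_real)
  show "set_integrable lborel {0<..} ?f"
    using *(1)[OF pre(1) _ pre(2,3,4)] by simp
  have "transform \<rho> = (LBINT x:{\<rho><..}. (?f (?g x) * sinh x))"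
    unfolding transform_def 
  proof (rule set_lebesgue_integral_cong, simp, intro allI impI)
    show "integrand \<rho> r = ?f (?g r) * sinh r" if "r \<in> {\<rho><..}" for r
      using that by (intro fg[symmetric]) simp
  qed
  also have "\<dots> = (LBINT x:{0<..}. ?f x)"
    using *(2)[OF pre(1) _ pre(2,3,4)] by (simp add: interval_lebesgue_integral_def)
  finally show "transform \<rho> = (LBINT x:{0<..}. ?f x)" .
qed

lemma transform_antimono:
  assumes "0 < \<rho>" "\<rho> \<le> \<rho>'" shows "transform \<rho>' \<le> transform \<rho>"
proof -
  have r': "0 < \<rho>'" using assms by simp
  show ?thesis
    unfolding transform_substitution(2)[OF assms(1)] transform_substitution(2)[OF r']
  proof (intro set_integral_mono transform_substitution(1) assms(1) r' mult_left_mono anti)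
    fix t :: real assume t: "t \<in> {0<..}"
    have "cosh \<rho> > 1" "cosh \<rho> \<le> cosh \<rho>'" using assms cosh_real_nonneg_less_iff[of 0 \<rho>] by (auto simp: cosh_real_nonneg_le_iff)
    then have "\<not> arcosh (cosh \<rho>' + t) < arcosh (cosh \<rho> + t)"
      using t by (subst arcosh_less_iff_real) auto
    then show "arcosh (cosh \<rho> + t) \<le> arcosh (cosh \<rho>' + t)" by linarith
    show "0 < arcosh (cosh \<rho> + t)" using t \<open>cosh \<rho> > 1\<close> by simp
  qed auto
qed

end

text \<open>
  The estimate of \<open>bessel_moment_upper\<close> loses an arbitrarily small power at $0$; the exponent $q$ below
  is larger than the sharp $n+2s$, but integrability of $\rho^2 \mathcal{K}(\rho)$ only needs $q < n+2$.
\<close>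

theorem kernel_bounds:
  fixes n :: nat and s :: real
  assumes n: "n \<ge> 2" and s: "0 < s" "s < 1"
  defines "q \<equiv> real n + 3 / 2 + s / 2"
  shows "\<exists>c>0. \<forall>r>0. c * exp (- ((real n - 1) * r)) * (1 + r) powr (- 1 - s) \<le> kernel n s r"
    and "\<exists>C>0. \<forall>r>0. kernel n s r \<le> C * exp (- ((real n - 1) * r)) * (1 + r) powr (- 1 - s) * (1 + 1 / r) powr q"
    and "\<And>r r'. 0 < r \<Longrightarrow> r \<le> r' \<Longrightarrow> kernel n s r' \<le> kernel n s r"
proof -
  \<comment> \<open>The loss \<delta> = 1 - s gives the exponent n + 1 + s for odd n, and for even n
    the exponent n + 2 + s, which the Abel integral lowers by (1 + s)/2; since s < 1 neither result
    exceeds q.\<close>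
  have d: "1 - s > 0" using s by simp
  define j where "j = (if odd n then (n - 1) div 2 else n div 2)"
  define G where "G = (sinh_deriv ^^ j) (Bessel_profile n s)"
  note P = profile_sinh_deriv[OF n s(1) d, where j = j, folded G_def]
  obtain c C where c: "c > 0" "\<And>r. r > 0 \<Longrightarrow> c * exp (- (((real n - 1) / 2 + real j) * r)) * (1 + r) powr (- 1 - s) \<le> G r"
    and C: "C > 0" "\<And>r. r > 0 \<Longrightarrow> G r \<le> C * exp (- (((real n - 1) / 2 + real j) * r)) * (1 + r) powr (- 1 - s)
       * (1 + 1 / r) powr (1 + 2 * s + (1 - s) + 2 * real j)"
    using P(1,2) by blast
  have "(\<exists>c>0. \<forall>r>0. c * exp (- ((real n - 1) * r)) * (1 + r) powr (- 1 - s) \<le> kernel n s r) \<and>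
    (\<exists>C>0. \<forall>r>0. kernel n s r \<le> C * exp (- ((real n - 1) * r)) * (1 + r) powr (- 1 - s) * (1 + 1 / r) powr q) \<and>
    (\<forall>r r'. 0 < r \<longrightarrow> r \<le> r' \<longrightarrow> kernel n s r' \<le> kernel n s r)"
  proof (cases "odd n")
    case True
    have K: "kernel n s r = G r" for r using True by (simp add: kernel_def G_def j_def)
    have j: "real j = (real n - 1) / 2" using True n by (auto simp: j_def elim!: oddE)
    have b: "(real n - 1) / 2 + real j = real n - 1" by (simp add: j)
    have q: "1 + 2 * s + (1 - s) + 2 * real j \<le> q" using s by (simp add: j q_def field_simps)
    have "G r \<le> C * exp (- ((real n - 1) * r)) * (1 + r) powr (- 1 - s) * (1 + 1 / r) powr q" if "r > 0" for r
    proof -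
      have "G r \<le> C * exp (- ((real n - 1) * r)) * (1 + r) powr (- 1 - s) * (1 + 1 / r) powr (1 + 2 * s + (1 - s) + 2 * real j)"
        using C(2)[OF that] unfolding b .
      also have "\<dots> \<le> C * exp (- ((real n - 1) * r)) * (1 + r) powr (- 1 - s) * (1 + 1 / r) powr q"
        using C(1) that q by (intro mult_left_mono powr_mono) auto
      finally show ?thesis .
    qed
    moreover have "c * exp (- ((real n - 1) * r)) * (1 + r) powr (- 1 - s) \<le> G r" if "r > 0" for r
      using c(2)[OF that] unfolding b .
    ultimately show ?thesis
      unfolding K using c(1) C(1) P(3) by (intro conjI exI[of _ C] exI[of _ c]) simp_all
  next
    case False
    have j: "real j = real n / 2" using False by (auto simp: j_def)
    let ?N = "1 + 2 * s + (1 - s) + 2 * real j"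
    interpret Abel_transform G "(real n - 1) / 2 + real j" s ?N c C
    proof
      show "(real n - 1) / 2 + real j \<ge> 3 / 2" "?N \<ge> (1 + s) / 2"
        using n s by (auto simp: j field_simps)
    qed (use c C P(3,4) s in \<open>simp_all only:\<close>)
    have K: "kernel n s \<rho> = transform \<rho>" for \<rho>
      using False unfolding kernel_def transform_def integrand_def by (simp add: G_def j_def)
    have b: "(real n - 1) / 2 + real j - 1 / 2 = real n - 1" by (simp add: j field_simps)
    have q: "?N - 1 / 2 - s / 2 = q" by (simp add: j q_def field_simps)
    obtain C' where C': "C' > 0" "\<And>\<rho>. \<rho> > 0 \<Longrightarrow> transform \<rho> \<le> C' * exp (- ((real n - 1) * \<rho>)) * (1 + \<rho>) powr (- 1 - s)
       * (1 + 1 / \<rho>) powr q"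
      by (rule transform_upper[unfolded b q]) (blast intro: that)
    obtain c' where c': "c' > 0" "\<And>\<rho>. \<rho> > 0 \<Longrightarrow> c' * exp (- ((real n - 1) * \<rho>)) * (1 + \<rho>) powr (- 1 - s) \<le> transform \<rho>"
      by (rule transform_lower[unfolded b]) (blast intro: that)
    show ?thesis
      unfolding K using C' c' transform_antimono by (intro conjI exI[of _ C'] exI[of _ c']) simp_all
  qed
  then show "\<exists>c>0. \<forall>r>0. c * exp (- ((real n - 1) * r)) * (1 + r) powr (- 1 - s) \<le> kernel n s r"
    and "\<exists>C>0. \<forall>r>0. kernel n s r \<le> C * exp (- ((real n - 1) * r)) * (1 + r) powr (- 1 - s) * (1 + 1 / r) powr q"
    and "\<And>r r'. 0 < r \<Longrightarrow> r \<le> r' \<Longrightarrow> kernel n s r' \<le> kernel n s r"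
    by blast+
qed

section \<open>Fermi coordinates\<close>

text \<open>\<open>t\<close> labels the leaf \<open>U t\<close> and \<open>z\<close> the orbit of
  the boosts. Boosts become translations in t, \<open>Sigma_half lam\<close> becomes t < lam, the
  reflection t -> 2 lam - t, and the volume element dt dz.\<close>

definition fermi :: "real \<times> (real ^ 'k::finite) \<Rightarrow> 'k mink" where
  "fermi = (\<lambda>(t, z). (sqrt (1 + (norm z)\<^sup>2) * cosh t, sqrt (1 + (norm z)\<^sup>2) * sinh t, z))"

lemma one_plus_norm_sq_pos: "0 < 1 + (norm (z::'a::real_normed_vector))\<^sup>2"
  by (simp add: add_pos_nonneg)

lemma fermi_eq_chart: "fermi (t, z) = chart (sqrt (1 + (norm z)\<^sup>2) * sinh t, z)"
proof -
  have "1 + (norm (sqrt (1 + (norm z)\<^sup>2) * sinh t, z))\<^sup>2 = (1 + (norm z)\<^sup>2) * (1 + (sinh t)\<^sup>2)"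
    using one_plus_norm_sq_pos[of z] by (simp add: norm_Pair power_mult_distrib algebra_simps)
  also have "1 + (sinh t)\<^sup>2 = (cosh t)\<^sup>2" by (simp add: cosh_square_eq)
  finally show ?thesis
    by (simp add: fermi_def chart_def real_sqrt_mult)
qed

lemma chart_eq_fermi: "chart (y, z) = fermi (arsinh (y / sqrt (1 + (norm z)\<^sup>2)), z)"
  using one_plus_norm_sq_pos[of z] by (simp add: fermi_eq_chart less_imp_neq[symmetric])

lemma range_fermi: "range fermi = (hyperboloid :: 'k::finite mink set)"
proof -
  have "range fermi = range (chart :: _ \<Rightarrow> 'k mink)"
  proof (intro equalityI subsetI)
    fix x :: "'k mink" assume "x \<in> range fermi"
    then obtain t z where "x = fermi (t, z)" by auto
    then show "x \<in> range chart" by (simp add: fermi_eq_chart)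
  next
    fix x :: "'k mink" assume "x \<in> range chart"
    then obtain y z where "x = chart (y, z)" by auto
    then show "x \<in> range fermi" by (simp add: chart_eq_fermi)
  qed
  then show ?thesis by (simp add: range_chart)
qed

lemma fermi_in_hyperboloid [simp]: "fermi p \<in> hyperboloid"
  using range_fermi by blast

lemma chart_in_hyperboloid [simp]: "chart y \<in> hyperboloid"
  using range_chart by blast

lemma inj_fermi: "inj fermi"
proof (rule injI)
  fix p q :: "real \<times> (real ^ 'k)" assume "fermi p = fermi q"
  moreover have "sqrt (1 + (norm (snd p))\<^sup>2) \<noteq> 0" using one_plus_norm_sq_pos[of "snd p"] by simp
  ultimately show "p = q" by (cases p; cases q) (auto simp: fermi_def)
qed

lemma boost_fermi: "boost s (fermi (t, z)) = fermi (t + s, z)"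
  by (simp add: boost_def fermi_def cosh_add sinh_add algebra_simps)

lemma hrefl_fermi: "hrefl lam (fermi (t, z)) = fermi (2 * lam - t, z)"
proof -
  have "refl0 (fermi (t', z)) = fermi (- t', z)" for t' by (simp add: refl0_def fermi_def)
  then show ?thesis by (simp add: hrefl_def boost_fermi)
qed

lemma Sigma_half_eq: "Sigma_half lam = (fermi ` ({..<lam} \<times> UNIV) :: 'k::finite mink set)"
proof -
  have *: "{x \<in> hyperboloid. fst (snd x) = 0} = (range (\<lambda>z. fermi (0, z)) :: 'k mink set)"
  proof -
    have 1: "x \<in> range (\<lambda>z. fermi (0, z))" if "x \<in> hyperboloid" "fst (snd x) = 0" for x :: "'k mink"
    proof -
      obtain t z where x: "x = fermi (t, z)" using \<open>x \<in> hyperboloid\<close> range_fermi by (metis imageE surj_pair)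
      then have "sinh t = 0" using that(2) one_plus_norm_sq_pos[of z] by (simp add: fermi_def)
      then show ?thesis using x by simp
    qed
    have 2: "fst (snd (fermi (0, z))) = 0" for z :: "real ^ 'k" by (simp add: fermi_def)
    show ?thesis
    proof (intro equalityI subsetI)
      fix x :: "'k mink" assume "x \<in> {x \<in> hyperboloid. fst (snd x) = 0}"
      then show "x \<in> range (\<lambda>z. fermi (0, z))" using 1 by blast
    next
      fix x :: "'k mink" assume "x \<in> range (\<lambda>z. fermi (0, z))"
      then obtain z where "x = fermi (0, z)" by blast
      then show "x \<in> {x \<in> hyperboloid. fst (snd x) = 0}" by (simp add: 2)
    qed
  qed
  have "U t = (range (\<lambda>z. fermi (t, z)) :: 'k mink set)" for t
    unfolding U_def * by (simp add: image_image boost_fermi)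
  then show ?thesis unfolding Sigma_half_def by (auto simp: image_def)
qed

section \<open>Hyperbolic volume in Fermi coordinates\<close>

lemma measurable_chart [measurable]: "(chart :: _ \<Rightarrow> 'k::finite mink) \<in> borel \<rightarrow>\<^sub>M restrict_space borel hyperboloid"
proof (rule measurable_restrict_space2)
  have "continuous_on UNIV (chart :: _ \<Rightarrow> 'k mink)"
    unfolding chart_def by (intro continuous_intros)
  then show "(chart :: _ \<Rightarrow> 'k mink) \<in> borel_measurable borel" by (rule borel_measurable_continuous_onI)
qed auto

lemma measurable_fermi [measurable]: "(fermi :: _ \<Rightarrow> 'k::finite mink) \<in> borel \<rightarrow>\<^sub>M restrict_space borel hyperboloid"
proof (rule measurable_restrict_space2)
  have "continuous_on UNIV (fermi :: _ \<Rightarrow> 'k mink)"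
    unfolding fermi_def case_prod_beta by (intro continuous_intros)
  then show "(fermi :: _ \<Rightarrow> 'k mink) \<in> borel_measurable borel" by (rule borel_measurable_continuous_onI)
qed auto

text \<open>Since arsinh(y/a) is a primitive of 1/sqrt(a^2 + y^2), the image measure gives intervals
  their length, which determines Lebesgue measure. With a^2 = 1 + |z|^2 the density is that of the
  graph chart along the boost direction for fixed z.\<close>

lemma lborel_eq_arsinh_image:
  fixes a :: real assumes a: "a > 0"
  shows "lborel = distr (density lborel (\<lambda>y. ennreal (1 / sqrt (a\<^sup>2 + y\<^sup>2)))) borel (\<lambda>y. arsinh (y / a))"
proof (rule lborel_eqI)
  have m [measurable]: "(\<lambda>y. arsinh (y / a)) \<in> borel_measurable borel"
    using a by (intro borel_measurable_continuous_onI continuous_intros) auto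
  fix l u :: real assume "\<And>b. b \<in> Basis \<Longrightarrow> l \<bullet> b \<le> u \<bullet> b"
  then have lu: "l \<le> u" by simp
  have pre: "arsinh (y / a) \<in> box l u \<longleftrightarrow> y \<in> {a * sinh l<..<a * sinh u}" for y
  proof -
    have "arsinh (y / a) < u \<longleftrightarrow> y / a < sinh u" for u
      by (metis sinh_arsinh_real sinh_real_less_iff)
    moreover have "l < arsinh (y / a) \<longleftrightarrow> sinh l < y / a" for l
      by (metis sinh_arsinh_real sinh_real_less_iff)
    ultimately show ?thesis using a by (auto simp: field_simps)
  qed
  have "emeasure (distr (density lborel (\<lambda>y. ennreal (1 / sqrt (a\<^sup>2 + y\<^sup>2)))) borel (\<lambda>y. arsinh (y / a))) (box l u)
      = (\<integral>\<^sup>+y. ennreal (1 / sqrt (a\<^sup>2 + y\<^sup>2)) * indicator {a * sinh l<..<a * sinh u} y \<partial>lborel)"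
  proof -
    have ind: "indicator (box l u) (arsinh (y / a)) = (indicator {a * sinh l<..<a * sinh u} y :: ennreal)" for y
      by (simp only: indicator_def pre)
    have bx: "box l u \<in> sets (distr (density lborel (\<lambda>y. ennreal (1 / sqrt (a\<^sup>2 + y\<^sup>2)))) borel (\<lambda>y. arsinh (y / a)))"
      by simp
    show ?thesis
      unfolding nn_integral_indicator[OF bx, symmetric]
      by (subst nn_integral_distr, simp, simp, subst nn_integral_density) (simp_all add: ind del: box_real)
  qed
  also have "\<dots> = (\<integral>\<^sup>+y. ennreal (1 / sqrt (a\<^sup>2 + y\<^sup>2)) * indicator {a * sinh l..a * sinh u} y \<partial>lborel)"
  proof (rule nn_integral_cong_AE)
    have "AE y in lborel. y \<noteq> a * sinh l" "AE y in lborel. y \<noteq> a * sinh u" by (rule AE_lborel_singleton)+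
    then show "AE y in lborel. ennreal (1 / sqrt (a\<^sup>2 + y\<^sup>2)) * indicator {a * sinh l<..<a * sinh u} y
        = ennreal (1 / sqrt (a\<^sup>2 + y\<^sup>2)) * indicator {a * sinh l..a * sinh u} y"
      by eventually_elim (auto split: split_indicator)
  qed
  also have "\<dots> = ennreal (arsinh (a * sinh u / a) - arsinh (a * sinh l / a))"
  proof (rule nn_integral_FTC_Icc)
    fix y assume "y \<in> {a * sinh l..a * sinh u}"
    show "((\<lambda>y. arsinh (y / a)) has_real_derivative 1 / sqrt (a\<^sup>2 + y\<^sup>2)) (at y)"
    proof -
      have "sqrt ((y / a)\<^sup>2 + 1) * a = sqrt (a\<^sup>2 + y\<^sup>2)"
      proof -
        have "(y / a)\<^sup>2 + 1 = (a\<^sup>2 + y\<^sup>2) / a\<^sup>2" using a by (simp add: field_simps)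
        then show ?thesis using a by (simp add: real_sqrt_divide)
      qed
      moreover have "((\<lambda>y. arsinh (y / a)) has_real_derivative 1 / sqrt ((y / a)\<^sup>2 + 1) * (1 / a)) (at y)"
        by (rule DERIV_chain2[OF arsinh_real_has_field_derivative])
           (use a in \<open>auto intro!: derivative_eq_intros\<close>)
      ultimately show ?thesis by simp
    qed
  qed (use a lu in auto)
  also have "\<dots> = ennreal (u - l)" using a by (simp add: arsinh_sinh_real)
  finally show "emeasure (distr (density lborel (\<lambda>y. ennreal (1 / sqrt (a\<^sup>2 + y\<^sup>2)))) borel (\<lambda>y. arsinh (y / a))) (box l u)
     = (\<Prod>b\<in>Basis. (u - l) \<bullet> b)" by simp
qed simp

definition hvol0 :: "'k::finite mink measure" where
  "hvol0 = distr (density lborel (\<lambda>y. ennreal (1 / sqrt (1 + (norm y)\<^sup>2)))) (restrict_space borel hyperboloid) chart"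

lemma hvol_eq: "hvol = completion hvol0"
  by (simp add: hvol_def hvol0_def)

lemma sets_hvol0 [measurable_cong]: "sets hvol0 = sets (restrict_space borel hyperboloid)"
  by (simp add: hvol0_def)

text \<open>For fixed z the map t -> sqrt(1+|z|^2) sinh t has derivative sqrt(1+|z|^2) cosh t = x_0,
  which cancels the density 1/x_0. Hence Fubini with the boost variable innermost.\<close>

lemma hvol0_eq_fermi: "hvol0 = distr lborel (restrict_space borel hyperboloid) (fermi :: _ \<Rightarrow> 'k::finite mink)"
proof (rule measure_eqI)
  fix A :: "'k mink set" assume "A \<in> sets hvol0"
  then have A [measurable]: "A \<in> sets (restrict_space borel hyperboloid)" by (simp add: sets_hvol0)
  let ?w = "\<lambda>y :: real \<times> (real ^ 'k). ennreal (1 / sqrt (1 + (norm y)\<^sup>2))"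
  have [measurable]: "(\<lambda>y. indicator A (chart y)) \<in> borel_measurable (borel :: (real \<times> (real ^ 'k)) measure)"
    "(\<lambda>y. indicator A (fermi y)) \<in> borel_measurable (borel :: (real \<times> (real ^ 'k)) measure)"
    by measurable
  have w [measurable]: "?w \<in> borel_measurable borel" by measurable
  have inner: "(\<integral>\<^sup>+y. ?w (y, z) * indicator A (chart (y, z)) \<partial>lborel) = (\<integral>\<^sup>+t. indicator A (fermi (t, z)) \<partial>lborel)" for z
  proof -
    let ?a = "sqrt (1 + (norm z)\<^sup>2)"
    have a: "?a > 0" using one_plus_norm_sq_pos[of z] by simp
    have a2: "1 + (norm (y, z))\<^sup>2 = ?a\<^sup>2 + y\<^sup>2" for y :: real
      using one_plus_norm_sq_pos[of z] by (simp add: norm_Pair)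
    have [measurable]: "(\<lambda>y. arsinh (y / ?a)) \<in> borel_measurable borel"
      using a by (intro borel_measurable_continuous_onI continuous_intros) auto
    have [measurable]: "(\<lambda>t. indicator A (fermi (t, z)) :: ennreal) \<in> borel_measurable borel" by measurable
    have "(\<integral>\<^sup>+t. indicator A (fermi (t, z)) \<partial>lborel)
       = (\<integral>\<^sup>+t. indicator A (fermi (t, z)) \<partial>(distr (density lborel (\<lambda>y. ennreal (1 / sqrt (?a\<^sup>2 + y\<^sup>2)))) borel (\<lambda>y. arsinh (y / ?a))))"
      using lborel_eq_arsinh_image[OF a] by (rule arg_cong)
    also have "\<dots> = (\<integral>\<^sup>+y. ennreal (1 / sqrt (?a\<^sup>2 + y\<^sup>2)) * indicator A (fermi (arsinh (y / ?a), z)) \<partial>lborel)"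
      by (subst nn_integral_distr, simp, simp, subst nn_integral_density) auto
    also have "\<dots> = (\<integral>\<^sup>+y. ?w (y, z) * indicator A (chart (y, z)) \<partial>lborel)"
      by (simp only: a2 chart_eq_fermi)
    finally show ?thesis by simp
  qed
  have "emeasure hvol0 A = (\<integral>\<^sup>+y. ?w y * indicator A (chart y) \<partial>lborel)"
    unfolding hvol0_def
    by (subst emeasure_distr, simp, simp, subst emeasure_density)
       (auto simp: vimage_def intro!: nn_integral_cong split: split_indicator)
  also have "\<dots> = (\<integral>\<^sup>+z. \<integral>\<^sup>+y. ?w (y, z) * indicator A (chart (y, z)) \<partial>lborel \<partial>lborel)"
    unfolding lborel_prod[symmetric] by (subst lborel_pair.nn_integral_snd) (auto simp: lborel_prod)
  also have "\<dots> = (\<integral>\<^sup>+z. \<integral>\<^sup>+t. indicator A (fermi (t, z)) \<partial>lborel \<partial>lborel)"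
    by (simp only: inner)
  also have "\<dots> = (\<integral>\<^sup>+p. indicator A (fermi p) \<partial>lborel)"
    unfolding lborel_prod[symmetric] by (subst lborel_pair.nn_integral_snd) (auto simp: lborel_prod)
  also have "\<dots> = emeasure (distr lborel (restrict_space borel hyperboloid) fermi) A"
  proof -
    have A': "A \<in> sets (distr lborel (restrict_space borel hyperboloid) fermi)" using A by simp
    show ?thesis unfolding nn_integral_indicator[OF A', symmetric] by (subst nn_integral_distr) simp_all
  qed
  finally show "emeasure hvol0 A = emeasure (distr lborel (restrict_space borel hyperboloid) fermi) A" .
qed (simp add: sets_hvol0)

definition param_refl :: "real \<Rightarrow> real \<times> 'a \<Rightarrow> real \<times> 'a" where
  "param_refl lam = (\<lambda>(t, z). (2 * lam - t, z))"

lemma distr_param_refl: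
  "distr lborel borel (param_refl lam) = (lborel :: (real \<times> 'a::euclidean_space) measure)"
proof -
  have r: "distr lborel borel (\<lambda>t. 2 * lam - t) = (lborel :: real measure)"
    using lborel_real_affine[of "- 1" "2 * lam"] by (simp add: density_1 one_ennreal_def[symmetric])
  have i: "distr lborel borel (\<lambda>z. z) = (lborel :: 'a measure)" by (simp add: distr_id2)
  have "(lborel :: (real \<times> 'a) measure) = distr lborel borel (\<lambda>t. 2 * lam - t) \<Otimes>\<^sub>M distr lborel borel (\<lambda>z. z)"
    by (simp only: r i lborel_prod)
  also have "\<dots> = distr (lborel \<Otimes>\<^sub>M lborel) (borel \<Otimes>\<^sub>M borel) (\<lambda>(t, z). (2 * lam - t, z))"
    by (rule pair_measure_distr) (simp_all add: i lborel.sigma_finite_measure_axioms)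
  finally show ?thesis by (simp add: lborel_prod borel_prod param_refl_def)
qed

lemma measurable_param_refl [measurable]:
  "param_refl lam \<in> borel_measurable (borel :: (real \<times> 'a::euclidean_space) measure)"
  unfolding param_refl_def borel_prod[symmetric] by measurable

section \<open>The hyperbolic distance\<close>

lemma origin_eq_chart: "origin = chart 0"
  by (simp add: origin_def chart_def zero_prod_def)

lemma one_le_sqrt_mult:
  "1 + norm (y::'a::real_normed_vector) * norm (z::'b::real_normed_vector)
     \<le> sqrt (1 + (norm y)\<^sup>2) * sqrt (1 + (norm z)\<^sup>2)"
proof -
  have "0 \<le> (norm y - norm z)\<^sup>2" by simp
  then have "(1 + norm y * norm z)\<^sup>2 \<le> (1 + (norm y)\<^sup>2) * (1 + (norm z)\<^sup>2)"
    by (simp add: power2_eq_square algebra_simps)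
  then have "1 + norm y * norm z \<le> sqrt ((1 + (norm y)\<^sup>2) * (1 + (norm z)\<^sup>2))"
    by (rule real_le_rsqrt)
  then show ?thesis by (simp add: real_sqrt_mult)
qed

lemma hdist_chart:
  "hdist (chart y) (chart z) = arcosh (sqrt (1 + (norm y)\<^sup>2) * sqrt (1 + (norm z)\<^sup>2) - y \<bullet> z)"
  by (cases y; cases z) (simp add: hdist_def chart_def algebra_simps)

lemma mprod_chart_ge_1: "1 \<le> sqrt (1 + (norm y)\<^sup>2) * sqrt (1 + (norm z)\<^sup>2) - y \<bullet> (z::'a::real_inner)"
  using one_le_sqrt_mult[of y z] norm_cauchy_schwarz[of y z] by linarith

lemma cosh_hdist_chart:
  "cosh (hdist (chart y) (chart z)) = sqrt (1 + (norm y)\<^sup>2) * sqrt (1 + (norm z)\<^sup>2) - y \<bullet> z"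
  unfolding hdist_chart by (rule cosh_arcosh_real[OF mprod_chart_ge_1])

lemma hdist_nonneg:
  assumes "x \<in> hyperboloid" "y \<in> hyperboloid" shows "0 \<le> hdist x y"
proof -
  obtain a b where "x = chart a" "y = chart b" using assms unfolding range_chart[symmetric] by blast
  then show ?thesis by (simp add: hdist_chart arcosh_nonneg_real[OF mprod_chart_ge_1])
qed

lemma cosh_hdist_origin: "cosh (hdist (chart y) origin) = sqrt (1 + (norm y)\<^sup>2)"
  unfolding origin_eq_chart cosh_hdist_chart by simp

lemma sinh_hdist_origin: "sinh (hdist (chart y) origin) = norm y"
proof -
  have d: "0 \<le> hdist (chart y) origin" by (rule hdist_nonneg) (simp_all add: origin_eq_chart)
  have "(sinh (hdist (chart y) origin))\<^sup>2 = (norm y)\<^sup>2"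
    using cosh_square_eq[of "hdist (chart y) origin"] one_plus_norm_sq_pos[of y] by (simp add: cosh_hdist_origin)
  then show ?thesis using d by (simp add: power2_eq_iff_nonneg)
qed

lemma cosh_le_cosh_imp:
  fixes a b :: real assumes "cosh a \<le> cosh b" "0 \<le> b" shows "a \<le> b"
proof (cases "a \<ge> 0")
  case True
  then show ?thesis using assms by (simp add: cosh_real_nonneg_le_iff)
qed (use assms in auto)

text \<open>Only triangles with a vertex at the origin are needed. There the norm of the chart
  coordinate is sinh of the distance to the origin, so Cauchy-Schwarz puts cosh d between cosh(A -
  B) and cosh(A + B).\<close>

lemma hdist_triangle_origin:
  assumes "x \<in> hyperboloid" "y \<in> hyperboloid"
  shows "hdist x y \<le> hdist x origin + hdist y origin"
    and "hdist y origin \<le> hdist x origin + hdist x y"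
proof -
  obtain a b where xy: "x = chart a" "y = chart b" using assms unfolding range_chart[symmetric] by blast
  let ?A = "hdist x origin" and ?B = "hdist y origin"
  have o: "origin \<in> hyperboloid" by (simp add: origin_eq_chart)
  note nn = hdist_nonneg[OF assms(1) o] hdist_nonneg[OF assms(2) o] hdist_nonneg[OF assms]
  have c: "cosh (hdist x y) = cosh ?A * cosh ?B - a \<bullet> b"
    by (simp add: xy cosh_hdist_chart cosh_hdist_origin)
  have s: "norm a = sinh ?A" "norm b = sinh ?B" by (simp_all add: xy sinh_hdist_origin)
  have cs: "\<bar>a \<bullet> b\<bar> \<le> sinh ?A * sinh ?B" using Cauchy_Schwarz_ineq2[of a b] by (simp add: s)
  show "hdist x y \<le> ?A + ?B"
    by (rule cosh_le_cosh_imp) (use c cs nn in \<open>auto simp: cosh_add\<close>)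
  have "?B - ?A \<le> hdist x y"
    by (rule cosh_le_cosh_imp) (use c cs nn in \<open>auto simp: cosh_diff mult.commute\<close>)
  then show "?B \<le> ?A + hdist x y" by simp
qed

text \<open>With $a = \sqrt{1+|y|^2}$ and $b = \sqrt{1+|z|^2}$, the denominator comes from
  $2\cosh d - 2 = |y-z|^2 - (a-b)^2$ and $(a-b)(a+b) = |y|^2-|z|^2$.\<close>

lemma cosh_hdist_lower:
  "2 * (norm (y - z))\<^sup>2 / (sqrt (1 + (norm y)\<^sup>2) + sqrt (1 + (norm z)\<^sup>2))\<^sup>2 \<le> cosh (hdist (chart y) (chart z)) - 1"
proof -
  let ?a = "sqrt (1 + (norm y)\<^sup>2)" and ?b = "sqrt (1 + (norm z)\<^sup>2)"
  have ab: "?a > 0" "?b > 0" using one_plus_norm_sq_pos[of y] one_plus_norm_sq_pos[of z] by simp_all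
  have sq: "?a\<^sup>2 = 1 + (norm y)\<^sup>2" "?b\<^sup>2 = 1 + (norm z)\<^sup>2"
    using one_plus_norm_sq_pos[of y] one_plus_norm_sq_pos[of z] by simp_all
  have D: "(norm (y - z))\<^sup>2 = (norm y)\<^sup>2 + (norm z)\<^sup>2 - 2 * (y \<bullet> z)"
    by (simp add: power2_norm_eq_inner inner_diff_left inner_diff_right inner_commute)
  have "2 * (?a * ?b - y \<bullet> z - 1) = (norm (y - z))\<^sup>2 - (?a - ?b)\<^sup>2"
    unfolding D power2_diff sq by (simp add: algebra_simps)
  then have E: "2 * (?a * ?b - y \<bullet> z - 1) * (?a + ?b)\<^sup>2 = (norm (y - z))\<^sup>2 * (?a + ?b)\<^sup>2 - ((?a - ?b) * (?a + ?b))\<^sup>2"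
    by (simp only: power_mult_distrib left_diff_distrib[of "(norm (y - z))\<^sup>2" "(?a - ?b)\<^sup>2"])
  have "(?a - ?b) * (?a + ?b) = (norm y - norm z) * (norm y + norm z)"
  proof -
    have "(?a - ?b) * (?a + ?b) = ?a\<^sup>2 - ?b\<^sup>2" by (simp add: power2_eq_square algebra_simps)
    also have "\<dots> = (norm y - norm z) * (norm y + norm z)"
      unfolding sq by (simp add: power2_eq_square algebra_simps)
    finally show ?thesis .
  qed
  then have "((?a - ?b) * (?a + ?b))\<^sup>2 = (norm y - norm z)\<^sup>2 * (norm y + norm z)\<^sup>2"
    by (simp add: power_mult_distrib)
  also have "\<dots> \<le> (norm (y - z))\<^sup>2 * (norm y + norm z)\<^sup>2"
  proof (rule mult_right_mono)
    have "\<bar>norm y - norm z\<bar> \<le> \<bar>norm (y - z)\<bar>" using norm_triangle_ineq3[of y z] by simp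
    then show "(norm y - norm z)\<^sup>2 \<le> (norm (y - z))\<^sup>2" by (simp only: abs_le_square_iff)
  qed simp
  finally have "(norm (y - z))\<^sup>2 * ((?a + ?b)\<^sup>2 - (norm y + norm z)\<^sup>2) \<le> 2 * (?a * ?b - y \<bullet> z - 1) * (?a + ?b)\<^sup>2"
    unfolding E by (simp add: algebra_simps)
  moreover have "4 \<le> (?a + ?b)\<^sup>2 - (norm y + norm z)\<^sup>2"
    using one_le_sqrt_mult[of y z] unfolding power2_sum sq by simp
  then have "(norm (y - z))\<^sup>2 * 4 \<le> (norm (y - z))\<^sup>2 * ((?a + ?b)\<^sup>2 - (norm y + norm z)\<^sup>2)"
    by (intro mult_left_mono) auto
  ultimately have "2 * (norm (y - z))\<^sup>2 \<le> (?a * ?b - y \<bullet> z - 1) * (?a + ?b)\<^sup>2" by linarith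
  moreover have "0 < (?a + ?b)\<^sup>2" using ab by (intro zero_less_power add_pos_pos)
  ultimately show ?thesis
    unfolding cosh_hdist_chart by (simp only: pos_divide_le_eq)
qed

lemma cosh_le_one_plus_square:
  fixes d :: real assumes "0 \<le> d" "d \<le> 1" shows "cosh d - 1 \<le> 2 * d\<^sup>2"
proof -
  define e where "e = exp (- d)"
  have "exp d \<le> 1 + d + d\<^sup>2" using assms by (intro exp_bound) auto
  moreover have "exp (- d) \<le> 1 - d + d\<^sup>2"
  proof -
    have "1 + d \<le> exp d" by (rule exp_ge_add_one_self)
    then have "exp (- d) \<le> 1 / (1 + d)" using assms by (simp add: exp_minus divide_inverse le_imp_inverse_le)
    also have "\<dots> \<le> 1 - d + d\<^sup>2"
    proof -
      have "(1 - d + d\<^sup>2) * (1 + d) = 1 + d * d * d" by (simp add: algebra_simps power2_eq_square)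
      moreover have "0 \<le> d * d * d" "0 < 1 + d" using assms by simp_all
      ultimately show ?thesis by (simp add: pos_divide_le_eq)
    qed
    finally show ?thesis .
  qed
  ultimately have "exp d + exp (- d) \<le> (1 + d + d\<^sup>2) + (1 - d + d\<^sup>2)" by (rule add_mono)
  moreover have "exp d + exp (- d) = 2 * cosh d" by (simp add: cosh_field_def)
  moreover have "0 \<le> d\<^sup>2" by simp
  ultimately show ?thesis by linarith
qed

lemma divide_le_divide_cross:
  fixes t D P Q :: real
  shows "0 < P \<Longrightarrow> 0 < Q \<Longrightarrow> t * Q \<le> D * P \<Longrightarrow> t / P \<le> D / Q"
  by (simp add: field_simps)

text \<open>Lets the singularity of the kernel at \<open>chart y\<close> be measured by the
  Euclidean norm, with a constant depending on y alone. The minimum with 1 is there because d grows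
  only logarithmically in |y - z|.\<close>

lemma hdist_chart_lower:
  "min 1 (norm (y - z)) / (2 * sqrt (1 + (norm y)\<^sup>2) + 1) \<le> hdist (chart y) (chart z)"
proof -
  let ?a = "sqrt (1 + (norm y)\<^sup>2)" and ?b = "sqrt (1 + (norm z)\<^sup>2)" and ?d = "hdist (chart y) (chart z)"
  define D where "D = norm (y - z)"
  define \<tau> where "\<tau> = min 1 D"
  have a: "?a \<ge> 1" by simp
  have b: "?b > 0" using one_plus_norm_sq_pos[of z] by simp
  have t: "0 \<le> \<tau>" "\<tau> \<le> 1" "\<tau> \<le> D" by (auto simp: \<tau>_def D_def)
  have d0: "?d \<ge> 0" by (rule hdist_nonneg) auto
  \<comment> \<open>Triangle inequality for the vectors (1,y) and (1,z), whose norms are these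
    square roots.\<close>
  have bD: "?b \<le> ?a + D"
  proof -
    have "norm ((1::real), z) \<le> norm ((1::real), y) + norm ((1::real) - 1, z - y)"
      using norm_triangle_ineq[of "(1::real, y)" "(0, z - y)"] by simp
    then show ?thesis by (simp add: norm_Pair D_def norm_minus_commute)
  qed
  have "\<tau> / (2 * ?a + 1) \<le> D / (?a + ?b)"
  proof (cases "D = 0")
    case False
    then have D: "D > 0" by (simp add: D_def)
    have "\<tau> * (?a + ?b) \<le> \<tau> * (2 * ?a + D)" using bD t by (intro mult_left_mono) auto
    also have "\<dots> = 2 * ?a * \<tau> + \<tau> * D" by (simp add: algebra_simps)
    also have "\<dots> \<le> 2 * ?a * D + 1 * D" using t a D by (intro add_mono mult_left_mono mult_right_mono) auto
    finally have "\<tau> * (?a + ?b) \<le> D * (2 * ?a + 1)" by (simp add: algebra_simps)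
    moreover have "0 < 2 * ?a + 1" "0 < ?a + ?b" using a b by linarith+
    ultimately show ?thesis by (intro divide_le_divide_cross)
  qed (use t in auto)
  then have "(\<tau> / (2 * ?a + 1))\<^sup>2 \<le> (D / (?a + ?b))\<^sup>2" using t a by (intro power_mono) auto
  then have "2 * (\<tau> / (2 * ?a + 1))\<^sup>2 \<le> cosh ?d - 1"
    using cosh_hdist_lower[of y z] by (simp add: D_def power_divide)
  show ?thesis
  proof (cases "?d \<le> 1")
    case True
    then have "2 * (\<tau> / (2 * ?a + 1))\<^sup>2 \<le> 2 * ?d\<^sup>2"
      using \<open>2 * (\<tau> / (2 * ?a + 1))\<^sup>2 \<le> cosh ?d - 1\<close> cosh_le_one_plus_square[OF d0 True] by linarith
    then have "(\<tau> / (2 * ?a + 1))\<^sup>2 \<le> ?d\<^sup>2" by simp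
    then have "\<tau> / (2 * ?a + 1) \<le> ?d" using d0 by (rule power2_le_imp_le)
    then show ?thesis by (simp add: \<tau>_def D_def)
  next
    case False
    have "1 \<le> 1 * (2 * ?a + 1)" by simp
    with t(2) have "\<tau> \<le> 1 * (2 * ?a + 1)" by (rule order_trans)
    moreover have "0 < 2 * ?a + 1" using a by linarith
    ultimately have "\<tau> / (2 * ?a + 1) \<le> 1" by (simp only: pos_divide_le_eq)
    then show ?thesis using False by (simp add: \<tau>_def D_def)
  qed
qed

lemma cosh_hdist_fermi:
  "cosh (hdist (fermi (t, z)) (fermi (t', z'))) =
     sqrt (1 + (norm z)\<^sup>2) * sqrt (1 + (norm z')\<^sup>2) * cosh (t - t') - z \<bullet> z'"
proof -
  have "hdist (fermi (t, z)) (fermi (t', z')) =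
     arcosh (sqrt (1 + (norm z)\<^sup>2) * sqrt (1 + (norm z')\<^sup>2) * cosh (t - t') - z \<bullet> z')"
    by (simp add: hdist_def fermi_def cosh_diff algebra_simps)
  moreover have "1 \<le> sqrt (1 + (norm z)\<^sup>2) * sqrt (1 + (norm z')\<^sup>2) * cosh (t - t') - z \<bullet> z'"
    using mprod_chart_ge_1[of z z'] mult_left_mono[OF cosh_real_ge_1[of "t - t'"], of "sqrt (1 + (norm z)\<^sup>2) * sqrt (1 + (norm z')\<^sup>2)"]
    by simp
  ultimately show ?thesis by simp
qed

text \<open>The distance sees t only through cosh(t - t'); in particular a point on the same side of
  a leaf is no farther than its mirror image.\<close>

lemma hdist_fermi_mono:
  assumes "\<bar>t - t1\<bar> \<le> \<bar>t - t2\<bar>"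
  shows "hdist (fermi (t, z)) (fermi (t1, z')) \<le> hdist (fermi (t, z)) (fermi (t2, z'))"
proof (rule cosh_le_cosh_imp)
  have "cosh \<bar>t - t1\<bar> \<le> cosh \<bar>t - t2\<bar>" using assms by (subst cosh_real_nonneg_le_iff) auto
  then have "cosh (t - t1) \<le> cosh (t - t2)" by simp
  then show "cosh (hdist (fermi (t, z)) (fermi (t1, z'))) \<le> cosh (hdist (fermi (t, z)) (fermi (t2, z')))"
    unfolding cosh_hdist_fermi by (simp add: mult_left_mono)
qed (rule hdist_nonneg; simp)

lemma hdist_pos:
  assumes "x \<in> hyperboloid" "y \<in> hyperboloid" "x \<noteq> y" shows "0 < hdist x y"
proof -
  obtain a b where xy: "x = chart a" "y = chart b" using assms unfolding range_chart[symmetric] by blast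
  with assms(3) have "0 < min 1 (norm (a - b)) / (2 * sqrt (1 + (norm a)\<^sup>2) + 1)"
    by (intro divide_pos_pos add_nonneg_pos) auto
  then show ?thesis unfolding xy using hdist_chart_lower[of a b] by linarith
qed

section \<open>Integrability\<close>

text \<open>The sets need not be disjoint: overlaps only enlarge the right-hand side.\<close>

lemma nn_integral_countable_cover:
  assumes A: "\<And>k::nat. A k \<in> sets M" and S: "S \<subseteq> (\<Union>k. A k)"
    and f: "\<And>k x. x \<in> A k \<Longrightarrow> f x \<le> c k"
  shows "(\<integral>\<^sup>+x\<in>S. f x \<partial>M) \<le> (\<Sum>k. c k * emeasure M (A k))"
proof -
  have "(\<integral>\<^sup>+x\<in>S. f x \<partial>M) \<le> (\<integral>\<^sup>+x. (\<Sum>k. c k * indicator (A k) x) \<partial>M)"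
  proof (rule nn_integral_mono)
    fix x
    show "f x * indicator S x \<le> (\<Sum>k. c k * indicator (A k) x)"
    proof (cases "x \<in> S")
      case True
      then obtain k where k: "x \<in> A k" using S by auto
      have "f x * indicator S x \<le> c k * indicator (A k) x" using f[OF k] k True by simp
      also have "\<dots> = (\<Sum>i\<in>{k}. c i * indicator (A i) x)"
        by (simp only: sum.insert finite.emptyI empty_iff not_False_eq_True sum.empty add_0_right)
      also have "\<dots> \<le> (\<Sum>i. c i * indicator (A i) x)" by (rule sum_le_suminf) auto
      finally show ?thesis .
    qed simp
  qed
  also have "\<dots> = (\<Sum>k. \<integral>\<^sup>+x. c k * indicator (A k) x \<partial>M)"
    using A by (intro nn_integral_suminf) auto
  also have "\<dots> = (\<Sum>k. c k * emeasure M (A k))"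
    using A by (simp add: nn_integral_cmult_indicator)
  finally show ?thesis .
qed

text \<open>In dimension n, on the shell of radius about r 2^(-k), the integrand is of size 2^(kp)
  and the volume at most of size 2^(-kn), so the shells are dominated by a geometric series of ratio
  2^(p-n) < 1.\<close>

lemma nn_integral_norm_powr_ball_finite:
  fixes y0 :: "'a::euclidean_space" and r p :: real
  assumes r: "r > 0" and p: "0 \<le> p" "p < DIM('a)"
  shows "(\<integral>\<^sup>+y\<in>ball y0 r. ennreal (norm (y - y0) powr (- p)) \<partial>lborel) < \<infinity>"
proof -
  let ?n = "DIM('a)"
  define A where "A k = ball y0 (r / 2 ^ k) - ball y0 (r / 2 ^ Suc k)" for k
  let ?c = "\<lambda>k. (r / 2 ^ Suc k) powr (- p)"
  \<comment> \<open>At the centre \<open>0 powr (- p)\<close> is 0, so removing the point changes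
    nothing.\<close>
  have "(\<integral>\<^sup>+y\<in>ball y0 r. ennreal (norm (y - y0) powr (- p)) \<partial>lborel)
      = (\<integral>\<^sup>+y\<in>ball y0 r - {y0}. ennreal (norm (y - y0) powr (- p)) \<partial>lborel)"
    by (intro nn_integral_cong) (auto simp: indicator_def)
  also have "\<dots> \<le> (\<Sum>k. ennreal (?c k) * emeasure lborel (A k))"
  proof (rule nn_integral_countable_cover)
    show "ball y0 r - {y0} \<subseteq> (\<Union>k. A k)"
    proof
      fix y assume y: "y \<in> ball y0 r - {y0}"
      define d where "d = dist y0 y"
      have d: "0 < d" "d < r" using y by (auto simp: d_def)
      define P where "P = (\<lambda>k. r / 2 ^ Suc k \<le> d)"
      obtain k0 where "(1/2::real) ^ k0 < d / r" using real_arch_pow_inv[of "d / r" "1/2"] d r by auto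
      then have "r / 2 ^ k0 < d" using r by (simp add: power_divide field_simps)
      moreover have "r / 2 ^ Suc k0 \<le> r / 2 ^ k0" using r by (simp add: field_simps)
      ultimately have "P k0" by (simp add: P_def)
      \<comment> \<open>Minimality supplies the outer inequality d < r / 2^k, so this is the index
        of the shell that contains y.\<close>
      define k where "k = (LEAST k. P k)"
      have "P k" unfolding k_def by (rule LeastI[of P, OF \<open>P k0\<close>])
      moreover have "d < r / 2 ^ k"
      proof (cases k)
        case (Suc j)
        then have "\<not> P j" using not_less_Least[of j P] by (simp add: k_def)
        then show ?thesis by (simp add: P_def Suc)
      qed (use d in simp)
      ultimately have "y \<in> A k" by (auto simp: A_def P_def d_def)
      then show "y \<in> (\<Union>k. A k)" by blast
    qed
    fix k y assume y: "y \<in> A k"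
    then have "r / 2 ^ Suc k \<le> norm (y - y0)" by (auto simp: A_def dist_norm norm_minus_commute)
    then show "ennreal (norm (y - y0) powr (- p)) \<le> ennreal (?c k)"
      using r p by (intro ennreal_leI powr_mono2') auto
  qed (simp add: A_def)
  also have "\<dots> \<le> (\<Sum>k. ennreal ((r / 2) powr (- p) * unit_ball_vol ?n * r ^ ?n * (2 powr (p - ?n)) ^ k))"
  proof (intro suminf_le allI summableI)
    fix k
    have "ennreal (?c k) * emeasure lborel (A k) \<le> ennreal (?c k) * emeasure lborel (ball y0 (r / 2 ^ k))"
      by (intro mult_left_mono emeasure_mono) (auto simp: A_def)
    also have "\<dots> = ennreal (?c k * (unit_ball_vol ?n * (r / 2 ^ k) ^ ?n))"
      using r by (subst emeasure_ball) (auto simp: ennreal_mult'')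
    also have "?c k * (unit_ball_vol ?n * (r / 2 ^ k) ^ ?n) = (r / 2) powr (- p) * unit_ball_vol ?n * r ^ ?n * (2 powr (p - ?n)) ^ k"
    proof -
      have "?c k = ((r / 2) * (1 / 2 ^ k)) powr (- p)" by simp
      also have "\<dots> = (r / 2) powr (- p) * (1 / 2 ^ k) powr (- p)" by (simp only: powr_mult)
      also have "(1 / 2 ^ k :: real) powr (- p) = 2 powr (p * k)"
        by (simp add: powr_divide powr_powr powr_minus_divide mult.commute flip: powr_realpow)
      finally have 1: "?c k = (r / 2) powr (- p) * 2 powr (p * k)" .
      have "(r / 2 ^ k) ^ ?n = r ^ ?n * (1 / 2 ^ (k * ?n))" by (simp add: power_divide power_mult)
      also have "1 / 2 ^ (k * ?n) = (2::real) powr (- (real ?n * k))"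
        by (simp add: powr_minus_divide mult.commute flip: powr_realpow)
      finally have 2: "(r / 2 ^ k) ^ ?n = r ^ ?n * 2 powr (- (real ?n * k))" .
      have 3: "(2 powr (p - ?n)) ^ k = 2 powr (p * k) * 2 powr (- (real ?n * k))"
        by (simp add: powr_powr algebra_simps flip: powr_realpow powr_add)
      show ?thesis unfolding 1 2 3 by (simp only: mult_ac)
    qed
    finally show "ennreal (?c k) * emeasure lborel (A k)
      \<le> ennreal ((r / 2) powr (- p) * unit_ball_vol ?n * r ^ ?n * (2 powr (p - ?n)) ^ k)" .
  qed
  also have "\<dots> < \<infinity>"
  proof -
    have "2 powr (p - ?n) < 2 powr 0" using p by (intro powr_less_mono) auto
    then have "summable (\<lambda>k. (r / 2) powr (- p) * unit_ball_vol ?n * r ^ ?n * (2 powr (p - ?n)) ^ k)"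
      by (intro summable_mult summable_geometric) simp
    then have "(\<Sum>k. ennreal ((r / 2) powr (- p) * unit_ball_vol ?n * r ^ ?n * (2 powr (p - ?n)) ^ k)) \<noteq> top"
      using r by (intro ennreal_suminf_neq_top) auto
    then show ?thesis by (simp add: less_top)
  qed
  finally show ?thesis .
qed

text \<open>The borderline case: on the shell 2^k <= 1 + |y| < 2^(k+1) the volume, of size 2^(kn) in
  dimension n, cancels the power exactly, and convergence comes from the logarithm alone, through
  the sum of (k+1)^(-1-s).\<close>

lemma nn_integral_log_weight_finite:
  fixes s :: real assumes s: "s > 0"
  defines "f \<equiv> \<lambda>y::'a::euclidean_space. (1 + norm y) powr (- real DIM('a)) * (1 + ln (1 + norm y)) powr (- 1 - s)"
  shows "(\<integral>\<^sup>+y. ennreal (f y) \<partial>lborel) < \<infinity>"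
proof -
  let ?n = "DIM('a)"
  define A where "A k = ball (0::'a) (2 ^ Suc k - 1) - ball 0 (2 ^ k - 1)" for k
  let ?c = "\<lambda>k. (2 ^ k) powr (- real ?n) * (ln 2 * real (Suc k)) powr (- 1 - s)"
  have "(\<integral>\<^sup>+y. ennreal (f y) \<partial>lborel) = (\<integral>\<^sup>+y\<in>UNIV. ennreal (f y) \<partial>lborel)" by simp
  also have "\<dots> \<le> (\<Sum>k. ennreal (?c k) * emeasure lborel (A k))"
  proof (rule nn_integral_countable_cover)
    show "UNIV \<subseteq> (\<Union>k. A k)"
    proof
      fix y :: 'a
      define R where "R = 1 + norm y"
      have R: "R \<ge> 1" by (simp add: R_def)
      define P where "P = (\<lambda>k. R < 2 ^ Suc k)"
      obtain k0 where "R < (2::real) ^ k0" using real_arch_pow[of 2 R] by auto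
      also have "\<dots> \<le> 2 ^ Suc k0" by simp
      finally have "P k0" by (simp only: P_def)
      define k where "k = (LEAST k. P k)"
      have "P k" unfolding k_def by (rule LeastI[of P, OF \<open>P k0\<close>])
      moreover have "2 ^ k \<le> R"
      proof (cases k)
        case (Suc j)
        then have "\<not> P j" using not_less_Least[of j P] by (simp add: k_def)
        then show ?thesis by (simp add: P_def Suc)
      qed (use R in simp)
      ultimately have "y \<in> A k" by (auto simp: A_def P_def R_def)
      then show "y \<in> (\<Union>k. A k)" by blast
    qed
    fix k and y :: 'a assume y: "y \<in> A k"
    then have y: "2 ^ k \<le> 1 + norm y" by (auto simp: A_def)
    have "real k * ln 2 = ln (2 ^ k)" by (simp add: ln_realpow)
    also have "\<dots> \<le> ln (1 + norm y)" using y by (subst ln_le_cancel_iff) (auto simp: add_pos_nonneg)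
    \<comment> \<open>The extra 1 pays for passing from k to k + 1, as ln 2 < 1.\<close>
    finally have l: "ln 2 * real (Suc k) \<le> 1 + ln (1 + norm y)"
      using ln_less_self[of "2::real"] ln_2_less_1 by (simp add: algebra_simps)
    have "f y \<le> ?c k"
      unfolding f_def using y l s by (intro mult_mono powr_mono2') auto
    then show "ennreal (f y) \<le> ennreal (?c k)" by (rule ennreal_leI)
  qed (simp add: A_def)
  also have "\<dots> \<le> (\<Sum>k. ennreal (unit_ball_vol ?n * 2 ^ ?n * ln 2 powr (- 1 - s) * real (Suc k) powr (- 1 - s)))"
  proof (intro suminf_le allI summableI)
    fix k
    have "ennreal (?c k) * emeasure lborel (A k) \<le> ennreal (?c k) * emeasure lborel (ball (0::'a) (2 ^ Suc k))"
      by (intro mult_left_mono emeasure_mono) (auto simp: A_def)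
    also have "\<dots> = ennreal (?c k * (unit_ball_vol ?n * (2 ^ Suc k) ^ ?n))"
      by (subst emeasure_ball) (auto simp: ennreal_mult'')
    also have "?c k * (unit_ball_vol ?n * (2 ^ Suc k) ^ ?n) = unit_ball_vol ?n * 2 ^ ?n * ln 2 powr (- 1 - s) * real (Suc k) powr (- 1 - s)"
    proof -
      have "(2 ^ k) powr (- real ?n) = 1 / (2 ^ k) ^ ?n"
        by (simp add: powr_minus_divide powr_realpow)
      moreover have "((2::real) ^ Suc k) ^ ?n = 2 ^ ?n * (2 ^ k) ^ ?n" by (simp add: power_mult_distrib)
      ultimately show ?thesis by (simp only: powr_mult) simp
    qed
    finally show "ennreal (?c k) * emeasure lborel (A k)
      \<le> ennreal (unit_ball_vol ?n * 2 ^ ?n * ln 2 powr (- 1 - s) * real (Suc k) powr (- 1 - s))" .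
  qed
  also have "\<dots> < \<infinity>"
  proof -
    have "summable (\<lambda>k. real (Suc k) powr (- 1 - s))"
      using s by (subst summable_Suc_iff) (simp add: summable_real_powr_iff)
    then have "summable (\<lambda>k. unit_ball_vol ?n * 2 ^ ?n * ln 2 powr (- 1 - s) * real (Suc k) powr (- 1 - s))"
      by (rule summable_mult)
    then have "(\<Sum>k. ennreal (unit_ball_vol ?n * 2 ^ ?n * ln 2 powr (- 1 - s) * real (Suc k) powr (- 1 - s))) \<noteq> top"
      by (intro ennreal_suminf_neq_top) auto
    then show ?thesis by (simp add: less_top)
  qed
  finally show ?thesis .
qed

section \<open>Measurability and comparison of the kernel\<close>

lemma nn_integral_hvol0:
  assumes [measurable]: "f \<in> borel_measurable (hvol0 :: 'k::finite mink measure)"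
  shows "(\<integral>\<^sup>+\<xi>. f \<xi> \<partial>hvol0) = (\<integral>\<^sup>+y. ennreal (1 / sqrt (1 + (norm y)\<^sup>2)) * f (chart y) \<partial>lborel)"
proof -
  have [measurable]: "f \<in> borel_measurable (restrict_space borel hyperboloid)"
    using assms by (simp cong: measurable_cong_sets add: sets_hvol0)
  show ?thesis
    unfolding hvol0_def by (subst nn_integral_distr, simp, simp, subst nn_integral_density) auto
qed

lemma space_hvol0 [simp]: "space hvol0 = hyperboloid"
  by (simp add: hvol0_def space_restrict_space)

lemma measurable_hdist [measurable]: "hdist x \<in> borel_measurable (hvol0 :: 'k::finite mink measure)"
proof -
  have "hdist x = (\<lambda>y. arcosh (fst x * fst y - fst (snd x) * fst (snd y) - snd (snd x) \<bullet> snd (snd y)))"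
    by (simp add: hdist_def fun_eq_iff case_prod_beta)
  moreover have "\<dots> \<in> borel_measurable borel"
  proof -
    have [measurable]: "(\<lambda>y. fst x * fst y - fst (snd x) * fst (snd y) - snd (snd x) \<bullet> snd (snd y)) \<in> borel_measurable borel"
      by (intro borel_measurable_continuous_onI continuous_intros)
    have eq: "arcosh = (\<lambda>w::real. ln (w + (w\<^sup>2 - 1) powr (1 / 2)))" by (simp add: arcosh_def fun_eq_iff)
    have [measurable]: "(arcosh :: real \<Rightarrow> real) \<in> borel_measurable borel" unfolding eq by measurable
    show ?thesis by measurable
  qed
  ultimately have "hdist x \<in> borel_measurable borel" by simp
  then have "hdist x \<in> borel_measurable (restrict_space borel hyperboloid)" by (rule measurable_restrict_space1)
  then show ?thesis by (simp cong: measurable_cong_sets add: sets_hvol0)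
qed

text \<open>
  The values of \<open>kernel\<close> at nonpositive arguments are junk, about which not even measurability is known.
\<close>

definition pos_kernel :: "nat \<Rightarrow> real \<Rightarrow> real \<Rightarrow> real" where
  "pos_kernel n s r = (if r > 0 then kernel n s r else 0)"

text \<open>Monotonicity alone gives measurability, for both parities of n and without any
  regularity of the Abel integral in \<rho>.\<close>

lemma borel_pos_kernel:
  assumes "n \<ge> 2" "0 < s" "s < 1"
  shows "pos_kernel n s \<in> borel_measurable borel"
proof -
  have "mono_on {0<..} (\<lambda>r. - kernel n s r)"
    using kernel_bounds(3)[OF assms] by (auto simp: mono_on_def)
  then have "(\<lambda>r. - kernel n s r) \<in> borel_measurable (restrict_space borel {0<..})"
    by (rule borel_measurable_mono_on_fnc)
  then have "(\<lambda>r. - (- kernel n s r)) \<in> borel_measurable (restrict_space borel {0<..})"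
    by (rule borel_measurable_uminus)
  then have "(\<lambda>r. indicator {0<..} r *\<^sub>R kernel n s r) \<in> borel_measurable borel"
    by (subst (asm) borel_measurable_restrict_space_iff) auto
  also have "(\<lambda>r. indicator {0<..} r *\<^sub>R kernel n s r) = pos_kernel n s"
    by (auto simp: pos_kernel_def fun_eq_iff)
  finally show ?thesis .
qed

lemma kernel_pos:
  assumes "n \<ge> 2" "0 < s" "s < 1" "r > 0" shows "0 < kernel n s r"
proof -
  obtain c where "c > 0" "\<And>r. r > 0 \<Longrightarrow> c * exp (- ((real n - 1) * r)) * (1 + r) powr (- 1 - s) \<le> kernel n s r"
    using kernel_bounds(1)[OF assms(1-3)] by blast
  moreover from this have "0 < c * exp (- ((real n - 1) * r)) * (1 + r) powr (- 1 - s)" using assms by simp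
  ultimately show ?thesis using assms(4) by (meson less_le_trans)
qed

text \<open>Both sides are compared with e^(-(n-1)\<rho>) (1+\<rho>)^(-1-s), for which a shift by R
  costs only a constant because 1 + \<rho> + R <= (1+\<rho>)(1+R). With R = 1 + d(x,o) this bounds
  K(d(x,\<xi>)), away from \<xi> = x, by the weight K(1 + d(\<xi>,o)) of
  \<open>L_space\<close>.\<close>

lemma kernel_Harnack:
  assumes A: "n \<ge> 2" "0 < s" "s < 1" and d: "\<delta> > 0" and R: "R \<ge> 0"
  obtains C where "C > 0" "\<And>\<rho> \<rho>'. \<delta> \<le> \<rho> \<Longrightarrow> 0 < \<rho>' \<Longrightarrow> \<rho>' \<le> \<rho> + R \<Longrightarrow> kernel n s \<rho> \<le> C * kernel n s \<rho>'"
proof -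
  obtain c where c: "c > 0" "\<And>r. r > 0 \<Longrightarrow> c * exp (- ((real n - 1) * r)) * (1 + r) powr (- 1 - s) \<le> kernel n s r"
    using kernel_bounds(1)[OF A] by blast
  let ?q = "real n + 3 / 2 + s / 2"
  obtain C where C: "C > 0" "\<And>r. r > 0 \<Longrightarrow> kernel n s r \<le> C * exp (- ((real n - 1) * r)) * (1 + r) powr (- 1 - s) * (1 + 1 / r) powr ?q"
    using kernel_bounds(2)[OF A] by blast
  define B where "B = exp (- ((real n - 1) * R)) * (1 + R) powr (- 1 - s)"
  have B: "B > 0" using R by (simp add: B_def)
  let ?C = "C * (1 + 1 / \<delta>) powr ?q / (c * B)"
  show ?thesis
  proof
    have "1 + 1 / \<delta> > 0" using d by (simp add: add_pos_pos)
    then show "?C > 0" using C c B by simp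
    fix \<rho> \<rho>' assume r: "\<delta> \<le> \<rho>" and r': "0 < \<rho>'" "\<rho>' \<le> \<rho> + R"
    have r0: "\<rho> > 0" using d r by simp
    let ?E = "exp (- ((real n - 1) * \<rho>)) * (1 + \<rho>) powr (- 1 - s)"
    have "kernel n s \<rho> \<le> C * exp (- ((real n - 1) * \<rho>)) * (1 + \<rho>) powr (- 1 - s) * (1 + 1 / \<rho>) powr ?q"
      by (rule C(2)[OF r0])
    also have "\<dots> \<le> C * exp (- ((real n - 1) * \<rho>)) * (1 + \<rho>) powr (- 1 - s) * (1 + 1 / \<delta>) powr ?q"
      using C(1) r r0 d A by (intro mult_left_mono powr_mono2 add_mono frac_le) auto
    also have "\<dots> = ?C * (c * (?E * B))" using c B by simp
    also have "\<dots> \<le> ?C * kernel n s \<rho>'"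
    proof (rule mult_left_mono)
      have "(1 + \<rho>) powr (- 1 - s) * (1 + R) powr (- 1 - s) = ((1 + \<rho>) * (1 + R)) powr (- 1 - s)"
        by (simp only: powr_mult)
      also have "\<dots> \<le> (1 + (\<rho> + R)) powr (- 1 - s)"
        using r0 R A by (intro powr_mono2') (auto simp: algebra_simps)
      finally have "exp (- ((real n - 1) * (\<rho> + R))) * ((1 + \<rho>) powr (- 1 - s) * (1 + R) powr (- 1 - s))
         \<le> exp (- ((real n - 1) * (\<rho> + R))) * (1 + (\<rho> + R)) powr (- 1 - s)"
        by (intro mult_left_mono) auto
      moreover have "exp (- ((real n - 1) * (\<rho> + R))) = exp (- ((real n - 1) * \<rho>)) * exp (- ((real n - 1) * R))"
        by (simp add: algebra_simps flip: exp_add)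
      ultimately have "?E * B \<le> exp (- ((real n - 1) * (\<rho> + R))) * (1 + (\<rho> + R)) powr (- 1 - s)"
        by (simp only: B_def mult_ac)
      then have "c * (?E * B) \<le> c * (exp (- ((real n - 1) * (\<rho> + R))) * (1 + (\<rho> + R)) powr (- 1 - s))"
        using c by (intro mult_left_mono) auto
      also have "\<dots> \<le> kernel n s (\<rho> + R)" using c(2)[of "\<rho> + R"] r0 R by (simp add: mult.assoc)
      also have "\<dots> \<le> kernel n s \<rho>'" by (rule kernel_bounds(3)[OF A r'])
      finally show "c * (?E * B) \<le> kernel n s \<rho>'" .
    qed (use C c B in auto)
    finally show "kernel n s \<rho> \<le> ?C * kernel n s \<rho>'" .
  qed
qed

text \<open>Says that constants belong to \<open>L_space\<close>, which takes care of the term u(x)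
  far from x. In the chart e^d >= 1 + |y|, so kernel and density together are dominated by the
  borderline weight of \<open>nn_integral_log_weight_finite\<close>.\<close>

lemma nn_integral_kernel_finite:
  assumes A: "n \<ge> 2" "0 < s" "s < 1" and k: "CARD('k::finite) = n - 1"
  shows "(\<integral>\<^sup>+\<xi>. ennreal (kernel n s (1 + hdist \<xi> origin)) \<partial>(hvol0 :: 'k mink measure)) < \<infinity>"
proof -
  let ?q = "real n + 3 / 2 + s / 2"
  obtain C where C: "C > 0" "\<And>r. r > 0 \<Longrightarrow> kernel n s r \<le> C * exp (- ((real n - 1) * r)) * (1 + r) powr (- 1 - s) * (1 + 1 / r) powr ?q"
    using kernel_bounds(2)[OF A] by blast
  have n: "DIM(real \<times> (real ^ 'k)) = n" using k A by simp
  let ?f = "\<lambda>y :: real \<times> (real ^ 'k). (1 + norm y) powr (- real n) * (1 + ln (1 + norm y)) powr (- 1 - s)"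
  have hsym: "hdist \<xi> origin = hdist origin \<xi>" for \<xi> :: "'k mink"
    by (cases \<xi>) (simp add: hdist_def origin_def)
  have hn: "hdist \<xi> origin \<ge> 0" if "\<xi> \<in> hyperboloid" for \<xi> :: "'k mink"
    using that by (intro hdist_nonneg) (auto simp: origin_eq_chart)
  note [measurable] = borel_pos_kernel[OF A]
  have "(\<integral>\<^sup>+\<xi>. ennreal (kernel n s (1 + hdist \<xi> origin)) \<partial>(hvol0 :: 'k mink measure))
     = (\<integral>\<^sup>+\<xi>. ennreal (pos_kernel n s (1 + hdist origin \<xi>)) \<partial>(hvol0 :: 'k mink measure))"
  proof (rule nn_integral_cong)
    fix \<xi> :: "'k mink" assume "\<xi> \<in> space hvol0"
    then have "0 < 1 + hdist \<xi> origin" using hn[of \<xi>] by simp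
    then show "ennreal (kernel n s (1 + hdist \<xi> origin)) = ennreal (pos_kernel n s (1 + hdist origin \<xi>))"
      by (simp add: pos_kernel_def hsym)
  qed
  also have "\<dots> = (\<integral>\<^sup>+y. ennreal (1 / sqrt (1 + (norm y)\<^sup>2)) * ennreal (pos_kernel n s (1 + hdist origin (chart y :: 'k mink))) \<partial>lborel)"
    by (rule nn_integral_hvol0) measurable
  also have "\<dots> \<le> (\<integral>\<^sup>+y. ennreal (2 * (C * 2 powr ?q)) * ennreal (?f y) \<partial>lborel)"
  proof (rule nn_integral_mono)
    fix y :: "real \<times> (real ^ 'k)"
    define d where "d = hdist (chart y) origin"
    have d0: "d \<ge> 0" unfolding d_def by (intro hn) simp
    have ed: "exp d = sqrt (1 + (norm y)\<^sup>2) + norm y"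
      using cosh_plus_sinh[of d] by (simp add: d_def cosh_hdist_origin sinh_hdist_origin)
    have e1: "1 + norm y \<le> exp d" unfolding ed by simp
    have ny: "0 < 1 + norm y" by (simp add: add_pos_nonneg)
    have l: "ln (1 + norm y) \<le> d"
    proof -
      have "ln (1 + norm y) \<le> ln (exp d)" using e1 ny by (subst ln_le_cancel_iff) auto
      then show ?thesis by simp
    qed
    have w: "1 / sqrt (1 + (norm y)\<^sup>2) \<le> 2 / (1 + norm y)"
    proof -
      have "1 + norm y \<le> 2 * sqrt (1 + (norm y)\<^sup>2)"
        using real_sqrt_ge_abs2[of "norm y" 1] by (simp add: add.commute) (smt (verit) norm_ge_zero real_sqrt_ge_one zero_le_power2)
      then show ?thesis using ny one_plus_norm_sq_pos[of y] by (intro divide_le_divide_cross) auto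
    qed
    have "kernel n s (1 + d) \<le> C * exp (- ((real n - 1) * (1 + d))) * (1 + (1 + d)) powr (- 1 - s) * (1 + 1 / (1 + d)) powr ?q"
      using d0 by (intro C(2)) auto
    also have "\<dots> \<le> C * exp (- ((real n - 1) * d)) * (1 + ln (1 + norm y)) powr (- 1 - s) * 2 powr ?q"
      using d0 C(1) A l by (intro mult_mono mult_left_mono powr_mono2 powr_mono2') (auto simp: mult_left_mono add_pos_nonneg)
    also have "\<dots> \<le> C * (1 + norm y) powr (- (real n - 1)) * (1 + ln (1 + norm y)) powr (- 1 - s) * 2 powr ?q"
    proof -
      have "exp (- ((real n - 1) * d)) = exp d powr (- (real n - 1))"
        by (simp add: exp_powr_real algebra_simps)
      also have "\<dots> \<le> (1 + norm y) powr (- (real n - 1))"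
        using e1 ny A by (intro powr_mono2') auto
      finally show ?thesis using C(1) by (intro mult_right_mono mult_left_mono) auto
    qed
    finally have K: "kernel n s (1 + d) \<le> C * (1 + norm y) powr (- (real n - 1)) * (1 + ln (1 + norm y)) powr (- 1 - s) * 2 powr ?q" .
    have "1 / sqrt (1 + (norm y)\<^sup>2) * pos_kernel n s (1 + hdist origin (chart y))
        = 1 / sqrt (1 + (norm y)\<^sup>2) * kernel n s (1 + d)"
      using d0 by (simp add: pos_kernel_def d_def hsym)
    also have "\<dots> \<le> 2 / (1 + norm y) * (C * (1 + norm y) powr (- (real n - 1)) * (1 + ln (1 + norm y)) powr (- 1 - s) * 2 powr ?q)"
      using d0 ny kernel_pos[OF A, of "1 + d"] by (intro mult_mono w K) auto
    also have "\<dots> = 2 * (C * 2 powr ?q) * ?f y"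
    proof -
      have "(1 + norm y) powr (- real n) = (1 + norm y) powr (- (real n - 1)) * (1 + norm y) powr (- 1)"
        by (subst powr_add[symmetric]) simp
      also have "(1 + norm y) powr (- 1) = 1 / (1 + norm y)" using ny by (simp add: powr_minus_divide)
      finally show ?thesis by simp
    qed
    finally have "ennreal (1 / sqrt (1 + (norm y)\<^sup>2) * pos_kernel n s (1 + hdist origin (chart y))) \<le> ennreal (2 * (C * 2 powr ?q) * ?f y)"
      by (rule ennreal_leI)
    then show "ennreal (1 / sqrt (1 + (norm y)\<^sup>2)) * ennreal (pos_kernel n s (1 + hdist origin (chart y)))
      \<le> ennreal (2 * (C * 2 powr ?q)) * ennreal (?f y)"
      using C(1) by (simp add: ennreal_mult'[symmetric])
  qed
  also have "\<dots> = ennreal (2 * (C * 2 powr ?q)) * (\<integral>\<^sup>+y. ennreal (?f y) \<partial>lborel)"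
    by (rule nn_integral_cmult) measurable
  also have "\<dots> < \<infinity>"
    using nn_integral_log_weight_finite[OF A(2), where 'a = "real \<times> (real ^ 'k)"] unfolding n
    by (simp add: ennreal_mult_less_top)
  finally show ?thesis .
qed

section \<open>Convergence of the singular integral at the minimum\<close>

lemma C11_loc_minimum_quadratic:
  fixes \<Omega> :: "'k::finite mink set"
  assumes u: "u \<in> C11_loc \<Omega>" and op: "openin (top_of_set hyperboloid) \<Omega>"
    and x: "chart y0 \<in> \<Omega>" and min: "\<And>\<xi>. \<xi> \<in> \<Omega> \<Longrightarrow> u (chart y0) \<le> u \<xi>"
  obtains r L where "0 < r" "r \<le> 1" "0 \<le> L"
    "\<And>z. z \<in> ball y0 r \<Longrightarrow> \<bar>u (chart y0) - u (chart z)\<bar> \<le> L * (norm (z - y0))\<^sup>2"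
proof -
  let ?V = "chart -` \<Omega>"
  let ?v = "\<lambda>z. u (chart z)"
  obtain g where g: "\<And>y. y \<in> ?V \<Longrightarrow> (?v has_derivative (\<lambda>h. g y \<bullet> h)) (at y)"
    "\<And>y. y \<in> ?V \<Longrightarrow> \<exists>r>0. \<exists>L. L-lipschitz_on (ball y r \<inter> ?V) g"
    using u unfolding C11_loc_def by blast
  have V: "open ?V"
  proof -
    obtain T where T: "open T" "\<Omega> = hyperboloid \<inter> T" using op by (auto simp: openin_open)
    then have "?V = chart -` T" using chart_in_hyperboloid by blast
    moreover have "continuous_on UNIV (chart :: _ \<Rightarrow> 'k mink)" unfolding chart_def by (intro continuous_intros)
    ultimately show ?thesis using T(1) by (simp add: open_vimage)
  qed
  have y0: "y0 \<in> ?V" using x by simp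
  have "(\<lambda>h. g y0 \<bullet> h) = (\<lambda>h. 0)"
    by (rule differential_zero_maxmin[OF y0 V g(1)[OF y0]]) (use min in auto)
  then have "g y0 \<bullet> g y0 = 0" by metis
  then have g0: "g y0 = 0" by simp
  obtain r1 L where r1: "r1 > 0" and L: "L-lipschitz_on (ball y0 r1 \<inter> ?V) g" using g(2)[OF y0] by blast
  obtain r2 where r2: "r2 > 0" "ball y0 r2 \<subseteq> ?V" using V y0 unfolding open_contains_ball by blast
  define r where "r = min 1 (min r1 r2)"
  have L0: "0 \<le> L" using L by (rule lipschitz_on_nonneg)
  show ?thesis
  proof
    show "0 < r" "r \<le> 1" using r1 r2 by (auto simp: r_def)
    show "0 \<le> L" by (rule L0)
    fix z assume z: "z \<in> ball y0 r"
    let ?S = "cball y0 (norm (z - y0))"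
    have S: "w \<in> ball y0 r1 \<inter> ?V" if "w \<in> ?S" for w
    proof -
      have "dist y0 w < r" using that z by (auto simp: dist_norm norm_minus_commute)
      then show ?thesis using r2 by (auto simp: r_def)
    qed
    \<comment> \<open>Mean value inequality on the ball of radius |z - y0|, where the gradient,
      being Lipschitz and zero at y0, is at most L |z - y0|.\<close>
    have "norm (?v y0 - ?v z) \<le> (L * norm (z - y0)) * norm (y0 - z)"
    proof (rule differentiable_bound[of ?S])
      fix w assume w: "w \<in> ?S"
      show "(?v has_derivative (\<lambda>h. g w \<bullet> h)) (at w within ?S)"
        by (rule has_derivative_at_withinI[OF g(1)]) (use S[OF w] in auto)
      have "norm (g w) \<le> L * norm (z - y0)"
      proof -
        have "dist (g w) (g y0) \<le> L * dist w y0"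
          by (rule lipschitz_onD[OF L S[OF w]]) (use y0 r1 in auto)
        also have "\<dots> \<le> L * norm (z - y0)" using w L0 by (intro mult_left_mono) (auto simp: dist_commute)
        finally show ?thesis by (simp add: g0)
      qed
      moreover have "onorm (\<lambda>h. g w \<bullet> h) \<le> norm (g w)"
        by (rule onorm_bound) (auto simp: Cauchy_Schwarz_ineq2)
      ultimately show "onorm (\<lambda>h. g w \<bullet> h) \<le> L * norm (z - y0)" by linarith
    qed (auto simp: dist_norm norm_minus_commute)
    then show "\<bar>u (chart y0) - u (chart z)\<bar> \<le> L * (norm (z - y0))\<^sup>2"
      by (simp add: norm_minus_commute power2_eq_square mult.assoc)
  qed
qed

text \<open>Near x the quadratic bound leaves a singularity of order q - 2 < n in the chart;
  elsewhere \<open>kernel_Harnack\<close> bounds the integrand by |u(x)| + |u| times the weight of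
  \<open>L_space\<close>. The value at x stays that of \<open>u\<close>, since the exceptional null
  set of \<open>u'\<close> may contain x.\<close>

lemma difference_quotient_integrable:
  fixes u u' :: "'k::finite mink \<Rightarrow> real"
  assumes A: "n \<ge> 2" "0 < s" "s < 1" and k: "CARD('k) = n - 1"
    and u: "(\<integral>\<^sup>+\<xi>. ennreal (\<bar>u \<xi>\<bar> * kernel n s (1 + hdist \<xi> origin)) \<partial>hvol0) < \<infinity>"
    and u' [measurable]: "u' \<in> borel_measurable hvol0" and ae: "AE \<xi> in hvol0. u \<xi> = u' \<xi>"
    and r: "0 < r" "r \<le> 1" and L: "0 \<le> L"
    and quad: "\<And>z. z \<in> ball y0 r \<Longrightarrow> \<bar>u (chart y0) - u (chart z)\<bar> \<le> L * (norm (z - y0))\<^sup>2"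
  shows "integrable hvol0 (\<lambda>\<xi>. (u (chart y0) - u' \<xi>) * pos_kernel n s (hdist (chart y0) \<xi>))"
proof -
  let ?x = "chart y0 :: 'k mink"
  let ?q = "real n + 3 / 2 + s / 2"
  \<comment> \<open>The reciprocal of the constant in \<open>hdist_chart_lower\<close>; unrelated to
    the \<kappa> of the theorem.\<close>
  define \<kappa> where "\<kappa> = 2 * sqrt (1 + (norm y0)\<^sup>2) + 1"
  have [measurable]: "ball y0 r \<in> sets borel" by simp
  have kap: "\<kappa> \<ge> 1" by (simp add: \<kappa>_def)
  have n: "DIM(real \<times> (real ^ 'k)) = n" using k A by simp
  note [measurable] = borel_pos_kernel[OF A]
  have o: "(origin :: 'k mink) \<in> hyperboloid" by (simp add: origin_eq_chart)
  obtain C where C: "C > 0" "\<And>r. r > 0 \<Longrightarrow> kernel n s r \<le> C * exp (- ((real n - 1) * r)) * (1 + r) powr (- 1 - s) * (1 + 1 / r) powr ?q"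
    using kernel_bounds(2)[OF A] by blast
  have d1: "r / \<kappa> > 0" using r kap by simp
  have R0: "1 + hdist ?x origin \<ge> 0" using hdist_nonneg[OF chart_in_hyperboloid o, of y0] by simp
  obtain H where H: "H > 0" "\<And>\<rho> \<rho>'. r / \<kappa> \<le> \<rho> \<Longrightarrow> 0 < \<rho>' \<Longrightarrow> \<rho>' \<le> \<rho> + (1 + hdist ?x origin) \<Longrightarrow> kernel n s \<rho> \<le> H * kernel n s \<rho>'"
    by (rule kernel_Harnack[OF A d1 R0]) (rule that)
  let ?h = "\<lambda>\<xi>. (u ?x - u' \<xi>) * pos_kernel n s (hdist ?x \<xi>)"
  define N where "N \<xi> = L * (C * (1 + \<kappa>) powr ?q) * (norm (snd \<xi> - y0) powr (- (?q - 2)) * indicator (ball y0 r) (snd \<xi>))" for \<xi> :: "'k mink"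
  define K1 where "K1 \<xi> = kernel n s (1 + hdist \<xi> origin)" for \<xi> :: "'k mink"
  have [measurable]: "(\<lambda>\<xi>. ennreal (N \<xi>)) \<in> borel_measurable (hvol0 :: 'k mink measure)"
  proof -
    have sm: "(snd :: 'k mink \<Rightarrow> _) \<in> borel_measurable borel"
      by (intro borel_measurable_continuous_onI continuous_intros)
    have "(\<lambda>z. ennreal (M * (norm (z - y0) powr e * indicator (ball y0 r) z))) \<in> borel_measurable borel" for M e :: real
      by measurable
    from measurable_compose[OF sm this[of "L * (C * (1 + \<kappa>) powr ?q)" "- (?q - 2)"]]
    have "(\<lambda>\<xi>. ennreal (N \<xi>)) \<in> borel_measurable (restrict_space borel hyperboloid)"
      unfolding N_def by (rule measurable_restrict_space1)
    then show ?thesis by (subst measurable_cong_sets[OF sets_hvol0 refl])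
  qed
  have K1pos: "K1 \<xi> > 0" if "\<xi> \<in> hyperboloid" for \<xi>
    unfolding K1_def using hdist_nonneg[OF that o] by (intro kernel_pos A) simp
  have hsym: "hdist \<xi> origin = hdist origin \<xi>" for \<xi> :: "'k mink"
    by (cases \<xi>) (simp add: hdist_def origin_def)
  have K1m [measurable]: "K1 \<in> borel_measurable hvol0"
  proof -
    have "K1 \<xi> = pos_kernel n s (1 + hdist origin \<xi>)" if "\<xi> \<in> space hvol0" for \<xi>
    proof -
      have "0 < 1 + hdist \<xi> origin" using hdist_nonneg[OF _ o, of \<xi>] that by simp
      then show ?thesis by (simp add: K1_def pos_kernel_def hsym)
    qed
    then have "K1 \<in> borel_measurable hvol0 \<longleftrightarrow> (\<lambda>\<xi>::'k mink. pos_kernel n s (1 + hdist origin \<xi>)) \<in> borel_measurable hvol0"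
      by (rule measurable_cong)
    also have "\<dots>" by measurable
    finally show ?thesis .
  qed
  have bound: "\<bar>?h \<xi>\<bar> \<le> N \<xi> + (\<bar>u ?x\<bar> * H * K1 \<xi> + H * (\<bar>u \<xi>\<bar> * K1 \<xi>))"
    if \<xi>: "\<xi> \<in> hyperboloid" and eq: "u \<xi> = u' \<xi>" for \<xi>
  proof (cases "\<xi> = ?x")
    case True
    then show ?thesis using eq C H L K1pos[OF \<xi>] by (auto simp: N_def)
  next
    case False
    obtain z where z: "\<xi> = chart z" using \<xi> unfolding range_chart[symmetric] by blast
    have sz: "snd \<xi> = z" by (simp add: z chart_def)
    have zy: "z \<noteq> y0" using False z by auto
    define d where "d = hdist ?x \<xi>"
    have d: "d > 0" unfolding d_def by (rule hdist_pos) (use \<xi> False in auto)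
    have low: "min 1 (norm (z - y0)) / \<kappa> \<le> d"
      using hdist_chart_lower[of y0 z] by (simp add: d_def z \<kappa>_def norm_minus_commute)
    have h: "\<bar>?h \<xi>\<bar> = \<bar>u ?x - u \<xi>\<bar> * kernel n s d"
      using d kernel_pos[OF A d] by (simp add: eq pos_kernel_def abs_mult flip: d_def)
    show ?thesis
    proof (cases "z \<in> ball y0 r")
      case True
      let ?w = "norm (z - y0)"
      have w: "0 < ?w" "?w \<le> 1" using True r zy by (auto simp: dist_norm norm_minus_commute)
      \<comment> \<open>As w <= 1, both 1/d <= \<kappa>/w and 1 <= 1/w hold, which turns powers of 1
        + 1/d into powers of the Euclidean distance.\<close>
      have "1 + 1 / d \<le> (1 + \<kappa>) / ?w"
      proof -
        have "?w / \<kappa> \<le> d" using low w by simp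
        then have "1 / d \<le> \<kappa> / ?w" using w kap d by (simp add: field_simps)
        moreover have "1 \<le> 1 / ?w" using w by simp
        ultimately show ?thesis by (simp add: add_divide_distrib)
      qed
      then have "(1 + 1 / d) powr ?q \<le> ((1 + \<kappa>) / ?w) powr ?q" using d A by (intro powr_mono2) auto
      also have "\<dots> = (1 + \<kappa>) powr ?q * ?w powr (- ?q)" by (simp only: powr_divide powr_minus) (simp only: divide_inverse)
      finally have q: "(1 + 1 / d) powr ?q \<le> (1 + \<kappa>) powr ?q * ?w powr (- ?q)" .
      have "kernel n s d \<le> C * exp (- ((real n - 1) * d)) * (1 + d) powr (- 1 - s) * (1 + 1 / d) powr ?q"
        by (rule C(2)[OF d])
      also have "\<dots> \<le> C * 1 * 1 * ((1 + \<kappa>) powr ?q * ?w powr (- ?q))"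
      proof (intro mult_mono q order_refl)
        show "exp (- ((real n - 1) * d)) \<le> 1" using A d by simp
        have "(1 + d) powr (- 1 - s) \<le> (1 + d) powr 0" using d A by (intro powr_mono) auto
        then show "(1 + d) powr (- 1 - s) \<le> 1" using d by simp
      qed (use C in auto)
      finally have K: "kernel n s d \<le> C * (1 + \<kappa>) powr ?q * ?w powr (- ?q)" by simp
      have "\<bar>?h \<xi>\<bar> \<le> (L * ?w\<^sup>2) * (C * (1 + \<kappa>) powr ?q * ?w powr (- ?q))"
        unfolding h using quad[OF True] kernel_pos[OF A d] L by (intro mult_mono K) (auto simp: z)
      also have "\<dots> = L * (C * (1 + \<kappa>) powr ?q) * (?w powr (- ?q) * ?w powr 2)"
        using w by simp
      also have "?w powr (- ?q) * ?w powr 2 = ?w powr (- (?q - 2))"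
        by (subst powr_add[symmetric]) (rule arg_cong[where f = "\<lambda>e. ?w powr e"], simp)
      also have "L * (C * (1 + \<kappa>) powr ?q) * ?w powr (- (?q - 2)) = N \<xi>"
        using True by (simp add: N_def sz)
      also have "N \<xi> \<le> N \<xi> + (\<bar>u ?x\<bar> * H * K1 \<xi> + H * (\<bar>u \<xi>\<bar> * K1 \<xi>))"
        using H K1pos[OF \<xi>] by simp
      finally show ?thesis .
    next
      case False
      then have "r \<le> min 1 (norm (z - y0))" using r by (auto simp: dist_norm norm_minus_commute)
      then have "r / \<kappa> \<le> min 1 (norm (z - y0)) / \<kappa>" using kap by (intro divide_right_mono) auto
      then have "r / \<kappa> \<le> d" using low by linarith
      moreover have "0 < 1 + hdist \<xi> origin" using hdist_nonneg[OF \<xi> o] by simp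
      moreover have "1 + hdist \<xi> origin \<le> d + (1 + hdist ?x origin)"
        using hdist_triangle_origin(2)[of ?x \<xi>] \<xi> by (simp add: d_def)
      ultimately have K: "kernel n s d \<le> H * K1 \<xi>" unfolding K1_def by (rule H(2))
      have "\<bar>?h \<xi>\<bar> \<le> (\<bar>u ?x\<bar> + \<bar>u \<xi>\<bar>) * (H * K1 \<xi>)"
        unfolding h using kernel_pos[OF A d] by (intro mult_mono K) auto
      also have "\<dots> = \<bar>u ?x\<bar> * H * K1 \<xi> + H * (\<bar>u \<xi>\<bar> * K1 \<xi>)" by (simp add: algebra_simps)
      also have "\<dots> \<le> N \<xi> + \<dots>" using L C by (simp add: N_def)
      finally show ?thesis .
    qed
  qed
  have fN: "(\<integral>\<^sup>+\<xi>. ennreal (N \<xi>) \<partial>hvol0) < \<infinity>"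
  proof -
    let ?M = "L * (C * (1 + \<kappa>) powr ?q)"
    have "(\<integral>\<^sup>+\<xi>. ennreal (N \<xi>) \<partial>hvol0) = (\<integral>\<^sup>+y. ennreal (1 / sqrt (1 + (norm y)\<^sup>2)) * ennreal (N (chart y)) \<partial>lborel)"
      by (rule nn_integral_hvol0) measurable
    also have "\<dots> \<le> (\<integral>\<^sup>+y. ennreal ?M * (ennreal (norm (y - y0) powr (- (?q - 2))) * indicator (ball y0 r) y) \<partial>lborel)"
    proof (rule nn_integral_mono)
      fix y :: "real \<times> (real ^ 'k)"
      have "1 / sqrt (1 + (norm y)\<^sup>2) \<le> 1" using one_plus_norm_sq_pos[of y] by (simp add: divide_le_eq)
      then have "ennreal (1 / sqrt (1 + (norm y)\<^sup>2)) * ennreal (N (chart y)) \<le> 1 * ennreal (N (chart y))"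
        by (intro mult_right_mono) (simp_all flip: ennreal_1 add: ennreal_leI)
      also have "\<dots> = ennreal ?M * (ennreal (norm (y - y0) powr (- (?q - 2))) * indicator (ball y0 r) y)"
        using L C by (auto simp: N_def chart_def indicator_def ennreal_mult''[symmetric] ennreal_mult'[symmetric])
      finally show "ennreal (1 / sqrt (1 + (norm y)\<^sup>2)) * ennreal (N (chart y))
         \<le> ennreal ?M * (ennreal (norm (y - y0) powr (- (?q - 2))) * indicator (ball y0 r) y)" .
    qed
    also have "\<dots> = ennreal ?M * (\<integral>\<^sup>+y\<in>ball y0 r. ennreal (norm (y - y0) powr (- (?q - 2))) \<partial>lborel)"
    proof (rule nn_integral_cmult)
      have "(\<lambda>z. ennreal (norm (z - y0) powr e) * indicator (ball y0 r) z) \<in> borel_measurable lborel" for e :: real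
        by measurable
      then show "(\<lambda>y. ennreal (norm (y - y0) powr (- (?q - 2))) * indicator (ball y0 r) y) \<in> borel_measurable lborel" .
    qed
    also have "\<dots> < \<infinity>"
    proof -
      have "(\<integral>\<^sup>+y\<in>ball y0 r. ennreal (norm (y - y0) powr (- (?q - 2))) \<partial>lborel) < \<infinity>"
        by (rule nn_integral_norm_powr_ball_finite) (use r n A in auto)
      then show ?thesis by (simp add: ennreal_mult_less_top)
    qed
    finally show ?thesis .
  qed
  have fK: "(\<integral>\<^sup>+\<xi>. ennreal (K1 \<xi>) \<partial>hvol0) < \<infinity>"
    unfolding K1_def using nn_integral_kernel_finite[OF A k] .
  have fu: "(\<integral>\<^sup>+\<xi>. ennreal (\<bar>u' \<xi>\<bar> * K1 \<xi>) \<partial>hvol0) < \<infinity>"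
  proof -
    have "(\<integral>\<^sup>+\<xi>. ennreal (\<bar>u' \<xi>\<bar> * K1 \<xi>) \<partial>hvol0) = (\<integral>\<^sup>+\<xi>. ennreal (\<bar>u \<xi>\<bar> * K1 \<xi>) \<partial>hvol0)"
      by (rule nn_integral_cong_AE) (use ae in eventually_elim, simp)
    then show ?thesis using u by (simp add: K1_def)
  qed
  show ?thesis
  proof (rule integrableI_bounded)
    have "(\<integral>\<^sup>+\<xi>. ennreal (norm (?h \<xi>)) \<partial>hvol0)
       \<le> (\<integral>\<^sup>+\<xi>. ennreal (N \<xi>) + (ennreal (\<bar>u ?x\<bar> * H) * ennreal (K1 \<xi>) + ennreal H * ennreal (\<bar>u' \<xi>\<bar> * K1 \<xi>)) \<partial>hvol0)"
    proof (rule nn_integral_mono_AE)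
      show "AE \<xi> in hvol0. ennreal (norm (?h \<xi>)) \<le> ennreal (N \<xi>) + (ennreal (\<bar>u ?x\<bar> * H) * ennreal (K1 \<xi>) + ennreal H * ennreal (\<bar>u' \<xi>\<bar> * K1 \<xi>))"
        using ae AE_space
      proof eventually_elim
        case (elim \<xi>)
        then have \<xi>: "\<xi> \<in> hyperboloid" by simp
        have N0: "0 \<le> N \<xi>" using L C by (simp add: N_def)
        have "ennreal (norm (?h \<xi>)) \<le> ennreal (N \<xi> + (\<bar>u ?x\<bar> * H * K1 \<xi> + H * (\<bar>u' \<xi>\<bar> * K1 \<xi>)))"
          using bound[OF \<xi> elim(1)] elim(1) by (intro ennreal_leI) simp
        also have "\<dots> = ennreal (N \<xi>) + (ennreal (\<bar>u ?x\<bar> * H) * ennreal (K1 \<xi>) + ennreal H * ennreal (\<bar>u' \<xi>\<bar> * K1 \<xi>))"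
          using N0 H K1pos[OF \<xi>] by (simp add: ennreal_plus ennreal_mult')
        finally show ?case .
      qed
    qed
    also have "\<dots> = (\<integral>\<^sup>+\<xi>. ennreal (N \<xi>) \<partial>hvol0) + (ennreal (\<bar>u ?x\<bar> * H) * (\<integral>\<^sup>+\<xi>. ennreal (K1 \<xi>) \<partial>hvol0)
        + ennreal H * (\<integral>\<^sup>+\<xi>. ennreal (\<bar>u' \<xi>\<bar> * K1 \<xi>) \<partial>hvol0))"
      by (subst nn_integral_add, simp, simp, subst nn_integral_add, simp, simp, subst nn_integral_cmult, simp, subst nn_integral_cmult) auto
    also have "\<dots> < \<infinity>" using fN fK fu by (simp add: ennreal_mult_less_top)
    finally show "(\<integral>\<^sup>+\<xi>. ennreal (norm (?h \<xi>)) \<partial>hvol0) < \<infinity>" .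
  qed measurable
qed

text \<open>
  \<open>u'\<close> is needed because the hyperbolic volume is completed, while the change to Fermi coordinates
  is available for the Borel measure \<open>hvol0\<close>.
\<close>

lemma frac_laplacian_eq_integral:
  fixes u u' :: "'k::finite mink \<Rightarrow> real"
  assumes A: "n \<ge> 2" "0 < s" "s < 1" and x: "x \<in> hyperboloid"
    and um: "u \<in> borel_measurable hvol"
    and u' [measurable]: "u' \<in> borel_measurable hvol0" and ae: "AE \<xi> in hvol0. u \<xi> = u' \<xi>"
    and int: "integrable hvol0 (\<lambda>\<xi>. (u x - u' \<xi>) * pos_kernel n s (hdist x \<xi>))"
  shows "integrable lborel (\<lambda>p. (u x - u' (fermi p)) * pos_kernel n s (hdist x (fermi p)))"
    and "frac_laplacian C n s u x = C * (LINT p|lborel. (u x - u' (fermi p)) * pos_kernel n s (hdist x (fermi p)))"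
proof -
  let ?h = "\<lambda>\<xi>. (u x - u' \<xi>) * pos_kernel n s (hdist x \<xi>)"
  note [measurable] = borel_pos_kernel[OF A]
  have hm: "?h \<in> borel_measurable (hvol0 :: 'k mink measure)" by measurable
  then have hr: "?h \<in> borel_measurable (restrict_space borel hyperboloid)"
    by (simp cong: measurable_cong_sets add: sets_hvol0)
  have fm: "(fermi :: _ \<Rightarrow> 'k mink) \<in> lborel \<rightarrow>\<^sub>M restrict_space borel hyperboloid" by simp
  show i: "integrable lborel (\<lambda>p. ?h (fermi p))"
    using int unfolding hvol0_eq_fermi by (subst (asm) integrable_distr_eq[OF fm hr])
  have e: "integral\<^sup>L hvol0 ?h = (LINT p|lborel. ?h (fermi p))"
    unfolding hvol0_eq_fermi by (rule integral_distr[OF fm hr])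
  \<comment> \<open>For \<epsilon> > 0 the truncated domain excludes distance 0, so
    \<open>kernel\<close> may be replaced by the measurable \<open>pos_kernel\<close>, and then
    \<open>u\<close> by \<open>u'\<close> almost everywhere.\<close>
  have trunc: "(LINT \<xi>:{\<xi> \<in> hyperboloid. \<epsilon> \<le> hdist x \<xi>}|hvol. (u x - u \<xi>) * kernel n s (hdist x \<xi>))
     = (LINT \<xi>|hvol0. indicator {\<epsilon>..} (hdist x \<xi>) * ?h \<xi>)" if "\<epsilon> > 0" for \<epsilon> :: real
  proof -
    have m0: "(\<lambda>\<xi>. indicator {\<epsilon>..} (hdist x \<xi>) * ?h \<xi>) \<in> borel_measurable (hvol0 :: 'k mink measure)" by measurable
    have eqs: "indicator {\<xi> \<in> hyperboloid. \<epsilon> \<le> hdist x \<xi>} \<xi> *\<^sub>R ((u x - u \<xi>) * kernel n s (hdist x \<xi>))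
        = indicator {\<epsilon>..} (hdist x \<xi>) * ((u x - u \<xi>) * pos_kernel n s (hdist x \<xi>))" if "\<xi> \<in> hyperboloid" for \<xi>
      using that \<open>\<epsilon> > 0\<close> by (auto simp: indicator_def pos_kernel_def)
    have "(LINT \<xi>:{\<xi> \<in> hyperboloid. \<epsilon> \<le> hdist x \<xi>}|hvol. (u x - u \<xi>) * kernel n s (hdist x \<xi>))
        = (LINT \<xi>|hvol. indicator {\<epsilon>..} (hdist x \<xi>) * ((u x - u \<xi>) * pos_kernel n s (hdist x \<xi>)))"
      unfolding set_lebesgue_integral_def
      by (rule Bochner_Integration.integral_cong) (use eqs in \<open>auto simp: hvol_eq\<close>)
    also have "\<dots> = (LINT \<xi>|hvol. indicator {\<epsilon>..} (hdist x \<xi>) * ?h \<xi>)"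
    proof (rule integral_cong_AE)
      show "(\<lambda>\<xi>. indicator {\<epsilon>..} (hdist x \<xi>) * ?h \<xi>) \<in> borel_measurable hvol"
        unfolding hvol_eq by (rule measurable_completion[OF m0])
      have "(\<lambda>\<xi>. indicator {\<epsilon>..} (hdist x \<xi>) * pos_kernel n s (hdist x \<xi>)) \<in> borel_measurable (hvol0 :: 'k mink measure)"
        by measurable
      then have "(\<lambda>\<xi>. indicator {\<epsilon>..} (hdist x \<xi>) * pos_kernel n s (hdist x \<xi>)) \<in> borel_measurable (hvol :: 'k mink measure)"
        unfolding hvol_eq by (rule measurable_completion)
      then have "(\<lambda>\<xi>. (u x - u \<xi>) * (indicator {\<epsilon>..} (hdist x \<xi>) * pos_kernel n s (hdist x \<xi>))) \<in> borel_measurable hvol"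
        by (rule borel_measurable_times[OF borel_measurable_diff[OF borel_measurable_const um]])
      then show "(\<lambda>\<xi>. indicator {\<epsilon>..} (hdist x \<xi>) * ((u x - u \<xi>) * pos_kernel n s (hdist x \<xi>))) \<in> borel_measurable hvol"
        by (simp only: mult.left_commute)
      show "AE \<xi> in hvol. indicator {\<epsilon>..} (hdist x \<xi>) * ((u x - u \<xi>) * pos_kernel n s (hdist x \<xi>)) = indicator {\<epsilon>..} (hdist x \<xi>) * ?h \<xi>"
        using AE_completion[OF ae] unfolding hvol_eq by eventually_elim simp
    qed
    also have "\<dots> = (LINT \<xi>|hvol0. indicator {\<epsilon>..} (hdist x \<xi>) * ?h \<xi>)"
      unfolding hvol_eq by (rule integral_completion[OF m0])
    finally show ?thesis .
  qed
  \<comment> \<open>The principal value is a genuine limit: the absolutely integrable full integrand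
    dominates every truncation.\<close>
  have "((\<lambda>\<epsilon>. LINT \<xi>:{\<xi> \<in> hyperboloid. \<epsilon> \<le> hdist x \<xi>}|hvol. (u x - u \<xi>) * kernel n s (hdist x \<xi>)) \<longlongrightarrow> integral\<^sup>L hvol0 ?h) (at_right 0)"
  proof (rule tendsto_at_right_sequentially[of 0 1])
    fix S :: "nat \<Rightarrow> real" assume S: "\<And>n. 0 < S n" "S \<longlonglongrightarrow> 0"
    have "(\<lambda>j. LINT \<xi>|hvol0. indicator {S j..} (hdist x \<xi>) * ?h \<xi>) \<longlonglongrightarrow> integral\<^sup>L hvol0 ?h"
    proof (rule integral_dominated_convergence[where w = "\<lambda>\<xi>. norm (?h \<xi>)"])
      show "integrable hvol0 (\<lambda>\<xi>. norm (?h \<xi>))" using int by (rule integrable_norm)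
      show "AE \<xi> in hvol0. (\<lambda>j. indicator {S j..} (hdist x \<xi>) * ?h \<xi>) \<longlonglongrightarrow> ?h \<xi>"
      proof (rule AE_I2)
        fix \<xi> :: "'k mink"
        show "(\<lambda>j. indicator {S j..} (hdist x \<xi>) * ?h \<xi>) \<longlonglongrightarrow> ?h \<xi>"
        \<comment> \<open>Without positive distance both sides vanish, because
          \<open>pos_kernel\<close> is 0 there.\<close>
        proof (cases "hdist x \<xi> > 0")
          case True
          then have "eventually (\<lambda>j. S j < hdist x \<xi>) sequentially" using S(2) by (rule order_tendstoD(2)[rotated])
          then have "eventually (\<lambda>j. indicator {S j..} (hdist x \<xi>) * ?h \<xi> = ?h \<xi>) sequentially"
            by eventually_elim simp
          then show ?thesis by (rule tendsto_eventually)
        qed (simp add: pos_kernel_def)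
      qed
    qed (auto simp: indicator_def)
    then show "(\<lambda>j. LINT \<xi>:{\<xi> \<in> hyperboloid. S j \<le> hdist x \<xi>}|hvol. (u x - u \<xi>) * kernel n s (hdist x \<xi>)) \<longlonglongrightarrow> integral\<^sup>L hvol0 ?h"
      by (simp only: trunc[OF S(1)])
  qed simp
  then have "Lim (at_right 0) (\<lambda>\<epsilon>. LINT \<xi>:{\<xi> \<in> hyperboloid. \<epsilon> \<le> hdist x \<xi>}|hvol. (u x - u \<xi>) * kernel n s (hdist x \<xi>)) = integral\<^sup>L hvol0 ?h"
    by (rule tendsto_Lim[rotated]) simp
  then show "frac_laplacian C n s u x = C * (LINT p|lborel. ?h (fermi p))"
    by (simp add: frac_laplacian_def e)
qed

section \<open>The minimum of an antisymmetric function\<close>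

text \<open>The part over t > lam is carried to t < lam by the reflection, which preserves Lebesgue
  measure; the leaf t = lam is a hyperplane in these coordinates, hence null.\<close>

lemma integral_halves:
  fixes h :: "real \<times> 'a::euclidean_space \<Rightarrow> real"
  assumes h: "integrable lborel h"
  shows "integrable lborel (\<lambda>p. indicator {..<lam} (fst p) * (h p + h (param_refl lam p)))"
    and "integral\<^sup>L lborel h = (LINT p|lborel. indicator {..<lam} (fst p) * (h p + h (param_refl lam p)))"
proof -
  let ?T = "param_refl lam :: real \<times> 'a \<Rightarrow> real \<times> 'a"
  have [measurable]: "h \<in> borel_measurable borel" using borel_measurable_integrable[OF h] by simp
  have [measurable]: "(fst :: real \<times> 'a \<Rightarrow> real) \<in> borel_measurable borel"
    by (intro borel_measurable_continuous_onI continuous_intros)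
  have T: "?T \<in> lborel \<rightarrow>\<^sub>M borel" by simp
  have i1: "integrable lborel (\<lambda>p. indicator {..<lam} (fst p) * h p)"
    by (rule Bochner_Integration.integrable_bound[OF h]) (auto simp: indicator_def)
  have i2: "integrable lborel (\<lambda>p. indicator {lam<..} (fst p) * h p)"
    by (rule Bochner_Integration.integrable_bound[OF h]) (auto simp: indicator_def)
  have ind: "indicator {lam<..} (fst (?T p)) = (indicator {..<lam} (fst p) :: real)" for p
    by (auto simp: param_refl_def indicator_def split: prod.splits)
  have m2: "(\<lambda>p. indicator {lam<..} (fst p) * h p) \<in> borel_measurable borel" by measurable
  have i3: "integrable lborel (\<lambda>p. indicator {..<lam} (fst p) * h (?T p))"
    using i2 by (subst (asm) distr_param_refl[of lam, symmetric], subst (asm) integrable_distr_eq[OF T m2]) (simp only: ind)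
  have e3: "(LINT p|lborel. indicator {lam<..} (fst p) * h p) = (LINT p|lborel. indicator {..<lam} (fst p) * h (?T p))"
    by (subst distr_param_refl[of lam, symmetric], subst integral_distr[OF T m2]) (simp only: ind)
  show "integrable lborel (\<lambda>p. indicator {..<lam} (fst p) * (h p + h (?T p)))"
    using Bochner_Integration.integrable_add[OF i1 i3] by (simp add: distrib_left)
  have null: "AE p in (lborel :: (real \<times> 'a) measure). fst p \<noteq> lam"
  proof -
    have "{p :: real \<times> 'a. fst p = lam} \<in> null_sets lborel"
    proof -
      have "negligible {p :: real \<times> 'a. p \<bullet> (1, 0) = lam}"
        by (rule negligible_standard_hyperplane) (simp add: Basis_prod_def)
      moreover have "{p :: real \<times> 'a. p \<bullet> (1, 0) = lam} = {p. fst p = lam}" by (auto simp: inner_prod_def)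
      moreover have "closed {p :: real \<times> 'a. fst p = lam}" by (intro closed_Collect_eq continuous_intros)
      ultimately show ?thesis by (simp add: negligible_iff_null_sets null_sets_completion_iff borel_closed)
    qed
    then show ?thesis by (rule AE_I') auto
  qed
  have "integral\<^sup>L lborel h = (LINT p|lborel. indicator {..<lam} (fst p) * h p + indicator {lam<..} (fst p) * h p)"
  proof (rule integral_cong_AE)
    show "AE p in lborel. h p = indicator {..<lam} (fst p) * h p + indicator {lam<..} (fst p) * h p"
      using null by eventually_elim (auto simp: indicator_def)
  qed (use borel_measurable_integrable[OF h] borel_measurable_integrable[OF i1] borel_measurable_integrable[OF i2]
       in \<open>auto intro: borel_measurable_add\<close>)
  also have "\<dots> = (LINT p|lborel. indicator {..<lam} (fst p) * h p) + (LINT p|lborel. indicator {lam<..} (fst p) * h p)"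
    by (rule Bochner_Integration.integral_add[OF i1 i2])
  also have "\<dots> = (LINT p|lborel. indicator {..<lam} (fst p) * h p + indicator {..<lam} (fst p) * h (?T p))"
    unfolding e3 by (rule Bochner_Integration.integral_add[OF i1 i3, symmetric])
  finally show "integral\<^sup>L lborel h = (LINT p|lborel. indicator {..<lam} (fst p) * (h p + h (?T p)))"
    by (simp add: distrib_left)
qed

text \<open>Any bounded part of the half-space of positive measure would do; this one has, for every
  \<open>lam\<close>, the volume of the unit ball of dimension n - 1.\<close>

definition slab :: "real \<Rightarrow> (real \<times> (real ^ 'k::finite)) set" where
  "slab lam = {lam - 1<..<lam} \<times> ball 0 1"

lemma emeasure_slab:
  "emeasure lborel (slab lam :: (real \<times> (real ^ 'k::finite)) set) = ennreal (unit_ball_vol CARD('k))"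
proof -
  have "emeasure lborel (slab lam :: (real \<times> (real ^ 'k)) set) = emeasure lborel {lam - 1<..<lam} * emeasure lborel (ball (0 :: real ^ 'k) 1)"
    unfolding slab_def lborel_prod[symmetric] by (rule lborel.emeasure_pair_measure_Times) auto
  then show ?thesis by (simp add: emeasure_ball)
qed

text \<open>The reflection moves t to a value between lam and lam + 1, and |z| < 1, so cosh of the
  distance to the origin is at most 2 cosh(|lam| + 1).\<close>

lemma hdist_slab_origin:
  obtains R where "R > 0" "\<And>p :: real \<times> (real ^ 'k::finite). p \<in> slab lam \<Longrightarrow> hdist (fermi (param_refl lam p)) origin \<le> R"
proof
  let ?R = "arcosh (2 * cosh (\<bar>lam\<bar> + 1))"
  have R1: "2 * cosh (\<bar>lam\<bar> + 1) > 1" using cosh_real_ge_1[of "\<bar>lam\<bar> + 1"] by linarith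
  then show R: "?R > 0" by simp
  fix p :: "real \<times> (real ^ 'k)" assume p: "p \<in> slab lam"
  obtain t z where tz: "p = (t, z)" by (cases p)
  have t: "lam - 1 < t" "t < lam" and z: "norm z < 1" using p by (auto simp: slab_def tz)
  have o: "(origin :: 'k mink) = fermi (0, 0)" by (simp add: origin_def fermi_def)
  have "cosh (hdist (fermi (2 * lam - t, z)) (origin :: 'k mink)) = sqrt (1 + (norm z)\<^sup>2) * cosh (2 * lam - t)"
    unfolding o cosh_hdist_fermi by simp
  also have "\<dots> \<le> 2 * cosh (\<bar>lam\<bar> + 1)"
  proof (rule mult_mono)
    have "(norm z)\<^sup>2 \<le> 1" using z by (simp add: power_le_one)
    then have "sqrt (1 + (norm z)\<^sup>2) \<le> sqrt 4" by (intro real_sqrt_le_mono) simp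
    then show "sqrt (1 + (norm z)\<^sup>2) \<le> 2" by simp
    have "cosh \<bar>2 * lam - t\<bar> \<le> cosh (\<bar>lam\<bar> + 1)" using t by (subst cosh_real_nonneg_le_iff) auto
    then show "cosh (2 * lam - t) \<le> cosh (\<bar>lam\<bar> + 1)" by simp
  qed auto
  also have "\<dots> = cosh ?R" using R1 by (simp add: cosh_arcosh_real)
  finally have "hdist (fermi (2 * lam - t, z)) (origin :: 'k mink) \<le> ?R"
    by (rule cosh_le_cosh_imp) (use R in simp)
  then show "hdist (fermi (param_refl lam p)) origin \<le> ?R" by (simp add: param_refl_def tz)
qed

text \<open>For \<xi> and its mirror image, with kernel values K >= K', antisymmetry turns the sum
  of the two integrands into (u(x) - u(\<xi>))(K - K') + 2 u(x) K'. The first term is <= 0 by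
  minimality; the second is negative and is kept only on the slab, where the distance to the mirror
  image is at most d(x,o) + R.\<close>

lemma antisymmetric_minimum_bound:
  fixes u u' :: "'k::finite mink \<Rightarrow> real"
  assumes A: "n \<ge> 2" "0 < s" "s < 1"
    and x: "x \<in> Sigma_half lam" and ux: "u x < 0"
    and min: "\<And>\<xi>. \<xi> \<in> Sigma_half lam \<Longrightarrow> u x \<le> u \<xi>"
    and anti: "\<And>\<xi>. \<xi> \<in> Sigma_half lam \<Longrightarrow> u (hrefl lam \<xi>) = - u \<xi>"
    and u' [measurable]: "u' \<in> borel_measurable hvol0" and ae: "AE \<xi> in hvol0. u \<xi> = u' \<xi>"
    and int: "integrable lborel (\<lambda>p. (u x - u' (fermi p)) * pos_kernel n s (hdist x (fermi p)))"
    and R: "R > 0" "\<And>p :: real \<times> (real ^ 'k). p \<in> slab lam \<Longrightarrow> hdist (fermi (param_refl lam p)) origin \<le> R"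
  shows "(LINT p|lborel. (u x - u' (fermi p)) * pos_kernel n s (hdist x (fermi p)))
     \<le> 2 * u x * kernel n s (hdist x origin + R) * unit_ball_vol CARD('k)"
proof -
  let ?h = "\<lambda>p. (u x - u' (fermi p)) * pos_kernel n s (hdist x (fermi p))"
  let ?k0 = "kernel n s (hdist x origin + R)"
  let ?T = "param_refl lam :: real \<times> (real ^ 'k) \<Rightarrow> _"
  let ?S = "slab lam :: (real \<times> (real ^ 'k)) set"
  have o: "(origin :: 'k mink) \<in> hyperboloid" by (simp add: origin_eq_chart)
  obtain tx zx where xe: "x = fermi (tx, zx)" and tx: "tx < lam" using x unfolding Sigma_half_eq by auto
  have xH: "x \<in> hyperboloid" by (simp add: xe)
  have fm: "(fermi :: _ \<Rightarrow> 'k mink) \<in> lborel \<rightarrow>\<^sub>M restrict_space borel hyperboloid" by simp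
  obtain N where N: "N \<in> null_sets hvol0" "{\<xi> \<in> space hvol0. u \<xi> \<noteq> u' \<xi>} \<subseteq> N"
    using ae unfolding eventually_ae_filter by blast
  have Nin: "fermi p \<in> N" if "u' (fermi p) \<noteq> u (fermi p)" for p
    using N(2) that fermi_in_hyperboloid[of p] unfolding space_hvol0 by force
  have N': "N \<in> sets (restrict_space borel hyperboloid)" using N(1) by (simp add: null_sets_def sets_hvol0)
  have "fermi -` N \<in> null_sets lborel"
  proof -
    have "emeasure hvol0 N = 0" using N(1) by (rule null_setsD1)
    then show ?thesis
      using measurable_sets[OF fm N'] unfolding hvol0_eq_fermi emeasure_distr[OF fm N'] by (simp add: null_sets_def)
  qed
  then have ae1: "AE p in lborel. u' (fermi p) = u (fermi p)"
    by (rule AE_I') (use Nin in blast)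
  \<comment> \<open>The exceptional set has to be avoided at the mirror point too; the reflection
    preserves null sets.\<close>
  have ae2: "AE p in lborel. u' (fermi (?T p)) = u (fermi (?T p))"
  proof -
    have "?T -` (fermi -` N) \<in> null_sets lborel"
    proof -
      have s: "fermi -` N \<in> sets borel" using measurable_sets[OF fm N'] by simp
      have "emeasure (distr lborel borel ?T) (fermi -` N) = 0"
        using null_setsD1[OF \<open>fermi -` N \<in> null_sets lborel\<close>] by (simp add: distr_param_refl)
      then show ?thesis
        using s measurable_sets[OF measurable_param_refl s, of lam] by (subst (asm) emeasure_distr) (auto simp: null_sets_def)
    qed
    then show ?thesis by (rule AE_I') (use Nin in blast)
  qed
  \<comment> \<open>The parameter of x itself is excluded, since monotonicity of the kernel is known
    only at positive distances.\<close>
  have pt: "indicator {..<lam} (fst p) * (?h p + ?h (?T p)) \<le> indicator ?S p * (2 * u x * ?k0)"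
    if e1: "u' (fermi p) = u (fermi p)" and e2: "u' (fermi (?T p)) = u (fermi (?T p))" and ne: "p \<noteq> (tx, zx)" for p
  proof (cases "fst p < lam")
    case False
    then show ?thesis by (auto simp: indicator_def slab_def)
  next
    case True
    obtain t z where p: "p = (t, z)" by (cases p)
    have t: "t < lam" using True by (simp add: p)
    have S: "fermi p \<in> Sigma_half lam" using True by (auto simp: Sigma_half_eq p)
    have Tp: "?T p = (2 * lam - t, z)" by (simp add: param_refl_def p)
    have un: "u (fermi (?T p)) = - u (fermi p)" unfolding Tp using anti[OF S] by (simp add: p hrefl_fermi)
    define d where "d = hdist x (fermi p)"
    define d' where "d' = hdist x (fermi (?T p))"
    have "x \<noteq> fermi p" using ne injD[OF inj_fermi, of "(tx, zx)" p] by (auto simp: xe)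
    then have d: "d > 0" unfolding d_def by (intro hdist_pos xH) auto
    have dd: "d \<le> d'" unfolding d_def d'_def xe p Tp[unfolded p] by (rule hdist_fermi_mono) (use t tx in auto)
    have d': "d' > 0" using d dd by linarith
    have KK: "kernel n s d' \<le> kernel n s d" by (rule kernel_bounds(3)[OF A d dd])
    have "?h p + ?h (?T p) = (u x - u (fermi p)) * kernel n s d + (u x + u (fermi p)) * kernel n s d'"
      using d d' by (simp add: e1 e2 un pos_kernel_def flip: d_def d'_def)
    also have "\<dots> = (u x - u (fermi p)) * (kernel n s d - kernel n s d') + 2 * u x * kernel n s d'"
      by (simp add: algebra_simps)
    also have "\<dots> \<le> 0 + 2 * u x * kernel n s d'"
      using min[OF S] KK by (intro add_right_mono mult_nonpos_nonneg) auto
    finally have *: "?h p + ?h (?T p) \<le> 2 * u x * kernel n s d'" by simp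
    show ?thesis
    proof (cases "p \<in> slab lam")
      case True
      have "d' \<le> hdist x origin + R"
        using hdist_triangle_origin(1)[OF xH fermi_in_hyperboloid, of "?T p"] R(2)[OF True] unfolding d'_def by linarith
      then have "?k0 \<le> kernel n s d'" by (rule kernel_bounds(3)[OF A d'])
      then have "2 * u x * kernel n s d' \<le> 2 * u x * ?k0" using ux by (intro mult_left_mono_neg) auto
      then show ?thesis using * True t by (simp add: p)
    next
      case False
      have "2 * u x * kernel n s d' \<le> 0" using ux kernel_pos[OF A d'] by (simp add: mult_nonpos_nonneg)
      then show ?thesis using * False t by (simp add: p)
    qed
  qed
  have vol: "emeasure lborel (slab lam :: (real \<times> (real ^ 'k)) set) < \<infinity>" by (simp add: emeasure_slab)
  have sl: "(slab lam :: (real \<times> (real ^ 'k)) set) \<in> sets lborel"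
    by (simp add: slab_def open_Times borel_open)
  have "integral\<^sup>L lborel ?h = (LINT p|lborel. indicator {..<lam} (fst p) * (?h p + ?h (?T p)))"
    by (rule integral_halves(2)[OF int])
  also have "\<dots> \<le> (LINT p|lborel. indicator ?S p * (2 * u x * ?k0))"
  proof (rule integral_mono_AE[OF integral_halves(1)[OF int]])
    show "integrable lborel (\<lambda>p. indicator ?S p * (2 * u x * ?k0))"
      using sl vol by (intro integrable_mult_left integrable_real_indicator)
    have "AE p in lborel. p \<noteq> (tx, zx)" by (rule AE_lborel_singleton)
    with ae1 ae2 show "AE p in lborel. indicator {..<lam} (fst p) * (?h p + ?h (?T p)) \<le> indicator ?S p * (2 * u x * ?k0)"
      by eventually_elim (rule pt)
  qed
  also have "\<dots> = 2 * u x * ?k0 * unit_ball_vol CARD('k)"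
    using sl vol by (simp add: measure_def emeasure_slab)
  finally show ?thesis .
qed

section \<open>Contradiction far from the origin\<close>

lemma eventually_at_far_ge:
  fixes F :: "'k::finite mink \<Rightarrow> real"
  assumes "Liminf (at_far \<Omega>) (\<lambda>x. ereal (F x)) \<ge> 0"
  obtains R where "\<And>x. x \<in> \<Omega> \<Longrightarrow> R < hdist x origin \<Longrightarrow> -1 < F x"
proof -
  \<comment> \<open>Any fixed negative number could replace -1: the quantity it is compared with at
    the end is unbounded.\<close>
  have "eventually (\<lambda>x. ereal (- 1) < ereal (F x)) (at_far \<Omega>)"
    using assms unfolding le_Liminf_iff by (metis ereal_less(2) ereal_uminus_eq_reorder less_ereal.simps(1) zero_ereal_def neg_less_0_iff_less zero_less_one)
  then have "eventually (\<lambda>x. x \<in> \<Omega> \<longrightarrow> - 1 < F x) (filtercomap (\<lambda>x. hdist x origin) at_top)"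
    by (simp add: at_far_def eventually_inf_principal)
  then obtain R where "\<And>x. R < hdist x origin \<Longrightarrow> x \<in> \<Omega> \<longrightarrow> - 1 < F x"
    unfolding eventually_filtercomap_at_top_dense by blast
  then show ?thesis by (intro that) blast
qed

theorem theorem5p4:
  fixes n :: nat
  assumes "n \<ge> 2" and "CARD('k::finite) = n - 1"
  shows "\<exists>\<kappa>>0. \<forall>s C. 0 < s \<and> s < 1 \<and> C > 0 \<longrightarrow>
    (\<forall>lam. \<forall>\<Omega> :: 'k mink set. \<forall>c :: 'k mink \<Rightarrow> real.
      unbounded_domain \<Omega> \<and> \<Omega> \<subseteq> Sigma_half lam \<and>
      Liminf (at_far \<Omega>) (\<lambda>x. ereal (hdist x origin powr (real n + 2 * s) *
        exp (\<kappa> * (real n - 1) * hdist x origin) * c x)) \<ge> 0 \<longrightarrow>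
      (\<exists>R0>0. \<forall>u :: 'k mink \<Rightarrow> real. \<forall>x0.
        u \<in> L_space n s \<inter> C11_loc \<Omega> \<and> lower_semicont_on (closure \<Omega>) u \<and>
        (\<forall>x\<in>\<Omega>. frac_laplacian C n s u x + c x * u x \<ge> 0) \<and>
        (\<forall>x\<in>Sigma_half lam - \<Omega>. u x \<ge> 0) \<and>
        (\<forall>x\<in>Sigma_half lam. u (hrefl lam x) = - u x) \<and>
        x0 \<in> \<Omega> \<and> (\<forall>x\<in>\<Omega>. u x0 \<le> u x) \<and> u x0 < 0 \<longrightarrow>
        hdist x0 origin \<le> R0))"
proof (rule exI[of _ "2::real"], intro conjI allI impI)
  show "(2::real) > 0" by simp
  fix s C lam :: real and \<Omega> :: "'k mink set" and c :: "'k mink \<Rightarrow> real"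
  assume "0 < s \<and> s < 1 \<and> C > 0"
  then have A: "n \<ge> 2" "0 < s" "s < 1" and C: "C > 0" using assms by auto
  assume "unbounded_domain \<Omega> \<and> \<Omega> \<subseteq> Sigma_half lam \<and>
      Liminf (at_far \<Omega>) (\<lambda>x. ereal (hdist x origin powr (real n + 2 * s) *
        exp (2 * (real n - 1) * hdist x origin) * c x)) \<ge> 0"
  then have op: "openin (top_of_set hyperboloid) \<Omega>" and sub: "\<Omega> \<subseteq> Sigma_half lam"
    and lim: "Liminf (at_far \<Omega>) (\<lambda>x. ereal (hdist x origin powr (real n + 2 * s) *
        exp (2 * (real n - 1) * hdist x origin) * c x)) \<ge> 0"
    by (auto simp: unbounded_domain_def)
  obtain R1 where R1: "\<And>x. x \<in> \<Omega> \<Longrightarrow> R1 < hdist x origin \<Longrightarrow>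
      - 1 < hdist x origin powr (real n + 2 * s) * exp (2 * (real n - 1) * hdist x origin) * c x"
    using eventually_at_far_ge[OF lim] by blast
  obtain R where R: "R > 0" "\<And>p :: real \<times> (real ^ 'k). p \<in> slab lam \<Longrightarrow> hdist (fermi (param_refl lam p)) origin \<le> R"
    by (rule hdist_slab_origin[where lam = lam and 'k = 'k]) (blast intro: that)
  obtain b where b: "b > 0" "\<And>r. r > 0 \<Longrightarrow> b * exp (- ((real n - 1) * r)) * (1 + r) powr (- 1 - s) \<le> kernel n s r"
    using kernel_bounds(1)[OF A] by blast
  define V where "V = unit_ball_vol CARD('k)"
  have V: "V > 0" by (simp add: V_def)
  \<comment> \<open>Gathers the factors independent of D in the lower bound for 2 C V K(D + R);
    e^(-(n-1)R) is the cost of the shift by R.\<close>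
  define B where "B = 2 * C * V * b * exp (- ((real n - 1) * R))"
  have B: "B > 0" using C V b by (simp add: B_def)
  \<comment> \<open>Beyond \<open>R1\<close> the weighted c exceeds -1; beyond \<open>1 + R\<close>
    one has 1 + D + R <= 2D; beyond \<open>4 / B\<close> the resulting inequality B D / 4 < 1
    fails.\<close>
  define R0 where "R0 = max R1 (max (1 + R) (4 / B))"
  show "\<exists>R0>0. \<forall>u :: 'k mink \<Rightarrow> real. \<forall>x0.
        u \<in> L_space n s \<inter> C11_loc \<Omega> \<and> lower_semicont_on (closure \<Omega>) u \<and>
        (\<forall>x\<in>\<Omega>. frac_laplacian C n s u x + c x * u x \<ge> 0) \<and>
        (\<forall>x\<in>Sigma_half lam - \<Omega>. u x \<ge> 0) \<and>
        (\<forall>x\<in>Sigma_half lam. u (hrefl lam x) = - u x) \<and>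
        x0 \<in> \<Omega> \<and> (\<forall>x\<in>\<Omega>. u x0 \<le> u x) \<and> u x0 < 0 \<longrightarrow>
        hdist x0 origin \<le> R0"
  proof (intro exI[of _ R0] conjI allI impI)
    show "R0 > 0" using R(1) by (simp add: R0_def)
    fix u :: "'k mink \<Rightarrow> real" and x0
    assume H: "u \<in> L_space n s \<inter> C11_loc \<Omega> \<and> lower_semicont_on (closure \<Omega>) u \<and>
        (\<forall>x\<in>\<Omega>. frac_laplacian C n s u x + c x * u x \<ge> 0) \<and>
        (\<forall>x\<in>Sigma_half lam - \<Omega>. u x \<ge> 0) \<and>
        (\<forall>x\<in>Sigma_half lam. u (hrefl lam x) = - u x) \<and>
        x0 \<in> \<Omega> \<and> (\<forall>x\<in>\<Omega>. u x0 \<le> u x) \<and> u x0 < 0"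
    then have x0: "x0 \<in> \<Omega>" and ux: "u x0 < 0" by auto
    have um: "u \<in> borel_measurable hvol"
      and uL: "(\<integral>\<^sup>+ \<xi>. ennreal (\<bar>u \<xi>\<bar> * kernel n s (1 + hdist \<xi> origin)) \<partial>hvol) < \<infinity>"
      using H by (auto simp: L_space_def)
    have xS: "x0 \<in> Sigma_half lam" using x0 sub by blast
    have xH: "x0 \<in> hyperboloid" using xS by (auto simp: Sigma_half_eq)
    obtain y0 where y0: "x0 = chart y0" using xH unfolding range_chart[symmetric] by blast
    \<comment> \<open>Outside \<Omega> the function is nonnegative, so a negative minimum over
      \<Omega> is one over the whole half-space.\<close>
    have min: "u x0 \<le> u \<xi>" if "\<xi> \<in> Sigma_half lam" for \<xi>
    proof (cases "\<xi> \<in> \<Omega>")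
      case False
      then have "0 \<le> u \<xi>" using H that by blast
      then show ?thesis using ux by linarith
    qed (use H in blast)
    obtain u' where u': "u' \<in> borel_measurable hvol0" "AE \<xi> in hvol0. u \<xi> = u' \<xi>"
      using completion_ex_borel_measurable_real[of u hvol0] um unfolding hvol_eq by blast
    obtain r L where rL: "0 < r" "r \<le> 1" "0 \<le> L"
      "\<And>z. z \<in> ball y0 r \<Longrightarrow> \<bar>u (chart y0) - u (chart z)\<bar> \<le> L * (norm (z - y0))\<^sup>2"
      by (rule C11_loc_minimum_quadratic[of u \<Omega> y0]) (use H op y0 in auto)
    have "integrable hvol0 (\<lambda>\<xi>. (u x0 - u' \<xi>) * pos_kernel n s (hdist x0 \<xi>))"
      unfolding y0
      by (rule difference_quotient_integrable[OF A assms(2) _ u' rL])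
         (use uL in \<open>simp add: hvol_eq nn_integral_completion\<close>)
    note fl = frac_laplacian_eq_integral[OF A xH um u' this]
    have "(LINT p|lborel. (u x0 - u' (fermi p)) * pos_kernel n s (hdist x0 (fermi p)))
        \<le> 2 * u x0 * kernel n s (hdist x0 origin + R) * V"
      unfolding V_def
      by (rule antisymmetric_minimum_bound[OF A xS ux min _ u' fl(1) R]) (use H in auto)
    then have "frac_laplacian C n s u x0 \<le> C * (2 * u x0 * kernel n s (hdist x0 origin + R) * V)"
      unfolding fl(2) using C by (intro mult_left_mono) auto
    moreover have "0 \<le> frac_laplacian C n s u x0 + c x0 * u x0" using H by blast
    ultimately have "0 \<le> u x0 * (2 * C * V * kernel n s (hdist x0 origin + R) + c x0)"
      by (simp add: algebra_simps)
    then have cle: "c x0 \<le> - (2 * C * V * kernel n s (hdist x0 origin + R))"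
      using ux by (simp add: zero_le_mult_iff)
    show "hdist x0 origin \<le> R0"
    proof (rule ccontr)
      define D where "D = hdist x0 origin"
      assume "\<not> hdist x0 origin \<le> R0"
      then have D: "R1 < D" "1 + R < D" "4 / B < D" by (auto simp: R0_def D_def)
      have D1: "1 < D" using D R by linarith
      let ?W = "D powr (real n + 2 * s) * exp (2 * (real n - 1) * D)"
      have W: "?W > 0" using D1 by simp
      have "2 * C * V * (b * exp (- ((real n - 1) * (D + R))) * (1 + (D + R)) powr (- 1 - s)) \<le> 2 * C * V * kernel n s (D + R)"
        using C V D1 R by (intro mult_left_mono b) auto
      then have "B * (exp (- ((real n - 1) * D)) * (1 + (D + R)) powr (- 1 - s)) \<le> - c x0"
        using cle by (simp add: B_def D_def algebra_simps exp_add exp_diff exp_minus)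
      then have "?W * (B * (exp (- ((real n - 1) * D)) * (1 + (D + R)) powr (- 1 - s))) \<le> ?W * (- c x0)"
        using W by (intro mult_left_mono) auto
      also have "\<dots> < 1" using R1[OF x0] D by (simp add: D_def)
      finally have less1: "?W * (B * (exp (- ((real n - 1) * D)) * (1 + (D + R)) powr (- 1 - s))) < 1" .
      \<comment> \<open>Since n - 1 >= 1, the spare exponential e^((n-1)D) is at least D.\<close>
      have e: "D \<le> exp (2 * (real n - 1) * D) * exp (- ((real n - 1) * D))"
      proof -
        have "D \<le> exp D" using exp_ge_add_one_self[of D] by linarith
        also have "\<dots> \<le> exp ((real n - 1) * D)" using A D1 by (simp add: mult_le_cancel_right1)
        also have "\<dots> = exp (2 * (real n - 1) * D) * exp (- ((real n - 1) * D))"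
          by (simp add: algebra_simps flip: exp_add)
        finally show ?thesis .
      qed
      \<comment> \<open>Uses -1 - s >= -2 and n + 2s >= 2 to compare with D^2 (2D)^(-2) =
        1/4.\<close>
      have p: "1 / 4 \<le> D powr (real n + 2 * s) * (1 + (D + R)) powr (- 1 - s)"
      proof -
        have "(2 * D) powr (- 2) \<le> (2 * D) powr (- 1 - s)" using D1 A by (intro powr_mono) auto
        also have "\<dots> \<le> (1 + (D + R)) powr (- 1 - s)" using D R A by (intro powr_mono2') auto
        finally have "(2 * D) powr (- 2) \<le> (1 + (D + R)) powr (- 1 - s)" .
        moreover have "D powr 2 \<le> D powr (real n + 2 * s)" using D1 A by (intro powr_mono) auto
        ultimately have "D powr 2 * (2 * D) powr (- 2) \<le> D powr (real n + 2 * s) * (1 + (D + R)) powr (- 1 - s)"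
          by (intro mult_mono) auto
        moreover have "D powr 2 * (2 * D) powr (- 2) = 1 / 4" using D1 by (simp add: powr_minus_divide power_mult_distrib)
        ultimately show ?thesis by simp
      qed
      have "B * (1 / 4 * D) \<le> B * ((D powr (real n + 2 * s) * (1 + (D + R)) powr (- 1 - s))
          * (exp (2 * (real n - 1) * D) * exp (- ((real n - 1) * D))))"
        using B D1 by (intro mult_left_mono mult_mono p e) auto
      also have "\<dots> = ?W * (B * (exp (- ((real n - 1) * D)) * (1 + (D + R)) powr (- 1 - s)))"
        by (simp only: mult_ac)
      finally have "B * (1 / 4 * D) < 1" using less1 by linarith
      moreover have "4 < D * B" using D(3) B by (simp only: pos_divide_less_eq)
      ultimately show False by (simp add: mult.commute)
    qed
  qed
qed

end
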